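(* Let $f:2^V\to\mathbb{R}_{\ge0}$ be a non-negative monotone submodular function, to be maximized subject to a cardinality constraint $k$, where the elements of $V$ arrive in a stream. Let $N$ be the total number of elements in the stream, let $B$ be the buffer size, and let $0<\varepsilon<1/3$ be a constant. Then for the algorithm Batch-Sieve-Streaming++ (described in the context): (i) the approximation factor is $\tfrac12-\tfrac{3\varepsilon}{2}$, i.e. the returned set $S$ satisfies $f(S)\ge\left(\tfrac12-\tfrac{3\varepsilon}{2}\right)\max_{A\subseteq V,\,|A|\le k}f(A)$; (ii) the memory complexity is $O(B+k/\varepsilon)$; (iii) the expected adaptive complexity is $O\!\left(\dfrac{N\log(B)\log(k)}{B\,\varepsilon}\right)$.
   Context: A function $f:2^V\to\mathbb{R}_{\ge0}$ is submodular if $f(A\cup\{e\})-f(A)\ge f(A'\cup\{e\})-f(A')$ for all $A\subseteq A'\subset V$ and $e\in V\setminus A'$; it is monotone if $f(A)\le f(A')$ whenever $A\subseteq A'$. Marginal gain: $f(A\mid S)=f(A\cup S)-f(S)$; write $f_S(A)=f(A\mid S)$. The function is accessed through a value oracle. Memory complexity is the number of elements kept in memory. An algorithm is $\ell$-adaptive if its oracle queries are organized in $\ell$ sequential rounds, where in each round polynomially many queries may be made in parallel and every query of round $i$ is independent of the answers to all other queries of rounds $j$, $i\le j\le\ell$; the adaptive complexity is the number of rounds. The expectation is over the random samples drawn by the algorithm. Algorithm Batch-Sieve-Streaming++ (inputs: stream $V$, function $f$, cardinality constraint $k$, a buffer $\mathcal B$ that can store at most $B$ elements, a parameter Threshold,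 assumed constant, and error term $\varepsilon$). Initialize $\Delta\gets0$, $\tau_{\min}\gets0$, $\mathrm{LB}\gets0$, $\mathcal B\gets\emptyset$. While there is an incoming element $e$ from $V$: add $e$ to $\mathcal B$; if the buffer $\mathcal B$ is Threshold percent full, then: - $\Delta\gets\max\{\Delta,\max_{e\in\mathcal B}f(\{e\})\}$ and $\tau_{\min}\gets\max(\mathrm{LB},\Delta)/(2k(1+\varepsilon))$; - discard all sets $S_\tau$ with $\tau<\tau_{\min}$; - for each $\tau\in\{(1+\varepsilon)^i:\tau_{\min}\le(1+\varepsilon)^i\le\Delta\}$: if $\tau$ is a new threshold, set $S_\tau\gets\emptyset$; if $|S_\tau|<k$, let $T\gets\text{Threshold-Sampling}(f_{S_\tau},\mathcal B,k-|S_\tau|,\tau,\varepsilon)$ and $S_\tau\gets S_\tau\cup T$; - $\mathrm{LB}\gets\max_{S_\tau}f(S_\tau)$ and $\mathcal B\gets\emptyset$. When the stream ends, return $\arg\max_{S_\tau}f(S_\tau)$. Subroutine Threshold-Sampling$(g,\mathcal B,\kappa,\tau,\varepsilon)$ (inputs: submodular function $g$, set of buffered items $\mathcal B$, cardinality constraint $\kappa$, threshold $\tau$, error term $\varepsilon$). Set $S\gets\emptyset$. While $|\mathcal B|>0$ and $|S|<\kappa$: (1) update $\mathcal B\gets\{x\in\mathcal B:g(\{x\}\mid S)\ge\tau\}$, filtering out the rest; (2) for $i=1$ to $\lceil1/\varepsilon\rceil$: sample $x$ uniformly at random from $\mathcal B\setminus S$; if $g(\{x\}\mid S)\le(1-\varepsilon)\tau$,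 break and go back to the test of the while loop; else $S\gets S\cup\{x\}$, and if $|S|=\kappa$ return $S$; (3) for $i=\lfloor\log_{1+\varepsilon}(1/\varepsilon)\rfloor$ to $\lceil\log_{1+\varepsilon}\kappa\rceil-1$: let $t\gets\min\{\lfloor(1+\varepsilon)^{i+1}-(1+\varepsilon)^i\rfloor,\ |\mathcal B\setminus S|,\ \kappa-|S|\}$; sample a random set $T$ of size $t$ from $\mathcal B\setminus S$; if $|S\cup T|=\kappa$, return $S\cup T$; if $g(T\mid S)/|T|\le(1-\varepsilon)\tau$, set $S\gets S\cup T$ and break out of this for loop; else $S\gets S\cup T$. After the while loop, return $S$.
   Formalization: The buffer left when the stream ends is also processed (otherwise (i) fails); empty blocks are skipped and sampling from an empty set returns to the while test; in (iii) the O-constant may depend on ε and Threshold (a uniform one fails), and k, B ≥ 2 and B ≤ N are assumed. *)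

theory Defs
  imports "HOL-Probability.SPMF" "HOL-Library.Monad_Syntax"
begin

section \<open>Submodular functions\<close>

definition submodular_on :: "'a set \<Rightarrow> ('a set \<Rightarrow> real) \<Rightarrow> bool" where
  "submodular_on V f \<longleftrightarrow>
     (\<forall>A A' e. A \<subseteq> A' \<and> A' \<subseteq> V \<and> e \<in> V - A' \<longrightarrow>
        f (A' \<union> {e}) - f A' \<le> f (A \<union> {e}) - f A)"

definition marginal :: "('a set \<Rightarrow> real) \<Rightarrow> 'a set \<Rightarrow> 'a set \<Rightarrow> real" where
  "marginal f A S = f (A \<union> S) - f S"


section \<open>Randomized computations with a value oracle\<close>

text \<open>
  The second component of an outcome is the number of adaptive rounds of oracle queries.
  The oracle is only ever accessed through \<open>oracle_round\<close>: the set of all queries of the round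
  is fixed before any of their answers is known, and only the answers to these queries are returned.
  Non-termination is represented by missing probability mass.
\<close>

datatype 'r comp = Comp (run_comp: "('r \<times> nat) spmf")

definition return_comp :: "'r \<Rightarrow> 'r comp" where
  "return_comp r = Comp (return_spmf (r, 0))"

definition bind_comp :: "'r comp \<Rightarrow> ('r \<Rightarrow> 's comp) \<Rightarrow> 's comp" where
  "bind_comp c h =
     Comp (bind_spmf (run_comp c) (\<lambda>(r, m). map_spmf (\<lambda>(s, n). (s, m + n)) (run_comp (h r))))"

adhoc_overloading Monad_Syntax.bind \<rightleftharpoons> bind_comp

definition uniform :: "'r set \<Rightarrow> 'r comp" where
  "uniform A = Comp (map_spmf (\<lambda>r. (r, 0)) (spmf_of_set A))"

definition oracle_round :: "('a set \<Rightarrow> real) \<Rightarrow> 'a set set \<Rightarrow> ('a set \<Rightarrow> real) comp" where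
  "oracle_round g Q = Comp (return_spmf (restrict g Q, 1))"

partial_function (spmf) while_spmf :: "('s \<Rightarrow> bool) \<Rightarrow> ('s \<Rightarrow> 's spmf) \<Rightarrow> 's \<Rightarrow> 's spmf" where
  "while_spmf test body s =
     (if test s then bind_spmf (body s) (while_spmf test body) else return_spmf s)"

definition while_comp :: "('s \<Rightarrow> bool) \<Rightarrow> ('s \<Rightarrow> 's comp) \<Rightarrow> 's \<Rightarrow> 's comp" where
  "while_comp test body s =
     Comp (while_spmf (\<lambda>(s, m). test s)
            (\<lambda>(s, m). map_spmf (\<lambda>(s', n). (s', m + n)) (run_comp (body s))) (s, 0))"

text \<open>
  Independent computations executed in parallel: their \<open>i\<close>-th rounds are issued together,
  so that the number of rounds is the maximum and not the sum.
\<close>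

primrec par_map :: "('x \<Rightarrow> 'r comp) \<Rightarrow> 'x list \<Rightarrow> 'r list comp" where
  "par_map h [] = return_comp []"
| "par_map h (x # xs) =
     Comp (bind_spmf (run_comp (h x)) (\<lambda>(r, m).
           map_spmf (\<lambda>(rs, n). (r # rs, max m n)) (run_comp (par_map h xs))))"

definition expected_rounds :: "'r comp \<Rightarrow> ennreal" where
  "expected_rounds c = (\<integral>\<^sup>+ (r, n). of_nat n \<partial>measure_spmf (run_comp c))"


section \<open>Threshold-Sampling\<close>

text \<open>
  The flag returned by \<open>sample_singles\<close> tells whether the \<open>for\<close> loop has run to completion.
  Otherwise control goes back to the test of the \<open>while\<close> loop of \<open>threshold_sampling\<close>. In particular,
  returning \<open>S\<close> with \<open>|S| = \<kappa>\<close> is the same as going back to that test, since it then fails.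
  There is nothing to sample from if \<open>P - S\<close> is empty, and this also means going back to the test.
\<close>

primrec sample_singles ::
  "('a set \<Rightarrow> real) \<Rightarrow> nat \<Rightarrow> real \<Rightarrow> real \<Rightarrow> 'a set \<Rightarrow> nat \<Rightarrow> 'a set \<Rightarrow> (bool \<times> 'a set) comp" where
  "sample_singles g \<kappa> \<tau> \<epsilon> P 0 S = return_comp (True, S)"
| "sample_singles g \<kappa> \<tau> \<epsilon> P (Suc n) S =
     (if P - S = {} then return_comp (False, S)
      else do {
        x \<leftarrow> uniform (P - S);
        a \<leftarrow> oracle_round g {{x} \<union> S, S};
        if marginal a {x} S \<le> (1 - \<epsilon>) * \<tau> then return_comp (False, S)
        else if card (S \<union> {x}) = \<kappa> then return_comp (False, S \<union> {x})
        else sample_singles g \<kappa> \<tau> \<epsilon> P n (S \<union> {x})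
      })"

text \<open>
  The list argument consists of the values of the loop index that are still to be processed.
  For the first value of the index, the rounded-down sample size is usually 0. The average marginal
  gain of an empty sample is not defined, so nothing is tested or queried in this case
  (\<open>0 / 0 = 0\<close> would make the loop break).
\<close>

primrec sample_blocks ::
  "('a set \<Rightarrow> real) \<Rightarrow> nat \<Rightarrow> real \<Rightarrow> real \<Rightarrow> 'a set \<Rightarrow> int list \<Rightarrow> 'a set \<Rightarrow> 'a set comp" where
  "sample_blocks g \<kappa> \<tau> \<epsilon> P [] S = return_comp S"
| "sample_blocks g \<kappa> \<tau> \<epsilon> P (i # is) S =
     (let t = min (nat \<lfloor>(1 + \<epsilon>) powi (i + 1) - (1 + \<epsilon>) powi i\<rfloor>) (min (card (P - S)) (\<kappa> - card S))
      in if t = 0 then sample_blocks g \<kappa> \<tau> \<epsilon> P is S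
         else do {
           T \<leftarrow> uniform {T. T \<subseteq> P - S \<and> card T = t};
           if card (S \<union> T) = \<kappa> then return_comp (S \<union> T)
           else do {
             a \<leftarrow> oracle_round g {T \<union> S, S};
             if marginal a T S / real (card T) \<le> (1 - \<epsilon>) * \<tau> then return_comp (S \<union> T)
             else sample_blocks g \<kappa> \<tau> \<epsilon> P is (S \<union> T)
           }
         })"

definition threshold_sampling ::
  "('a set \<Rightarrow> real) \<Rightarrow> 'a set \<Rightarrow> nat \<Rightarrow> real \<Rightarrow> real \<Rightarrow> 'a set comp" where
  "threshold_sampling g buf \<kappa> \<tau> \<epsilon> = do {
     (P, S) \<leftarrow> while_comp
       (\<lambda>(P, S). card P > 0 \<and> card S < \<kappa>)
       (\<lambda>(P, S). do {
          a \<leftarrow> oracle_round g (insert S ((\<lambda>x. {x} \<union> S) ` P));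
          let P' = {x \<in> P. marginal a {x} S \<ge> \<tau>};
          (completed, S') \<leftarrow> sample_singles g \<kappa> \<tau> \<epsilon> P' (nat \<lceil>1 / \<epsilon>\<rceil>) S;
          S'' \<leftarrow> (if completed
                 then sample_blocks g \<kappa> \<tau> \<epsilon> P'
                        [\<lfloor>log (1 + \<epsilon>) (1 / \<epsilon>)\<rfloor> .. \<lceil>log (1 + \<epsilon>) (real \<kappa>)\<rceil> - 1] S'
                 else return_comp S');
          return_comp (P', S'')
        })
       (buf, {});
     return_comp S
   }"


section \<open>Batch-Sieve-Streaming++\<close>

text \<open>
  \<open>cand\<close> maps each active threshold \<open>\<tau>\<close> to the set \<open>S\<^sub>\<tau>\<close>; \<open>peak\<close> is the largest number
  of elements that have been in memory so far. An element is counted once even if it occurs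
  in several of the sets \<open>S\<^sub>\<tau>\<close>.
\<close>

record 'a bss_state =
  buf :: "'a set"
  delta :: real
  LB :: real
  cand :: "real \<rightharpoonup> 'a set"
  peak :: nat

definition footprint :: "'a set \<Rightarrow> (real \<rightharpoonup> 'a set) \<Rightarrow> nat" where
  "footprint b c = card (b \<union> \<Union>(ran c))"

text \<open>
  The footprint is taken before the buffer is cleared. All intermediate sets in
  \<open>threshold_sampling\<close> are subsets of the buffer.
  If there is no \<open>S\<^sub>\<tau>\<close> (which requires \<open>\<Delta> = 0\<close>), then \<open>LB\<close> is left unchanged.
\<close>

definition process_buffer ::
  "('a set \<Rightarrow> real) \<Rightarrow> nat \<Rightarrow> real \<Rightarrow> 'a bss_state \<Rightarrow> 'a bss_state comp" where
  "process_buffer f k \<epsilon> st = do {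
     a \<leftarrow> oracle_round f ((\<lambda>e. {e}) ` buf st);
     let \<Delta> = max (delta st) (Max ((\<lambda>e. a {e}) ` buf st));
     let \<tau>min = max (LB st) \<Delta> / (2 * real k * (1 + \<epsilon>));
     let kept = cand st |` {\<tau>. \<tau>min \<le> \<tau>};
     let thresholds = {\<tau>. \<exists>i::int. \<tau> = (1 + \<epsilon>) powi i \<and> \<tau>min \<le> \<tau> \<and> \<tau> \<le> \<Delta>};
     new \<leftarrow> par_map
       (\<lambda>\<tau>. let S = (case kept \<tau> of None \<Rightarrow> {} | Some S \<Rightarrow> S)
            in if card S < k
               then do {
                 T \<leftarrow> threshold_sampling (\<lambda>A. marginal f A S) (buf st) (k - card S) \<tau> \<epsilon>;
                 return_comp (\<tau>, S \<union> T)
               }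
               else return_comp (\<tau>, S))
       (sorted_list_of_set thresholds);
     let c = kept ++ map_of new;
     b \<leftarrow> oracle_round f (ran c);
     return_comp
       \<lparr>buf = {}, delta = \<Delta>, LB = (if ran c = {} then LB st else Max (b ` ran c)), cand = c,
        peak = max (peak st) (footprint (buf st) c)\<rparr>
   }"

definition arrive :: "'a \<Rightarrow> 'a bss_state \<Rightarrow> 'a bss_state" where
  "arrive e st = st\<lparr>buf := insert e (buf st),
                    peak := max (peak st) (footprint (insert e (buf st)) (cand st))\<rparr>"

definition init_state :: "'a bss_state" where
  "init_state = \<lparr>buf = {}, delta = 0, LB = 0, cand = Map.empty, peak = 0\<rparr>"

text \<open>
  \<open>\<theta>\<close> is the parameter Threshold, in percent. Elements that are left in the buffer
  when the stream ends are processed before the output is computed: without this, they would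
  be ignored and no approximation guarantee could hold.
\<close>

primrec process_stream ::
  "('a set \<Rightarrow> real) \<Rightarrow> nat \<Rightarrow> nat \<Rightarrow> real \<Rightarrow> real \<Rightarrow> 'a list \<Rightarrow> 'a bss_state \<Rightarrow> 'a bss_state comp" where
  "process_stream f k B \<theta> \<epsilon> [] st =
     (if buf st = {} then return_comp st else process_buffer f k \<epsilon> st)"
| "process_stream f k B \<theta> \<epsilon> (e # es) st =
     (let st' = arrive e st
      in if real (card (buf st')) \<ge> \<theta> / 100 * real B
         then do {
           st'' \<leftarrow> process_buffer f k \<epsilon> st';
           process_stream f k B \<theta> \<epsilon> es st''
         }
         else process_stream f k B \<theta> \<epsilon> es st')"

text \<open>The result consists of the returned set and the peak number of elements in memory.\<close>

definition batch_sieve_streaming ::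
  "('a set \<Rightarrow> real) \<Rightarrow> nat \<Rightarrow> nat \<Rightarrow> real \<Rightarrow> real \<Rightarrow> 'a list \<Rightarrow> ('a set \<times> nat) comp" where
  "batch_sieve_streaming f k B \<theta> \<epsilon> xs = do {
     st \<leftarrow> process_stream f k B \<theta> \<epsilon> xs init_state;
     a \<leftarrow> oracle_round f (ran (cand st));
     return_comp
       (if ran (cand st) = {} then {} else arg_max_on a (ran (cand st)), peak st)
   }"

definition streaming_instance ::
  "('a set \<Rightarrow> real) \<Rightarrow> 'a list \<Rightarrow> nat \<Rightarrow> nat \<Rightarrow> real \<Rightarrow> real \<Rightarrow> bool" where
  "streaming_instance f xs k B \<theta> \<epsilon> \<longleftrightarrow>
     distinct xs \<and>
     (\<forall>A \<subseteq> set xs. 0 \<le> f A) \<and> mono_on (Pow (set xs)) f \<and> submodular_on (set xs) f \<and>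
     1 \<le> k \<and> 1 \<le> B \<and> 0 < \<theta> \<and> \<theta> \<le> 100 \<and> 0 < \<epsilon> \<and> \<epsilon> < 1 / 3"

end

theory Submission
  imports Defs "HOL-Combinatorics.Multiset_Permutations"
begin

text \<open>
  Gain. In an iteration of Threshold-Sampling, only the last block can be bad. Its size is at most
  \<open>2 \<epsilon>\<close> times the number of elements added before it, and these gain \<open>(1 - \<epsilon>) \<tau>\<close> on average.
  Hence \<open>f S\<^sub>\<tau> \<ge> (1 - \<epsilon>) / (1 + 2 \<epsilon>) \<tau> |S\<^sub>\<tau>|\<close> for every outcome. Two adjacent thresholds near
  \<open>opt / (2 k)\<close> together make up for the loss in the approximation factor. The memory bound follows
  from \<open>|S\<^sub>\<tau>| \<le> LB (1 + 2 \<epsilon>) / ((1 - \<epsilon>) \<tau>)\<close>, a geometric series in \<open>\<tau>\<close>.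

  Rounds. An iteration is stuck if nearly all filtered elements survive the next filtering. A loop
  breaks in such a state only if a single sample, or a fraction \<open>\<epsilon>\<close> of a block, is among the few
  elements that do not survive. This is exponentially unlikely in the block size, so that an
  iteration is stuck with probability at most \<open>1 / 4\<close>, whatever the number of blocks. So a power of
  the number of survivors is a potential for the exponential moment of the number of iterations.
  By this moment, the maximum over \<open>O(log k)\<close> parallel thresholds is \<open>O(log B + log log k)\<close>
  iterations in expectation. An iteration has \<open>O(min (log k) (log B))\<close> rounds, because a block
  cannot be larger than the buffer.
\<close>

section \<open>Reasoning about randomized computations\<close>

text \<open>Parallel calls cost the maximum of their rounds, which the expectations of the single
  calls do not control; this is why an exponential moment is tracked instead of a mean. The obstacle
  is to keep the stuck probability independent of the number of blocks: a block is tested only on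
  its average gain, its elements are drawn without replacement, and a constant failure probability
  per block would add up with \<open>\<kappa>\<close>. Reading the random set as a random sequence
  exposes the failing elements one draw at a time, and each of them can be charged to the share
  \<open>d\<close> of elements that the next filtering removes. The block sizes then make the
  charges summable, so that \<open>d\<close> and the exponent of the potential depend on the
  accuracy only. Gain, memory and termination need no probability: they hold in every outcome and
  are kept in the separate judgement \<open>sure\<close>, of which losslessness is a part.\<close>

definition sure :: "'r comp \<Rightarrow> ('r \<Rightarrow> nat \<Rightarrow> bool) \<Rightarrow> bool" where
  "sure c Q \<longleftrightarrow> lossless_spmf (run_comp c) \<and> (\<forall>(r, n) \<in> set_spmf (run_comp c). Q r n)"

definition expect :: "'r comp \<Rightarrow> ('r \<Rightarrow> nat \<Rightarrow> ennreal) \<Rightarrow> ennreal" where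
  "expect c \<phi> = (\<integral>\<^sup>+ x. \<phi> (fst x) (snd x) \<partial>measure_spmf (run_comp c))"

section \<open>Rules for properties of every outcome\<close>

lemma sure_mono:
  assumes "sure c Q" "\<And>r n. Q r n \<Longrightarrow> Q' r n"
  shows "sure c Q'"
  using assms by (auto simp: sure_def)

lemma sure_conj: "sure c Q \<Longrightarrow> sure c Q' \<Longrightarrow> sure c (\<lambda>r n. Q r n \<and> Q' r n)"
  by (auto simp: sure_def)

lemma sure_return: "sure (return_comp r) Q \<longleftrightarrow> Q r 0"
  by (simp add: sure_def return_comp_def)

lemma sure_oracle_round: "sure (oracle_round g A) Q \<longleftrightarrow> Q (restrict g A) 1"
  by (simp add: sure_def oracle_round_def)

lemma sure_uniform:
  assumes "finite A" "A \<noteq> {}"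
  shows "sure (uniform A) Q \<longleftrightarrow> (\<forall>x\<in>A. Q x 0)"
  using assms by (auto simp: sure_def uniform_def)

lemma sure_bind:
  assumes "sure c (\<lambda>r m. sure (h r) (\<lambda>s n. Q s (m + n)))"
  shows "sure (bind_comp c h) Q"
  using assms by (fastforce simp: sure_def bind_comp_def set_bind_spmf)

lemma bind_comp_assoc: "bind_comp (bind_comp c h) k = bind_comp c (\<lambda>r. bind_comp (h r) k)"
  by (simp add: bind_comp_def map_spmf_conv_bind_spmf bind_spmf_assoc case_prod_unfold add.assoc)

text \<open>Oracle answers are deterministic, so a continuation may be rewritten for the recorded
  answers before any other rule is applied.\<close>

lemma bind_oracle_round:
  "bind_comp (oracle_round g Q) h = bind_comp (oracle_round g Q) (\<lambda>_. h (restrict g Q))"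
  by (simp add: bind_comp_def oracle_round_def)

lemma image_restrict_eq: "restrict g A ` A = g ` A"
  by auto

lemma sure_par_map:
  assumes "\<And>x. x \<in> set xs \<Longrightarrow> sure (h x) (\<lambda>r n. Q x r)"
  shows "sure (par_map h xs) (\<lambda>rs n. list_all2 Q xs rs)"
  using assms
proof (induction xs)
  case Nil
  then show ?case by (simp add: sure_return)
next
  case (Cons x xs)
  have "sure (h x) (\<lambda>r n. Q x r)" "sure (par_map h xs) (\<lambda>rs n. list_all2 Q xs rs)"
    using Cons by auto
  then show ?case by (fastforce simp: sure_def set_bind_spmf)
qed

text \<open>Fixpoint induction would give partial correctness only. A variant that decreases in
  every outcome allows well-founded induction, which also shows that no probability mass is lost.
  The counter \<open>m\<close> is generalized because the loop state carries the rounds spent so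
  far.\<close>

lemma sure_while_spmf:
  fixes I :: "'s \<Rightarrow> nat \<Rightarrow> bool" and v :: "'s \<Rightarrow> nat"
  assumes step: "\<And>s m. I s m \<Longrightarrow> test s \<Longrightarrow> sure (body s) (\<lambda>s' n. I s' (m + n) \<and> v s' < v s)"
    and "I s m"
  shows "sure (Comp (while_spmf (\<lambda>(s, m). test s)
            (\<lambda>(s, m). map_spmf (\<lambda>(s', n). (s', m + n)) (run_comp (body s))) (s, m)))
          (\<lambda>s m. I s m \<and> \<not> test s)"
  using \<open>I s m\<close>
proof (induction "v s" arbitrary: s m rule: less_induct)
  case less
  show ?case
  proof (cases "test s")
    case False
    then show ?thesis using less.prems by (simp add: sure_def while_spmf.simps)
  next
    case True
    have *: "sure (body s) (\<lambda>s' n. I s' (m + n) \<and> v s' < v s)"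
      by (rule step[OF less.prems True])
    have "sure (Comp (while_spmf (\<lambda>(s, m). test s)
            (\<lambda>(s, m). map_spmf (\<lambda>(s', n). (s', m + n)) (run_comp (body s))) (s', m + n)))
          (\<lambda>s m. I s m \<and> \<not> test s)" if "(s', n) \<in> set_spmf (run_comp (body s))" for s' n
      using * that by (intro less.hyps) (auto simp: sure_def)
    with * show ?thesis
      by (subst while_spmf.simps) (fastforce simp: sure_def True set_bind_spmf)
  qed
qed

lemma sure_while:
  fixes I :: "'s \<Rightarrow> nat \<Rightarrow> bool" and v :: "'s \<Rightarrow> nat"
  assumes "\<And>s m. I s m \<Longrightarrow> test s \<Longrightarrow> sure (body s) (\<lambda>s' n. I s' (m + n) \<and> v s' < v s)"
    and "I s 0"
  shows "sure (while_comp test body s) (\<lambda>s m. I s m \<and> \<not> test s)"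
  unfolding while_comp_def using assms by (rule sure_while_spmf)

section \<open>Rules for expectations and exponential moments\<close>

lemma nn_integral_bind_spmf:
  "(\<integral>\<^sup>+ y. \<phi> y \<partial>measure_spmf (bind_spmf p h)) =
   (\<integral>\<^sup>+ x. (\<integral>\<^sup>+ y. \<phi> y \<partial>measure_spmf (h x)) \<partial>measure_spmf p)"
  unfolding measure_spmf_bind
  by (subst nn_integral_bind[where B = "count_space UNIV"]) (auto simp: o_def)

lemma expect_return: "expect (return_comp r) \<phi> = \<phi> r 0"
  by (simp add: expect_def return_comp_def measure_spmf_return_spmf nn_integral_return)

lemma expect_oracle_round: "expect (oracle_round g A) \<phi> = \<phi> (restrict g A) 1"
  by (simp add: expect_def oracle_round_def measure_spmf_return_spmf nn_integral_return)

lemma expect_uniform: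
  assumes "finite A" "A \<noteq> {}"
  shows "expect (uniform A) \<phi> = (\<Sum>x\<in>A. \<phi> x 0) / of_nat (card A)"
  using assms
  by (simp add: expect_def uniform_def nn_integral_map_spmf o_def measure_spmf_spmf_of_set
      nn_integral_pmf_of_set)

lemma expect_bind:
  "expect (bind_comp c h) \<phi> = expect c (\<lambda>r m. expect (h r) (\<lambda>s n. \<phi> s (m + n)))"
  by (auto simp: expect_def bind_comp_def nn_integral_bind_spmf nn_integral_map_spmf
      o_def case_prod_unfold)

lemma expect_mono:
  assumes "sure c Q" "\<And>r n. Q r n \<Longrightarrow> \<phi> r n \<le> \<psi> r n"
  shows "expect c \<phi> \<le> expect c \<psi>"
  using assms unfolding expect_def sure_def
  by (intro nn_integral_mono_AE) (auto simp: AE_measure_spmf_iff)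

lemma expect_const_le: "expect c (\<lambda>_ _. K) \<le> K"
  using mult_left_mono[OF measure_spmf.subprob_emeasure_le_1[of "run_comp c" UNIV], of K]
  by (simp add: expect_def space_measure_spmf)

lemma expect_le_const:
  assumes "sure c Q" "\<And>r n. Q r n \<Longrightarrow> \<phi> r n \<le> K"
  shows "expect c \<phi> \<le> K"
  using expect_mono[OF assms] expect_const_le by (rule order_trans)

lemma expect_add: "expect c (\<lambda>r n. \<phi> r n + \<psi> r n) = expect c \<phi> + expect c \<psi>"
  by (simp add: expect_def case_prod_unfold nn_integral_add)

lemma expect_cmult: "expect c (\<lambda>r n. K * \<phi> r n) = K * expect c \<phi>"
  by (simp add: expect_def case_prod_unfold nn_integral_cmult)

text \<open>A union bound for one uniform draw: \<open>r\<close> is the failure probability left for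
  later, and \<open>w\<close> is the share of draws that fail at once. Single samples and blocks are
  both charged by this rule.\<close>

lemma expect_uniform_bind_le:
  assumes A: "finite A" "A \<noteq> {}" and "0 \<le> r"
    and step: "\<And>x. x \<in> A \<Longrightarrow> expect (h x) \<phi> \<le> ennreal (r + (if Q x then 1 else 0))"
    and count: "real (card {x \<in> A. Q x}) \<le> w * real (card A)"
  shows "expect (bind_comp (uniform A) h) \<phi> \<le> ennreal (r + w)"
proof -
  have card: "0 < card A" using A by (simp add: card_gt_0_iff)
  have "expect (bind_comp (uniform A) h) \<phi> = (\<Sum>x\<in>A. expect (h x) \<phi>) / of_nat (card A)"
    by (simp add: expect_bind expect_uniform[OF A])
  also have "\<dots> \<le> (\<Sum>x\<in>A. ennreal (r + (if Q x then 1 else 0))) / of_nat (card A)"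
    by (intro divide_right_mono_ennreal sum_mono step)
  also have "\<dots> = ennreal (\<Sum>x\<in>A. r + (if Q x then 1 else 0)) / of_nat (card A)"
    using \<open>0 \<le> r\<close> by (subst sum_ennreal) auto
  also have "\<dots> = ennreal ((\<Sum>x\<in>A. r + (if Q x then 1 else 0)) / real (card A))"
    using \<open>0 \<le> r\<close> card
    by (subst divide_ennreal[symmetric])
      (auto intro!: sum_nonneg simp: ennreal_of_nat_eq_real_of_nat)
  also have "(\<Sum>x\<in>A. r + (if Q x then 1 else 0)) = real (card A) * r + real (card {x \<in> A. Q x})"
    using A by (simp add: sum.distrib sum.If_cases Int_def)
  also have "ennreal ((real (card A) * r + real (card {x \<in> A. Q x})) / real (card A)) \<le> ennreal (r + w)"
    using count card by (intro ennreal_leI) (simp add: field_simps)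
  finally show ?thesis .
qed

lemma expect_bind_add_le:
  assumes "sure c Q" "\<And>r m. Q r m \<Longrightarrow> expect (h r) (\<lambda>s n. of_nat n) \<le> K"
  shows "expect (bind_comp c h) (\<lambda>s n. of_nat n) \<le> expect c (\<lambda>s n. of_nat n) + K"
proof -
  have "expect (bind_comp c h) (\<lambda>s n. of_nat n) =
    expect c (\<lambda>r m. expect (h r) (\<lambda>s n. of_nat m) + expect (h r) (\<lambda>s n. of_nat n))"
    by (simp add: expect_bind expect_add[symmetric])
  also have "\<dots> \<le> expect c (\<lambda>r m. of_nat m + K)"
  proof (rule expect_mono[OF assms(1)])
    fix r m assume "Q r m"
    then show "expect (h r) (\<lambda>s n. of_nat m) + expect (h r) (\<lambda>s n. of_nat n) \<le> of_nat m + K"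
      using assms(2) by (intro add_mono expect_const_le) auto
  qed
  also have "\<dots> = expect c (\<lambda>s n. of_nat n) + expect c (\<lambda>_ _. K)" by (rule expect_add)
  also have "\<dots> \<le> expect c (\<lambda>s n. of_nat n) + K"
    by (intro add_left_mono expect_le_const[OF assms(1)]) auto
  finally show ?thesis .
qed

text \<open>The potential \<open>V\<close> bounds the exponential moment of the remaining number of rounds.\<close>

lemma expect_while_spmf_le:
  fixes V :: "'s \<Rightarrow> ennreal" and v :: "'s \<Rightarrow> nat" and b :: ennreal
  assumes sure: "\<And>s. I s \<Longrightarrow> test s \<Longrightarrow> sure (body s) (\<lambda>s' n. I s' \<and> v s' < v s)"
    and step: "\<And>s. I s \<Longrightarrow> test s \<Longrightarrow> expect (body s) (\<lambda>s' n. b ^ n * V s') \<le> V s"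
    and stop: "\<And>s. I s \<Longrightarrow> \<not> test s \<Longrightarrow> 1 \<le> V s"
    and "I s"
  shows "expect (Comp (while_spmf (\<lambda>(s, m). test s)
            (\<lambda>(s, m). map_spmf (\<lambda>(s', n). (s', m + n)) (run_comp (body s))) (s, m)))
          (\<lambda>s n. b ^ n) \<le> b ^ m * V s"
  using \<open>I s\<close>
proof (induction "v s" arbitrary: s m rule: less_induct)
  case less
  let ?W = "while_spmf (\<lambda>(s, m). test s)
            (\<lambda>(s, m). map_spmf (\<lambda>(s', n). (s', m + n)) (run_comp (body s)))"
  show ?case
  proof (cases "test s")
    case False
    then have "expect (Comp (?W (s, m))) (\<lambda>s n. b ^ n) = b ^ m * 1"
      by (subst while_spmf.simps)
        (simp add: expect_def measure_spmf_return_spmf nn_integral_return)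
    also have "\<dots> \<le> b ^ m * V s" using stop[OF less.prems False] by (intro mult_left_mono) auto
    finally show ?thesis .
  next
    case True
    note * = sure[OF less.prems True]
    have "expect (Comp (?W (s, m))) (\<lambda>s n. b ^ n) =
      expect (body s) (\<lambda>s' n. expect (Comp (?W (s', m + n))) (\<lambda>s n. b ^ n))"
      by (subst while_spmf.simps)
        (simp add: expect_def True nn_integral_bind_spmf nn_integral_map_spmf o_def case_prod_unfold)
    also have "\<dots> \<le> expect (body s) (\<lambda>s' n. b ^ m * (b ^ n * V s'))"
    proof (rule expect_mono[OF *])
      fix s' n assume "I s' \<and> v s' < v s"
      then show "expect (Comp (?W (s', m + n))) (\<lambda>s n. b ^ n) \<le> b ^ m * (b ^ n * V s')"
        using less.hyps[of s' "m + n"] by (simp add: power_add mult.assoc)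
    qed
    also have "\<dots> = b ^ m * expect (body s) (\<lambda>s' n. b ^ n * V s')" by (rule expect_cmult)
    also have "\<dots> \<le> b ^ m * V s" using step[OF less.prems True] by (intro mult_left_mono) auto
    finally show ?thesis .
  qed
qed

lemma expect_while_le:
  fixes V :: "'s \<Rightarrow> ennreal" and v :: "'s \<Rightarrow> nat" and b :: ennreal
  assumes "\<And>s. I s \<Longrightarrow> test s \<Longrightarrow> sure (body s) (\<lambda>s' n. I s' \<and> v s' < v s)"
    and "\<And>s. I s \<Longrightarrow> test s \<Longrightarrow> expect (body s) (\<lambda>s' n. b ^ n * V s') \<le> V s"
    and "\<And>s. I s \<Longrightarrow> \<not> test s \<Longrightarrow> 1 \<le> V s"
    and "I s"
  shows "expect (while_comp test body s) (\<lambda>s n. b ^ n) \<le> V s"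
  using expect_while_spmf_le[of I test body v b V s 0, OF assms]
  unfolding while_comp_def by simp

text \<open>The maximum in the exponent is replaced by a sum,
  \<open>b ^ max m n \<le> b ^ m + b ^ n\<close>. The number of parallel calls thus enters the
  moment linearly, hence the number of rounds only logarithmically.\<close>

lemma expect_par_map_power_le:
  fixes b K :: ennreal
  assumes b: "1 \<le> b"
    and le: "\<And>x. x \<in> set xs \<Longrightarrow> expect (h x) (\<lambda>r n. b ^ n) \<le> K"
  shows "expect (par_map h xs) (\<lambda>rs n. b ^ n) \<le> 1 + of_nat (length xs) * K"
  using le
proof (induction xs)
  case Nil
  then show ?case by (simp add: expect_return)
next
  case (Cons x xs)
  have max: "b ^ max m n \<le> b ^ m + b ^ n" for m n
    by (cases "m \<le> n") (auto simp: max_def)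
  have "expect (par_map h (x # xs)) (\<lambda>rs n. b ^ n) =
     expect (h x) (\<lambda>r m. expect (par_map h xs) (\<lambda>rs n. b ^ max m n))"
    by (simp add: expect_def nn_integral_bind_spmf nn_integral_map_spmf o_def case_prod_unfold)
  also have "\<dots> \<le> expect (h x) (\<lambda>r m. b ^ m + expect (par_map h xs) (\<lambda>rs n. b ^ n))"
  proof -
    have "expect (par_map h xs) (\<lambda>rs n. b ^ max m n) \<le>
        expect (par_map h xs) (\<lambda>rs n. b ^ m + b ^ n)" for m
      unfolding expect_def by (intro nn_integral_mono) (auto intro: max)
    also have "expect (par_map h xs) (\<lambda>rs n. b ^ m + b ^ n) \<le> b ^ m + expect (par_map h xs) (\<lambda>rs n. b ^ n)" for m
      unfolding expect_add by (intro add_right_mono expect_const_le)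
    finally show ?thesis
      unfolding expect_def by (intro nn_integral_mono) (auto simp: case_prod_unfold)
  qed
  also have "\<dots> \<le> K + expect (par_map h xs) (\<lambda>rs n. b ^ n)"
    unfolding expect_add using Cons.prems[of x] by (intro add_mono expect_const_le) auto
  also have "\<dots> \<le> K + (1 + of_nat (length xs) * K)"
    using Cons by (intro add_left_mono) auto
  finally show ?case by (simp add: algebra_simps)
qed

section \<open>Threshold-Sampling: gain and rounds\<close>

definition density :: "real \<Rightarrow> real" where
  "density \<epsilon> = (1 - \<epsilon>) / (1 + 2 * \<epsilon>)"

definition block_size :: "real \<Rightarrow> int \<Rightarrow> nat" where
  "block_size \<epsilon> i = nat \<lfloor>(1 + \<epsilon>) powi (i + 1) - (1 + \<epsilon>) powi i\<rfloor>"

definition singles_count :: "real \<Rightarrow> nat" where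
  "singles_count \<epsilon> = nat \<lceil>1 / \<epsilon>\<rceil>"

definition block_indices :: "real \<Rightarrow> nat \<Rightarrow> int list" where
  "block_indices \<epsilon> \<kappa> = [\<lfloor>log (1 + \<epsilon>) (1 / \<epsilon>)\<rfloor> .. \<lceil>log (1 + \<epsilon>) (real \<kappa>)\<rceil> - 1]"

text \<open>Besides the filtering and the single samples, an iteration has a round per nonempty block.
  A block of size at least \<open>N\<close> exhausts a set of \<open>N\<close> elements.\<close>

definition iteration_rounds :: "real \<Rightarrow> nat \<Rightarrow> nat \<Rightarrow> nat" where
  "iteration_rounds \<epsilon> \<kappa> N = 1 + singles_count \<epsilon> + min (length (block_indices \<epsilon> \<kappa>))
     (length (filter (\<lambda>i. block_size \<epsilon> i < N) (block_indices \<epsilon> \<kappa>)) + 1)"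

lemma marginal_restrict: "marginal (restrict g {A \<union> S, S}) A S = marginal g A S"
  by (simp add: marginal_def)

lemma nonempty_if_min_card: "min a (min (card A) b) \<noteq> 0 \<Longrightarrow> A \<noteq> {}"
  by auto

lemma length_filter_mono:
  "(\<And>x. Q x \<Longrightarrow> Q' x) \<Longrightarrow> length (filter Q xs) \<le> length (filter Q' xs)"
  by (induction xs) (auto simp: le_SucI)

section \<open>Block sizes and their growth\<close>

locale accuracy =
  fixes \<epsilon> :: real
  assumes eps: "0 < \<epsilon>" "\<epsilon> < 1 / 3"
begin

lemma density_pos: "0 < density \<epsilon>"
  using eps by (simp add: density_def)

lemma density_le: "density \<epsilon> \<le> 1 - \<epsilon>"
  using eps by (simp add: density_def field_simps)

lemma block_size_alt: "block_size \<epsilon> i = nat \<lfloor>\<epsilon> * (1 + \<epsilon>) powi i\<rfloor>"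
  using eps by (simp add: block_size_def power_int_add algebra_simps)

lemma block_size_le: "real (block_size \<epsilon> i) \<le> \<epsilon> * (1 + \<epsilon>) powi i"
  unfolding block_size_alt using eps by (intro of_nat_floor) simp

text \<open>The rounding of the block sizes loses at most half of every nonempty block.\<close>

lemma block_size_ge:
  assumes "0 < block_size \<epsilon> i"
  shows "\<epsilon> * (1 + \<epsilon>) powi i \<le> 2 * real (block_size \<epsilon> i)"
proof -
  have "1 \<le> \<lfloor>\<epsilon> * (1 + \<epsilon>) powi i\<rfloor>" using assms by (simp add: block_size_alt)
  then have "real (block_size \<epsilon> i) = of_int \<lfloor>\<epsilon> * (1 + \<epsilon>) powi i\<rfloor>"
    by (simp add: block_size_alt)
  moreover have "\<epsilon> * (1 + \<epsilon>) powi i < of_int \<lfloor>\<epsilon> * (1 + \<epsilon>) powi i\<rfloor> + 1" by linarith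
  moreover have "(1 :: real) \<le> of_int \<lfloor>\<epsilon> * (1 + \<epsilon>) powi i\<rfloor>"
    using \<open>1 \<le> \<lfloor>\<epsilon> * (1 + \<epsilon>) powi i\<rfloor>\<close> by linarith
  ultimately show ?thesis by linarith
qed

lemma block_size_0:
  assumes "block_size \<epsilon> i = 0"
  shows "\<epsilon> * (1 + \<epsilon>) powi i < 1"
  using assms by (simp add: block_size_alt)

text \<open>Here \<open>n\<close> counts the elements added in the current iteration. If rounding
  makes the block empty, then \<open>(1 + \<epsilon>) powi i\<close> is below
  \<open>1 / \<epsilon>\<close>, so the single samples alone suffice; otherwise at most half of the
  block is lost to rounding, which the factor 2 pays for.\<close>

lemma grown_enough_step:
  fixes n :: real
  assumes n: "(1 + \<epsilon>) powi i \<le> 2 * n" "1 / \<epsilon> \<le> n"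
  shows "(1 + \<epsilon>) powi (i + 1) \<le> 2 * (n + real (block_size \<epsilon> i))"
proof (cases "block_size \<epsilon> i = 0")
  case True
  have "(1 + \<epsilon>) powi i \<le> 1 / \<epsilon>"
    using block_size_0[OF True] eps by (simp add: field_simps)
  then have "(1 + \<epsilon>) powi i * (1 + \<epsilon>) \<le> (1 / \<epsilon>) * 2"
    using eps by (intro mult_mono) auto
  then show ?thesis using n True eps by (simp add: power_int_add)
next
  case False
  then show ?thesis using block_size_ge[of i] n eps by (simp add: power_int_add algebra_simps)
qed

lemma singles_count_ge: "1 / \<epsilon> \<le> real (singles_count \<epsilon>)" "0 < singles_count \<epsilon>"
  using eps unfolding singles_count_def by (auto simp: le_of_int_ceiling)

lemma powi_floor_log_le:
  assumes "0 < x"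
  shows "(1 + \<epsilon>) powi \<lfloor>log (1 + \<epsilon>) x\<rfloor> \<le> x"
proof -
  have "(1 + \<epsilon>) powi \<lfloor>log (1 + \<epsilon>) x\<rfloor> = (1 + \<epsilon>) powr of_int \<lfloor>log (1 + \<epsilon>) x\<rfloor>"
    using eps by (simp add: powr_real_of_int')
  also have "\<dots> \<le> (1 + \<epsilon>) powr log (1 + \<epsilon>) x"
    using eps by (intro powr_mono) auto
  also have "\<dots> = x" using eps assms by (simp add: powr_log_cancel)
  finally show ?thesis .
qed

lemma le_powi_ceiling_log:
  assumes "0 < x"
  shows "x \<le> (1 + \<epsilon>) powi \<lceil>log (1 + \<epsilon>) x\<rceil>"
proof -
  have "x = (1 + \<epsilon>) powr log (1 + \<epsilon>) x" using eps assms by (simp add: powr_log_cancel)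
  also have "\<dots> \<le> (1 + \<epsilon>) powr of_int \<lceil>log (1 + \<epsilon>) x\<rceil>" using eps by (intro powr_mono) auto
  also have "\<dots> = (1 + \<epsilon>) powi \<lceil>log (1 + \<epsilon>) x\<rceil>" using eps by (simp add: powr_real_of_int')
  finally show ?thesis .
qed

end

section \<open>Gain, rounds and termination of a call\<close>

locale threshold_instance = accuracy +
  fixes V :: "'a set" and g :: "'a set \<Rightarrow> real" and \<kappa> :: nat and \<tau> :: real
  assumes fin: "finite V" and mono: "mono_on (Pow V) g" and submod: "submodular_on V g"
    and tau: "0 < \<tau>"
begin

lemma g_mono: "A \<subseteq> B \<Longrightarrow> B \<subseteq> V \<Longrightarrow> g A \<le> g B"
  using mono by (auto simp: mono_on_def)

lemma marginal_member: "x \<in> S \<Longrightarrow> marginal g {x} S = 0"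
  by (simp add: marginal_def insert_absorb)

lemma marginal_nonneg: "A \<subseteq> V \<Longrightarrow> S \<subseteq> V \<Longrightarrow> 0 \<le> marginal g A S"
  using g_mono[of S "A \<union> S"] by (simp add: marginal_def)

lemma marginal_antimono:
  assumes "S \<subseteq> S'" "S' \<subseteq> V" "x \<in> V"
  shows "marginal g {x} S' \<le> marginal g {x} S"
proof (cases "x \<in> S'")
  case True
  then show ?thesis using marginal_nonneg[of "{x}" S] assms by (simp add: marginal_member)
next
  case False
  then show ?thesis using submod assms by (auto simp: submodular_on_def marginal_def Un_commute)
qed

text \<open>The last clause drives termination: if every remaining element passes the filter, its
  gain is at least \<open>\<tau>\<close> and exceeds the break level
  \<open>(1 - \<epsilon>) * \<tau>\<close>, so the first sample cannot fail. The clause on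
  \<open>c\<close> supplies the head start for the blocks.\<close>

lemma sure_sample_singles:
  assumes "P \<subseteq> V" "S \<subseteq> V" "card S < \<kappa>"
  shows "sure (sample_singles g \<kappa> \<tau> \<epsilon> P n S) (\<lambda>(c, S') r.
    S \<subseteq> S' \<and> S' \<subseteq> S \<union> P \<and> card S' \<le> \<kappa> \<and> r \<le> n \<and>
    (1 - \<epsilon>) * \<tau> * (real (card S') - real (card S)) \<le> g S' - g S \<and>
    (c \<longrightarrow> card S' = card S + n \<and> card S' < \<kappa>) \<and>
    (0 < n \<and> P - S \<noteq> {} \<and> (\<forall>x\<in>P - S. \<tau> \<le> marginal g {x} S) \<longrightarrow> card S < card S'))"
  using assms
proof (induction n arbitrary: S)
  case 0
  then show ?case by (simp add: sure_return)
next
  case (Suc n)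
  have finP: "finite (P - S)" using Suc.prems fin by (auto intro: finite_subset)
  have finS: "finite S" using Suc.prems fin by (auto intro: finite_subset)
  let ?Q = "\<lambda>(c, S') r.
    S \<subseteq> S' \<and> S' \<subseteq> S \<union> P \<and> card S' \<le> \<kappa> \<and> r \<le> Suc n \<and>
    (1 - \<epsilon>) * \<tau> * (real (card S') - real (card S)) \<le> g S' - g S \<and>
    (c \<longrightarrow> card S' = card S + Suc n \<and> card S' < \<kappa>) \<and>
    (0 < Suc n \<and> P - S \<noteq> {} \<and> (\<forall>x\<in>P - S. \<tau> \<le> marginal g {x} S) \<longrightarrow> card S < card S')"
  show ?case
  proof (cases "P - S = {}")
    case True
    then show ?thesis using Suc.prems by (simp add: sure_return)
  next
    case False
    have "sure (if marginal g {x} S \<le> (1 - \<epsilon>) * \<tau> then return_comp (False, S)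
        else if card (S \<union> {x}) = \<kappa> then return_comp (False, S \<union> {x})
        else sample_singles g \<kappa> \<tau> \<epsilon> P n (S \<union> {x})) (\<lambda>s r. ?Q s (1 + r))"
      (is "sure ?c _") if x: "x \<in> P - S" for x
    proof (cases "marginal g {x} S \<le> (1 - \<epsilon>) * \<tau>")
      case True
      have "(1 - \<epsilon>) * \<tau> < \<tau>" using eps tau by simp
      then have "\<not> \<tau> \<le> marginal g {x} S" using True by linarith
      then show ?thesis using True Suc.prems x by (auto simp: sure_return)
    next
      case gain: False
      have card: "card (S \<union> {x}) = card S + 1" using x finS by simp
      have gain': "(1 - \<epsilon>) * \<tau> \<le> g (S \<union> {x}) - g S" using gain by (simp add: marginal_def)
      show ?thesis
      proof (cases "card (S \<union> {x}) = \<kappa>")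
        case True
        then show ?thesis using gain gain' x card by (auto simp: sure_return)
      next
        case ne: False
        have "S \<union> {x} \<subseteq> V" "card (S \<union> {x}) < \<kappa>" using ne card Suc.prems x by auto
        note IH = Suc.IH[OF Suc.prems(1) this]
        have c: "?c = sample_singles g \<kappa> \<tau> \<epsilon> P n (S \<union> {x})" using ne gain by simp
        have "card S < card S'" if "S \<union> {x} \<subseteq> S'" "S' \<subseteq> S \<union> {x} \<union> P" for S'
        proof -
          have "finite S'"
            using that(2) \<open>S \<union> {x} \<subseteq> V\<close> \<open>P \<subseteq> V\<close> fin by (meson finite_subset le_sup_iff)
          then show ?thesis using card_mono[OF _ that(1)] card by simp
        qed
        note lt = this
        show ?thesis unfolding c
        proof (rule sure_mono[OF IH], clarify, intro conjI)
          fix c S' r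
          assume *: "S \<union> {x} \<subseteq> S'" "S' \<subseteq> S \<union> {x} \<union> P" "card S' \<le> \<kappa>" "r \<le> n"
            "(1 - \<epsilon>) * \<tau> * (real (card S') - real (card (S \<union> {x}))) \<le> g S' - g (S \<union> {x})"
            "c \<longrightarrow> card S' = card (S \<union> {x}) + n \<and> card S' < \<kappa>"
          show "0 < Suc n \<and> P - S \<noteq> {} \<and> (\<forall>x\<in>P - S. \<tau> \<le> marginal g {x} S) \<longrightarrow> card S < card S'"
            using lt * by blast
        qed (use gain' card x in \<open>auto simp: algebra_simps\<close>)
      qed
    qed
    then have "sure (uniform (P - S)) (\<lambda>x m. sure (oracle_round g {{x} \<union> S, S} \<bind> (\<lambda>a.
        if marginal a {x} S \<le> (1 - \<epsilon>) * \<tau> then return_comp (False, S)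
        else if card (S \<union> {x}) = \<kappa> then return_comp (False, S \<union> {x})
        else sample_singles g \<kappa> \<tau> \<epsilon> P n (S \<union> {x}))) (\<lambda>s r. ?Q s (m + r)))"
      unfolding sure_uniform[OF finP False] add_0
      by (intro ballI sure_bind) (simp only: sure_oracle_round marginal_restrict)
    then show ?thesis
      unfolding sample_singles.simps if_not_P[OF False] by (rule sure_bind)
  qed
qed

lemma finite_samples: "P \<subseteq> V \<Longrightarrow> finite {T. T \<subseteq> P - S \<and> card T = t}"
  using fin by (auto intro!: finite_subset[of _ "Pow V"])

lemma samples_nonempty:
  assumes "P \<subseteq> V" "t \<le> card (P - S)"
  shows "{T. T \<subseteq> P - S \<and> card T = t} \<noteq> {}"
proof -
  have "finite (P - S)" using assms fin by (auto intro: finite_subset)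
  then show ?thesis using assms by (metis (mono_tags, lifting) empty_iff mem_Collect_eq obtain_subset_with_card_n)
qed

definition block_step :: "'a set \<Rightarrow> int list \<Rightarrow> 'a set \<Rightarrow> 'a set \<Rightarrow> 'a set comp" where
  "block_step P is S T =
     (if card (S \<union> T) = \<kappa> then return_comp (S \<union> T)
      else do {
        a \<leftarrow> oracle_round g {T \<union> S, S};
        if marginal a T S / real (card T) \<le> (1 - \<epsilon>) * \<tau> then return_comp (S \<union> T)
        else sample_blocks g \<kappa> \<tau> \<epsilon> P is (S \<union> T)
      })"

lemma sample_blocks_Cons:
  assumes "t = min (block_size \<epsilon> i) (min (card (P - S)) (\<kappa> - card S))"
  shows "sample_blocks g \<kappa> \<tau> \<epsilon> P (i # is) S =
    (if t = 0 then sample_blocks g \<kappa> \<tau> \<epsilon> P is S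
     else uniform {T. T \<subseteq> P - S \<and> card T = t} \<bind> block_step P is S)"
  unfolding assms block_size_def sample_blocks.simps Let_def block_step_def ..

lemma sure_sample_blocks_Cons:
  assumes "P \<subseteq> V" and t: "t = min (block_size \<epsilon> i) (min (card (P - S)) (\<kappa> - card S))" "t \<noteq> 0"
    and "\<And>T. T \<subseteq> P - S \<Longrightarrow> card T = t \<Longrightarrow> sure (block_step P is S T) Q"
  shows "sure (sample_blocks g \<kappa> \<tau> \<epsilon> P (i # is) S) Q"
proof -
  have "t \<le> card (P - S)" by (simp add: t)
  then show ?thesis
    unfolding sample_blocks_Cons[OF t(1)] if_not_P[OF t(2)]
    using assms finite_samples samples_nonempty by (intro sure_bind) (simp add: sure_uniform)
qed

text \<open>Invariant of the block loop before index \<open>i\<close>. Either nothing is left to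
  draw, or half of \<open>(1 + \<epsilon>) powi i\<close> has been collected, so that the next block
  is at most a fraction \<open>2 * \<epsilon>\<close> of what is already there. The bound
  \<open>1 / \<epsilon>\<close> carries the invariant through blocks that round down to 0.\<close>

abbreviation grown :: "'a set \<Rightarrow> int \<Rightarrow> 'a set \<Rightarrow> 'a set \<Rightarrow> bool" where
  "grown P i S0 S \<equiv> P - S = {} \<or> (1 + \<epsilon>) powi i \<le> 2 * (real (card S) - real (card S0)) \<and>
     1 / \<epsilon> \<le> real (card S) - real (card S0)"

text \<open>The sample size is a minimum of three terms: ending below \<open>\<kappa>\<close> rules
  out the third, and the second means that the pool is used up. What remains is a block of the
  nominal size.\<close>

lemma block_sample:
  assumes "P \<subseteq> V" "S \<subseteq> V" "card S < \<kappa>" and T: "T \<subseteq> P - S" "card T = t"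
    and t: "t = min (block_size \<epsilon> i) (min (card (P - S)) (\<kappa> - card S))"
  shows "card (S \<union> T) = card S + t" "card (S \<union> T) \<le> \<kappa>" "S \<union> T \<subseteq> V"
    "card (S \<union> T) < \<kappa> \<Longrightarrow> P - (S \<union> T) = {} \<or> t = block_size \<epsilon> i"
proof -
  show "S \<union> T \<subseteq> V" using assms by auto
  then have finS: "finite S" and finT: "finite T" using finite_subset[OF _ fin] by auto
  have finP: "finite (P - S)" using finite_subset[OF assms(1) fin] by simp
  show card: "card (S \<union> T) = card S + t"
    using T finS finT by (subst card_Un_disjoint) auto
  then show "card (S \<union> T) \<le> \<kappa>" using assms(3) by (simp add: t)
  assume lt: "card (S \<union> T) < \<kappa>"
  show "P - (S \<union> T) = {} \<or> t = block_size \<epsilon> i"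
  proof (cases "t = card (P - S)")
    case True
    then have "T = P - S" using T finP by (simp add: card_subset_eq)
    then show ?thesis by auto
  next
    case False
    then show ?thesis using lt card by (auto simp: t min_def split: if_splits)
  qed
qed

lemma empty_block:
  assumes "P \<subseteq> V" "card S < \<kappa>" "0 = min (block_size \<epsilon> i) (min (card (P - S)) (\<kappa> - card S))"
  shows "P - S = {} \<or> block_size \<epsilon> i = 0"
  using assms(2,3) card_0_eq[of "P - S"] finite_subset[OF assms(1) fin]
  by (auto simp only: min_def finite_Diff split: if_splits)

text \<open>The hypothesis has the rate \<open>1 - \<epsilon>\<close> and the conclusion only
  \<open>density \<epsilon>\<close>: the strong rate is kept while the tests succeed and is given up
  once, when the loop ends.\<close>

lemma sure_sample_blocks:
  assumes "P \<subseteq> V" "S \<subseteq> V" "S0 \<subseteq> S" "card S < \<kappa>"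
    and "(1 - \<epsilon>) * \<tau> * (real (card S) - real (card S0)) \<le> g S - g S0"
    and "grown P i S0 S"
  shows "sure (sample_blocks g \<kappa> \<tau> \<epsilon> P [i..j] S) (\<lambda>S' r.
    S \<subseteq> S' \<and> S' \<subseteq> S \<union> P \<and> card S' \<le> \<kappa> \<and>
    density \<epsilon> * \<tau> * (real (card S') - real (card S0)) \<le> g S' - g S0)"
  using assms
proof (induction "nat (j + 1 - i)" arbitrary: i S)
  case 0
  have finS: "finite S" using 0 fin by (auto intro: finite_subset)
  have "density \<epsilon> * \<tau> * (real (card S) - real (card S0)) \<le>
      (1 - \<epsilon>) * \<tau> * (real (card S) - real (card S0))"
    using density_le tau card_mono[OF finS \<open>S0 \<subseteq> S\<close>] by (intro mult_right_mono) auto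
  then show ?case using 0 by (simp add: sure_return)
next
  case (Suc n)
  have ij: "[i..j] = i # [i+1..j]" using Suc.hyps(2) by (intro upto_rec1) simp
  define t where "t = min (block_size \<epsilon> i) (min (card (P - S)) (\<kappa> - card S))"
  have n: "n = nat (j + 1 - (i + 1))" using Suc.hyps(2) by simp
  note IH = Suc.hyps(1)[OF n]
  show ?case
  proof (cases "t = 0")
    case True
    have "P - S = {} \<or> block_size \<epsilon> i = 0"
      using Suc.prems(1,4) by (rule empty_block) (use True t_def in simp)
    then have "grown P (i+1) S0 S"
      using grown_enough_step[of i "real (card S) - real (card S0)"] Suc.prems by auto
    from IH[OF Suc.prems(1-5) this] True
    show ?thesis unfolding ij sample_blocks_Cons[OF t_def] by simp
  next
    case False
    let ?Q = "\<lambda>S'. S \<subseteq> S' \<and> S' \<subseteq> S \<union> P \<and> card S' \<le> \<kappa> \<and>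
      density \<epsilon> * \<tau> * (real (card S') - real (card S0)) \<le> g S' - g S0"
    have "P - S \<noteq> {}" by (rule nonempty_if_min_card[OF False[unfolded t_def]])
    then have size: "(1 + \<epsilon>) powi i \<le> 2 * (real (card S) - real (card S0))"
      "1 / \<epsilon> \<le> real (card S) - real (card S0)" using Suc.prems by auto
    have "sure (block_step P [i+1..j] S T) (\<lambda>S' r. ?Q S')" if T: "T \<subseteq> P - S" "card T = t" for T
    proof -
      note block = block_sample[OF Suc.prems(1,2,4) T t_def]
      note card = block(1) and le = block(2)
      have sub: "S \<union> T \<subseteq> V" "S0 \<subseteq> S \<union> T" using block(3) Suc.prems by auto
      have "real t \<le> real (block_size \<epsilon> i)" by (simp add: t_def)
      also have "\<dots> \<le> \<epsilon> * (1 + \<epsilon>) powi i" by (rule block_size_le)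
      also have "\<dots> \<le> \<epsilon> * (2 * (real (card S) - real (card S0)))"
        using size eps by (intro mult_left_mono) auto
      finally have t: "real t \<le> 2 * \<epsilon> * (real (card S) - real (card S0))" by (simp add: algebra_simps)
      have "density \<epsilon> * \<tau> * (real (card (S \<union> T)) - real (card S0))
        \<le> density \<epsilon> * \<tau> * ((1 + 2 * \<epsilon>) * (real (card S) - real (card S0)))"
        using t tau density_pos card by (intro mult_left_mono) (auto simp: algebra_simps)
      also have "\<dots> = (1 - \<epsilon>) * \<tau> * (real (card S) - real (card S0))"
        using eps by (simp add: density_def field_simps)
      also have "\<dots> \<le> g S - g S0" using Suc.prems by simp
      \<comment> \<open>The last block may gain nothing: only monotonicity is used for it, and its
        size is charged to the earlier elements. This also covers a block that reaches
        \<open>\<kappa>\<close>, which is returned without a test.\<close>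
      also have "\<dots> \<le> g (S \<union> T) - g S0" using g_mono[OF _ sub(1), of S] by simp
      finally have Q: "?Q (S \<union> T)" using le T by auto
      show ?thesis
      proof (cases "card (S \<union> T) = \<kappa> \<or> marginal g T S / real (card T) \<le> (1 - \<epsilon>) * \<tau>")
        case True
        then show ?thesis using Q
          by (auto simp: block_step_def sure_return sure_oracle_round marginal_restrict intro!: sure_bind)
      next
        case ok: False
        then have "(1 - \<epsilon>) * \<tau> * real t \<le> g (S \<union> T) - g S"
          using False T(2) by (simp add: marginal_def field_simps Un_commute)
        then have gain: "(1 - \<epsilon>) * \<tau> * (real (card (S \<union> T)) - real (card S0)) \<le> g (S \<union> T) - g S0"
          using Suc.prems(5) card by (simp add: algebra_simps)
        have lt: "card (S \<union> T) < \<kappa>" using ok le by simp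
        have "grown P (i + 1) S0 (S \<union> T)"
          using block(4)[OF lt] grown_enough_step[OF size] size(2) card by (auto simp: algebra_simps)
        from IH[OF Suc.prems(1) sub lt gain this]
        have "sure (sample_blocks g \<kappa> \<tau> \<epsilon> P [i+1..j] (S \<union> T)) (\<lambda>S' r. ?Q S')"
          by (rule sure_mono) (use T in auto)
        then show ?thesis using ok
          by (auto simp: block_step_def sure_oracle_round marginal_restrict intro!: sure_bind)
      qed
    qed
    then show ?thesis
      unfolding ij by (intro sure_sample_blocks_Cons[OF Suc.prems(1) t_def False]) auto
  qed
qed

text \<open>A block of size at least \<open>card P\<close> leaves the pool empty or ends the loop.
  The clause \<open>P - S = {} \<longrightarrow> r = 0\<close> lets the induction stop counting
  there, which gives the \<open>+ 1\<close>.\<close>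

lemma sure_sample_blocks_rounds:
  assumes "P \<subseteq> V" "S \<subseteq> V" "card S < \<kappa>"
  shows "sure (sample_blocks g \<kappa> \<tau> \<epsilon> P is S) (\<lambda>S' r. r \<le> length is \<and>
    r \<le> length (filter (\<lambda>i. block_size \<epsilon> i < card P) is) + 1 \<and> (P - S = {} \<longrightarrow> r = 0))"
  using assms
proof (induction "is" arbitrary: S)
  case Nil
  then show ?case by (simp add: sure_return)
next
  case (Cons i "is")
  define t where "t = min (block_size \<epsilon> i) (min (card (P - S)) (\<kappa> - card S))"
  show ?case
  proof (cases "t = 0")
    case True
    from Cons.IH[OF Cons.prems]
    have "sure (sample_blocks g \<kappa> \<tau> \<epsilon> P is S) (\<lambda>S' r. r \<le> length (i # is) \<and>
      r \<le> length (filter (\<lambda>i. block_size \<epsilon> i < card P) (i # is)) + 1 \<and> (P - S = {} \<longrightarrow> r = 0))"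
      by (rule sure_mono) auto
    then show ?thesis unfolding sample_blocks_Cons[OF t_def] using True by simp
  next
    case False
    let ?Q = "\<lambda>r. r \<le> length (i # is) \<and>
      r \<le> length (filter (\<lambda>i. block_size \<epsilon> i < card P) (i # is)) + 1"
    have "sure (block_step P is S T) (\<lambda>S' r. ?Q r)" if T: "T \<subseteq> P - S" "card T = t" for T
    proof (cases "card (S \<union> T) = \<kappa> \<or> marginal g T S / real (card T) \<le> (1 - \<epsilon>) * \<tau>")
      case True
      then show ?thesis
        by (auto simp: block_step_def sure_return sure_oracle_round marginal_restrict intro!: sure_bind)
    next
      case ok: False
      note block = block_sample[OF Cons.prems T t_def]
      have lt: "card (S \<union> T) < \<kappa>" and sub: "S \<union> T \<subseteq> V" using ok block(2,3) by auto
      have "P - (S \<union> T) = {} \<or> block_size \<epsilon> i < card P"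
      proof (rule disjCI)
        assume ne: "\<not> block_size \<epsilon> i < card P"
        have finP: "finite P" using Cons.prems(1) fin by (rule finite_subset)
        have "card (P - S) \<le> card P" using finP by (intro card_mono) auto
        then have "P - (S \<union> T) = {} \<or> card (P - S) \<le> card T"
          using block(4)[OF lt] ne T(2) by linarith
        moreover have "T = P - S" if "card (P - S) \<le> card T"
          using finP T(1) that by (intro card_seteq) auto
        ultimately show "P - (S \<union> T) = {}" by auto
      qed
      then have "sure (sample_blocks g \<kappa> \<tau> \<epsilon> P is (S \<union> T)) (\<lambda>S' r. ?Q (1 + r))"
        by (intro sure_mono[OF Cons.IH[OF Cons.prems(1) sub lt]]) auto
      then show ?thesis using ok
        by (auto simp: block_step_def sure_oracle_round marginal_restrict intro!: sure_bind)
    qed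
    moreover have "\<not> P \<subseteq> S" using nonempty_if_min_card[OF False[unfolded t_def]] by blast
    ultimately show ?thesis
      by (intro sure_sample_blocks_Cons[OF Cons.prems(1) t_def False]) simp
  qed
qed

definition survivors :: "'a set \<Rightarrow> 'a set \<Rightarrow> 'a set" where
  "survivors P S = {x \<in> P. \<tau> \<le> marginal g {x} S}"

definition refine :: "'a set \<Rightarrow> 'a set \<Rightarrow> 'a set comp" where
  "refine P S = do {
     (completed, S') \<leftarrow> sample_singles g \<kappa> \<tau> \<epsilon> P (singles_count \<epsilon>) S;
     (if completed then sample_blocks g \<kappa> \<tau> \<epsilon> P (block_indices \<epsilon> \<kappa>) S' else return_comp S')
   }"

lemma filter_restrict:
  "{x \<in> P. \<tau> \<le> marginal (restrict g (insert S ((\<lambda>x. {x} \<union> S) ` P))) {x} S} = survivors P S"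
  by (auto simp: survivors_def marginal_def)

text \<open>Members of \<open>S\<close> have gain 0, so with a positive threshold the filter already
  removes the elements chosen before.\<close>

lemma survivors_disjoint: "survivors P S \<inter> S = {}"
  using tau by (auto simp: survivors_def marginal_member)

lemma survivors_subset: "survivors P S \<subseteq> P"
  by (auto simp: survivors_def)

lemma survivors_antimono:
  assumes "P \<subseteq> V" "S \<subseteq> S'" "S' \<subseteq> V"
  shows "survivors P S' \<subseteq> survivors P S"
  using marginal_antimono[OF assms(2,3)] assms(1) by (fastforce simp: survivors_def)

lemma sure_refine:
  assumes "P \<subseteq> V" "S \<subseteq> V" "card S < \<kappa>"
  shows "sure (refine P S) (\<lambda>S' r.
    S \<subseteq> S' \<and> S' \<subseteq> S \<union> P \<and> card S' \<le> \<kappa> \<and>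
    r \<le> singles_count \<epsilon> + length (block_indices \<epsilon> \<kappa>) \<and>
    r \<le> singles_count \<epsilon> + length (filter (\<lambda>i. block_size \<epsilon> i < card P)
      (block_indices \<epsilon> \<kappa>)) + 1 \<and>
    density \<epsilon> * \<tau> * (real (card S') - real (card S)) \<le> g S' - g S \<and>
    (P - S \<noteq> {} \<and> (\<forall>x\<in>P - S. \<tau> \<le> marginal g {x} S) \<longrightarrow> card S < card S'))"
  (is "sure _ ?Q")
proof -
  let ?is = "block_indices \<epsilon> \<kappa>"
  have "sure (if c then sample_blocks g \<kappa> \<tau> \<epsilon> P ?is S' else return_comp S') (\<lambda>S'' r. ?Q S'' (m + r))"
    if *: "S \<subseteq> S'" "S' \<subseteq> S \<union> P" "card S' \<le> \<kappa>" "m \<le> singles_count \<epsilon>"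
    "(1 - \<epsilon>) * \<tau> * (real (card S') - real (card S)) \<le> g S' - g S"
    "c \<longrightarrow> card S' = card S + singles_count \<epsilon> \<and> card S' < \<kappa>"
    "P - S \<noteq> {} \<and> (\<forall>x\<in>P - S. \<tau> \<le> marginal g {x} S) \<longrightarrow> card S < card S'"
    for c S' m
  proof (cases c)
    case True
    have "S' \<subseteq> V" using *(2) assms by blast
    then have S': "S' \<subseteq> V" "finite S'" using fin finite_subset by auto
    have size: "1 / \<epsilon> \<le> real (card S') - real (card S)"
      using singles_count_ge(1) *(6) True by simp
    have pos: "0 < 1 / \<epsilon>" using eps by simp
    \<comment> \<open>The index of the first block is chosen so that the completed single samples
      establish \<open>grown\<close>.\<close>
    have "(1 + \<epsilon>) powi \<lfloor>log (1 + \<epsilon>) (1 / \<epsilon>)\<rfloor> \<le> 2 * (real (card S') - real (card S))"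
      using less_le_trans[OF pos size]
      by (intro order_trans[OF order_trans[OF powi_floor_log_le[OF pos] size]]) simp
    with size have "grown P \<lfloor>log (1 + \<epsilon>) (1 / \<epsilon>)\<rfloor> S S'"
      by (intro disjI2 conjI)
    note inv = this
    have lt: "card S' < \<kappa>" using *(6) True by blast
    have "sure (sample_blocks g \<kappa> \<tau> \<epsilon> P ?is S') (\<lambda>S'' r.
        (S' \<subseteq> S'' \<and> S'' \<subseteq> S' \<union> P \<and> card S'' \<le> \<kappa> \<and>
          density \<epsilon> * \<tau> * (real (card S'') - real (card S)) \<le> g S'' - g S) \<and>
        r \<le> length ?is \<and> r \<le> length (filter (\<lambda>i. block_size \<epsilon> i < card P) ?is) + 1 \<and>
        (P - S' = {} \<longrightarrow> r = 0))"
      unfolding block_indices_def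
      by (rule sure_conj[OF sure_sample_blocks[OF assms(1) S'(1) *(1) lt *(5) inv]
            sure_sample_blocks_rounds[OF assms(1) S'(1) lt]])
    then have "sure (sample_blocks g \<kappa> \<tau> \<epsilon> P ?is S') (\<lambda>S'' r. ?Q S'' (m + r))"
    proof (rule sure_mono)
      fix S'' r
      assume **: "(S' \<subseteq> S'' \<and> S'' \<subseteq> S' \<union> P \<and> card S'' \<le> \<kappa> \<and>
          density \<epsilon> * \<tau> * (real (card S'') - real (card S)) \<le> g S'' - g S) \<and>
        r \<le> length ?is \<and> r \<le> length (filter (\<lambda>i. block_size \<epsilon> i < card P) ?is) + 1 \<and>
        (P - S' = {} \<longrightarrow> r = 0)"
      then have b': "card S'' \<le> \<kappa>"
        "density \<epsilon> * \<tau> * (real (card S'') - real (card S)) \<le> g S'' - g S" by blast+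
      from ** have b: "S' \<subseteq> S''" "S'' \<subseteq> S' \<union> P" "r \<le> length ?is"
        "r \<le> length (filter (\<lambda>i. block_size \<epsilon> i < card P) ?is) + 1" by simp_all
      have "S'' \<subseteq> V" using b(2) S'(1) assms(1) by blast
      then have "finite S''" using fin by (rule finite_subset)
      then have card: "card S' \<le> card S''" using b(1) by (rule card_mono)
      show "?Q S'' (m + r)"
      proof (intro conjI impI)
        show "S \<subseteq> S''" "S'' \<subseteq> S \<union> P" using b(1,2) *(1,2) by blast+
        show "m + r \<le> singles_count \<epsilon> + length ?is" using b(3) *(4) by (rule add_mono[rotated])
        show "m + r \<le> singles_count \<epsilon> + length (filter (\<lambda>i. block_size \<epsilon> i < card P) ?is) + 1"
          unfolding add.assoc using b(4) *(4) by (rule add_mono[rotated])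
        assume "P - S \<noteq> {} \<and> (\<forall>x\<in>P - S. \<tau> \<le> marginal g {x} S)"
        then show "card S < card S''" using *(7) card by (meson less_le_trans)
      qed (fact b')+
    qed
    then show ?thesis using True by simp
  next
    case False
    have "S' \<subseteq> V" using *(2) assms by blast
    then have finS': "finite S'" using fin by (rule finite_subset)
    then have "card S \<le> card S'" using *(1) by (intro card_mono)
    then have "density \<epsilon> * \<tau> * (real (card S') - real (card S)) \<le>
      (1 - \<epsilon>) * \<tau> * (real (card S') - real (card S))"
      using density_le tau by (intro mult_right_mono) auto
    then show ?thesis using False * finS' by (auto simp: sure_return)
  qed
  note step = this
  have "sure (sample_singles g \<kappa> \<tau> \<epsilon> P (singles_count \<epsilon>) S) (\<lambda>x m.
    sure (case x of (c, S') \<Rightarrow> if c then sample_blocks g \<kappa> \<tau> \<epsilon> P ?is S' else return_comp S')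
      (\<lambda>S'' r. ?Q S'' (m + r)))"
  proof (rule sure_mono[OF sure_sample_singles[OF assms, of "singles_count \<epsilon>"]], goal_cases)
    case (1 x m)
    obtain c S' where x: "x = (c, S')" by (rule prod.exhaust)
    note * = 1[unfolded x prod.case]
    show ?case unfolding x prod.case
    proof (rule step)
      show "S \<subseteq> S'" "S' \<subseteq> S \<union> P" "card S' \<le> \<kappa>" "m \<le> singles_count \<epsilon>"
        "(1 - \<epsilon>) * \<tau> * (real (card S') - real (card S)) \<le> g S' - g S"
        "c \<longrightarrow> card S' = card S + singles_count \<epsilon> \<and> card S' < \<kappa>"
        "P - S \<noteq> {} \<and> (\<forall>x\<in>P - S. \<tau> \<le> marginal g {x} S) \<longrightarrow> card S < card S'"
        using * singles_count_ge(2) by blast+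
    qed
  qed
  then show ?thesis unfolding refine_def by (rule sure_bind)
qed

definition iteration :: "'a set \<Rightarrow> 'a set \<Rightarrow> ('a set \<times> 'a set) comp" where
  "iteration P S = do {
     a \<leftarrow> oracle_round g (insert S ((\<lambda>x. {x} \<union> S) ` P));
     let P' = {x \<in> P. marginal a {x} S \<ge> \<tau>};
     S' \<leftarrow> refine P' S;
     return_comp (P', S')
   }"

lemma sure_iteration:
  assumes "P \<subseteq> V" "S \<subseteq> V" "card S < \<kappa>" "card P \<le> N"
  shows "sure (iteration P S) (\<lambda>(P', S') r. P' = survivors P S \<and>
    S \<subseteq> S' \<and> S' \<subseteq> S \<union> P' \<and> card S' \<le> \<kappa> \<and> r \<le> iteration_rounds \<epsilon> \<kappa> N \<and>
    density \<epsilon> * \<tau> * (real (card S') - real (card S)) \<le> g S' - g S \<and>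
    (P' \<noteq> {} \<longrightarrow> card S < card S'))" (is "sure _ ?Q")
proof -
  let ?P = "survivors P S"
  have P: "?P \<subseteq> V" using assms survivors_subset by blast
  have "card ?P \<le> N"
    using card_mono[OF finite_subset[OF assms(1) fin] survivors_subset[of P S]] assms(4) by linarith
  then have len: "length (filter (\<lambda>i. block_size \<epsilon> i < card ?P) (block_indices \<epsilon> \<kappa>))
    \<le> length (filter (\<lambda>i. block_size \<epsilon> i < N) (block_indices \<epsilon> \<kappa>))"
    by (intro length_filter_mono) simp
  have "\<forall>x\<in>?P - S. \<tau> \<le> marginal g {x} S" "?P - S = ?P"
    using survivors_disjoint[of P S] by (auto simp: survivors_def)
  note P_facts = this
  have "sure (refine ?P S) (\<lambda>S' r. ?Q (?P, S') (1 + r))"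
    unfolding prod.case
  proof (rule sure_mono[OF sure_refine[OF P assms(2,3)]], elim conjE, intro conjI)
    fix S' r
    assume "r \<le> singles_count \<epsilon> + length (block_indices \<epsilon> \<kappa>)"
      "r \<le> singles_count \<epsilon> + length (filter (\<lambda>i. block_size \<epsilon> i < card ?P) (block_indices \<epsilon> \<kappa>)) + 1"
    then show "1 + r \<le> iteration_rounds \<epsilon> \<kappa> N" using len unfolding iteration_rounds_def by linarith
  next
    fix S' r
    assume "?P - S \<noteq> {} \<and> (\<forall>x\<in>?P - S. \<tau> \<le> marginal g {x} S) \<longrightarrow> card S < card S'"
    then show "?P \<noteq> {} \<longrightarrow> card S < card S'" using P_facts by simp
  qed (rule refl | assumption)+
  then show ?thesis unfolding iteration_def
    by (intro sure_bind)
      (simp only: sure_oracle_round filter_restrict Let_def,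
       intro sure_bind, simp add: sure_return)
qed

lemma threshold_sampling_iteration:
  "threshold_sampling g E \<kappa> \<tau> \<epsilon> = do {
     (P, S) \<leftarrow> while_comp (\<lambda>(P, S). card P > 0 \<and> card S < \<kappa>) (\<lambda>(P, S). iteration P S) (E, {});
     return_comp S
   }"
  unfolding threshold_sampling_def iteration_def refine_def singles_count_def block_indices_def
    Let_def bind_comp_assoc case_prod_unfold ..

text \<open>Elements filtered out stay below \<open>\<tau>\<close> because gains only shrink as the
  set grows. Every iteration either empties the pool or enlarges the set, so the pool size plus the
  number of free slots decreases in every outcome.\<close>

lemma sure_threshold_sampling:
  assumes "E \<subseteq> V"
  shows "sure (threshold_sampling g E \<kappa> \<tau> \<epsilon>) (\<lambda>T r. T \<subseteq> E \<and> card T \<le> \<kappa> \<and>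
    density \<epsilon> * \<tau> * real (card T) \<le> g T - g {} \<and>
    (card T < \<kappa> \<longrightarrow> (\<forall>x\<in>E. marginal g {x} T < \<tau>)))" (is "sure _ ?Q")
proof -
  define I where "I = (\<lambda>(P, S) (m :: nat). P \<subseteq> E \<and> S \<subseteq> E \<and> card S \<le> \<kappa> \<and>
    density \<epsilon> * \<tau> * real (card S) \<le> g S - g {} \<and> (\<forall>x\<in>E - P. marginal g {x} S < \<tau>))"
  define v where "v = (\<lambda>(P :: 'a set, S :: 'a set). card P + (\<kappa> - card S))"
  have finE: "finite E" using assms fin by (rule finite_subset)
  have "sure (while_comp (\<lambda>(P, S). card P > 0 \<and> card S < \<kappa>) (\<lambda>(P, S). iteration P S) (E, {}))
    (\<lambda>s m. I s m \<and> \<not> (case s of (P, S) \<Rightarrow> card P > 0 \<and> card S < \<kappa>))"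
  proof (rule sure_while[where v = v])
    show "I (E, {}) 0" by (simp add: I_def)
  next
    fix s m assume I: "I s m" and "case s of (P, S) \<Rightarrow> card P > 0 \<and> card S < \<kappa>"
    then obtain P S where s: "s = (P, S)" "0 < card P" "card S < \<kappa>" "P \<subseteq> E" "S \<subseteq> E"
      "density \<epsilon> * \<tau> * real (card S) \<le> g S - g {}" "\<forall>x\<in>E - P. marginal g {x} S < \<tau>"
      by (cases s) (auto simp: I_def)
    have sub: "P \<subseteq> V" "S \<subseteq> V" using s assms by auto
    show "sure (case s of (P, S) \<Rightarrow> iteration P S) (\<lambda>s' n. I s' (m + n) \<and> v s' < v s)"
      unfolding s(1) prod.case
    proof (rule sure_mono[OF sure_iteration[OF sub s(3) order_refl]], clarify, intro conjI)
      fix S' r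
      let ?P' = "survivors P S"
      assume *: "S \<subseteq> S'" "S' \<subseteq> S \<union> ?P'" "card S' \<le> \<kappa>"
        "density \<epsilon> * \<tau> * (real (card S') - real (card S)) \<le> g S' - g S"
        "?P' \<noteq> {} \<longrightarrow> card S < card S'"
      have P': "?P' \<subseteq> P" by (rule survivors_subset)
      have S': "S' \<subseteq> E" using * s P' by blast
      have "marginal g {x} S' < \<tau>" if "x \<in> E - ?P'" for x
      proof -
        have "marginal g {x} S < \<tau>" using that s by (auto simp: survivors_def not_le)
        then show ?thesis
          using marginal_antimono[OF *(1), of x] S' assms that by force
      qed
      then show "I (?P', S') (m + r)"
        using * s P' S' by (auto simp: I_def algebra_simps)
      have finP: "finite P" by (rule finite_subset[OF s(4) finE])
      show "v (?P', S') < v (P, S)"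
      proof (cases "?P' = {}")
        case True
        then show ?thesis
          using * s finE card_mono[OF finite_subset[OF S' finE] *(1)] by (simp add: v_def)
      next
        case False
        then show ?thesis using * s card_mono[OF finP P'] by (simp add: v_def)
      qed
    qed
  qed
  then have "sure (while_comp (\<lambda>(P, S). card P > 0 \<and> card S < \<kappa>) (\<lambda>(P, S). iteration P S) (E, {}))
    (\<lambda>s m. sure (case s of (P, S) \<Rightarrow> return_comp S) (\<lambda>T r. ?Q T (m + r)))"
  proof (rule sure_mono)
    fix s m assume *: "I s m \<and> \<not> (case s of (P, S) \<Rightarrow> card P > 0 \<and> card S < \<kappa>)"
    obtain P S where s: "s = (P, S)" by (cases s)
    have I: "I (P, S) m" and stop: "\<not> (0 < card P \<and> card S < \<kappa>)" using * s by auto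
    have "P \<subseteq> E" using I by (simp add: I_def)
    then have "finite P" using finE by (rule finite_subset)
    then have "P = {}" if "card S < \<kappa>" using stop that by (simp add: card_gt_0_iff)
    then show "sure (case s of (P, S) \<Rightarrow> return_comp S) (\<lambda>T r. ?Q T (m + r))"
      using I by (auto simp: s I_def sure_return)
  qed
  then show ?thesis
    unfolding threshold_sampling_iteration by (rule sure_bind)
qed

end

section \<open>Threshold-Sampling: expected number of rounds\<close>

text \<open>The elements of a sequence are drawn from right to left.\<close>

primrec bad_draws :: "('a set \<Rightarrow> 'a \<Rightarrow> bool) \<Rightarrow> 'a list \<Rightarrow> nat" where
  "bad_draws bad [] = 0"
| "bad_draws bad (y # ys) = bad_draws bad ys + (if bad (set ys) y then 1 else 0)"

definition draws :: "'a set \<Rightarrow> nat \<Rightarrow> 'a list set" where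
  "draws R t = {ys. distinct ys \<and> set ys \<subseteq> R \<and> length ys = t}"

lemma finite_draws: "finite R \<Longrightarrow> finite (draws R t)"
  using finite_lists_length_eq[of R t] by (rule rev_finite_subset) (auto simp: draws_def)

lemma sum_draws_Suc:
  fixes \<phi> :: "'a list \<Rightarrow> real"
  assumes "finite R"
  shows "(\<Sum>ys\<in>draws R (Suc t). \<phi> ys) = (\<Sum>ys\<in>draws R t. \<Sum>y\<in>R - set ys. \<phi> (y # ys))"
proof -
  have "(\<Sum>ys\<in>draws R t. \<Sum>y\<in>R - set ys. \<phi> (y # ys)) =
    (\<Sum>(ys, y)\<in>Sigma (draws R t) (\<lambda>ys. R - set ys). \<phi> (y # ys))"
    using assms by (intro sum.Sigma) (auto simp: finite_draws)
  also have "\<dots> = (\<Sum>ys\<in>draws R (Suc t). \<phi> ys)"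
  proof (rule sum.reindex_bij_witness[of _ "\<lambda>ys. (tl ys, hd ys)" "\<lambda>(ys, y). y # ys"])
    fix ys assume "ys \<in> draws R (Suc t)"
    then show "(tl ys, hd ys) \<in> Sigma (draws R t) (\<lambda>ys. R - set ys)"
      "(case (tl ys, hd ys) of (ys, y) \<Rightarrow> y # ys) = ys"
      by (cases ys; auto simp: draws_def)+
  qed (auto simp: draws_def)
  finally show ?thesis ..
qed

text \<open>While the state is good, a draw is bad with probability at most \<open>d\<close>, so that weighting every
  bad draw by \<open>1 / d\<close> at most doubles the mass with every draw.\<close>

lemma sum_draws_le:
  fixes d :: real
  assumes "finite R" "0 < d"
    and mono: "\<And>U y. good (insert y U) \<Longrightarrow> good U"
    and bad: "\<And>U. U \<subseteq> R \<Longrightarrow> good U \<Longrightarrow> real (card {y \<in> R - U. bad U y}) \<le> d * real (card (R - U))"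
  shows "(\<Sum>ys\<in>draws R t. if good (set ys) then (1 / d) ^ bad_draws bad ys else 0) \<le>
    2 ^ t * real (card (draws R t))"
proof (induction t)
  case 0
  have eq: "draws R 0 = {[]}" by (auto simp: draws_def)
  show ?case unfolding eq by simp
next
  case (Suc t)
  let ?w = "\<lambda>ys. if good (set ys) then (1 / d) ^ bad_draws bad ys else 0"
  have step: "(\<Sum>y\<in>R - set ys. ?w (y # ys)) \<le> 2 * real (card R - t) * ?w ys"
    if ys: "ys \<in> draws R t" for ys
  proof (cases "good (set ys)")
    case False
    then have "\<not> good (insert y (set ys))" for y using mono by blast
    then show ?thesis using False by simp
  next
    case True
    have sub: "set ys \<subseteq> R" and len: "card (set ys) = t"
      using ys by (auto simp: draws_def distinct_card)
    have "(\<Sum>y\<in>R - set ys. ?w (y # ys)) \<le>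
      (\<Sum>y\<in>R - set ys. (1 / d) ^ bad_draws bad ys * (if bad (set ys) y then 1 / d else 1))"
      using \<open>0 < d\<close> by (intro sum_mono) auto
    also have "\<dots> = (1 / d) ^ bad_draws bad ys * (\<Sum>y\<in>R - set ys. if bad (set ys) y then 1 / d else 1)"
      by (simp add: sum_distrib_left)
    \<comment> \<open>Bad draws have weight \<open>1 / d\<close> but form at most a share
      \<open>d\<close>, so they contribute no more than all draws with weight 1: this is the factor
      2.\<close>
    also have "(\<Sum>y\<in>R - set ys. if bad (set ys) y then 1 / d else 1) \<le>
      (\<Sum>y\<in>R - set ys. (if bad (set ys) y then 1 / d else 0) + 1)"
      by (intro sum_mono) auto
    also have "\<dots> = (1 / d) * real (card {y \<in> R - set ys. bad (set ys) y}) + real (card (R - set ys))"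
      using \<open>finite R\<close> by (simp add: sum.distrib sum.If_cases Int_def)
    also have "\<dots> \<le> (1 / d) * (d * real (card (R - set ys))) + real (card (R - set ys))"
      using bad[OF sub True] \<open>0 < d\<close> by (intro add_right_mono mult_left_mono) auto
    also have "\<dots> = 2 * real (card R - t)"
      using \<open>0 < d\<close> sub len \<open>finite R\<close> by (simp add: card_Diff_subset finite_subset)
    finally show ?thesis using True \<open>0 < d\<close> by (simp add: mult.commute mult_left_mono)
  qed
  have "real (card (draws R (Suc t))) = (\<Sum>ys\<in>draws R (Suc t). 1)" by simp
  also have "\<dots> = (\<Sum>ys\<in>draws R t. \<Sum>y\<in>R - set ys. 1)" by (rule sum_draws_Suc[OF \<open>finite R\<close>])
  also have "\<dots> = (\<Sum>ys\<in>draws R t. real (card R - t))"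
    by (intro sum.cong refl)
      (auto simp: draws_def distinct_card card_Diff_subset)
  finally have card: "real (card (draws R (Suc t))) = real (card R - t) * real (card (draws R t))"
    by simp
  have "(\<Sum>ys\<in>draws R (Suc t). ?w ys) = (\<Sum>ys\<in>draws R t. \<Sum>y\<in>R - set ys. ?w (y # ys))"
    by (rule sum_draws_Suc[OF \<open>finite R\<close>])
  also have "\<dots> \<le> (\<Sum>ys\<in>draws R t. 2 * real (card R - t) * ?w ys)"
    by (intro sum_mono step)
  also have "\<dots> = 2 * real (card R - t) * (\<Sum>ys\<in>draws R t. ?w ys)"
    by (simp add: sum_distrib_left)
  also have "\<dots> \<le> 2 * real (card R - t) * (2 ^ t * real (card (draws R t)))"
    using Suc.IH by (intro mult_left_mono) auto
  also have "\<dots> = 2 ^ Suc t * real (card (draws R (Suc t)))" by (simp add: card)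
  finally show ?case .
qed

text \<open>A uniform set of size \<open>t\<close> is a uniform sequence with the order forgotten,
  since all such sets have the same number of orderings.\<close>

lemma sum_draws_by_set:
  fixes \<phi> :: "'a list \<Rightarrow> real"
  assumes "finite R"
  shows "(\<Sum>ys\<in>draws R t. \<phi> ys) = (\<Sum>T\<in>{T. T \<subseteq> R \<and> card T = t}. \<Sum>ys\<in>permutations_of_set T. \<phi> ys)"
proof -
  have fin: "finite {T. T \<subseteq> R \<and> card T = t}"
    using assms by (auto intro: finite_subset[of _ "Pow R"])
  have "draws R t = (\<Union>T\<in>{T. T \<subseteq> R \<and> card T = t}. permutations_of_set T)"
    by (auto simp: draws_def permutations_of_set_def distinct_card)
  then show ?thesis
    by (simp only:, intro sum.UNION_disjoint)
      (auto simp: fin permutations_of_set_def finite_permutations_of_set[unfolded permutations_of_set_def])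
qed

text \<open>An exponential Markov bound: a set that satisfies \<open>B\<close> has weight at least
  \<open>(1 / d) powr (e * real t)\<close> in each ordering, while the average weight is at most
  \<open>2 ^ t\<close>. Draws without replacement are dependent, so a bound conditional on the
  earlier draws replaces independence. \<open>good\<close> is known for the final set, and its
  closure under removing elements makes it available at every draw.\<close>

lemma card_bad_samples_le:
  fixes d e :: real
  assumes "finite R" "0 < d" "d \<le> 1"
    and "\<And>U y. good (insert y U) \<Longrightarrow> good U"
    and "\<And>U. U \<subseteq> R \<Longrightarrow> good U \<Longrightarrow> real (card {y \<in> R - U. bad U y}) \<le> d * real (card (R - U))"
    and good: "\<And>T. B T \<Longrightarrow> good T"
    and many: "\<And>ys. B (set ys) \<Longrightarrow> set ys \<subseteq> R \<Longrightarrow> length ys = t \<Longrightarrow> e * real t \<le> real (bad_draws bad ys)"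
  shows "real (card {T. T \<subseteq> R \<and> card T = t \<and> B T}) \<le>
    (2 * d powr e) ^ t * real (card {T. T \<subseteq> R \<and> card T = t})"
proof -
  let ?w = "\<lambda>ys. if good (set ys) then (1 / d) ^ bad_draws bad ys else 0"
  let ?A = "{T. T \<subseteq> R \<and> card T = t}"
  have finA: "finite ?A" using assms(1) by (auto intro: finite_subset[of _ "Pow R"])
  have card: "card (permutations_of_set T) = fact t" if "T \<in> ?A" for T
    using that \<open>finite R\<close> by (auto simp: finite_subset)
  have w: "(1 / d) powr (e * real t) \<le> ?w ys" if "B T" "T \<in> ?A" "ys \<in> permutations_of_set T" for T ys
  proof -
    have "set ys = T" "length ys = t" using that by (auto simp: permutations_of_set_def distinct_card)
    then have "good (set ys)" "e * real t \<le> real (bad_draws bad ys)"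
      using that good many by auto
    moreover from this have "(1 / d) powr (e * real t) \<le> (1 / d) powr real (bad_draws bad ys)"
      using assms(2,3) by (intro powr_mono) auto
    ultimately show ?thesis using \<open>0 < d\<close> by (simp add: powr_realpow)
  qed
  have "fact t * (1 / d) powr (e * real t) * real (card {T \<in> ?A. B T}) =
    (\<Sum>T\<in>{T \<in> ?A. B T}. \<Sum>ys\<in>permutations_of_set T. (1 / d) powr (e * real t))"
    by (simp add: card)
  also have "\<dots> \<le> (\<Sum>T\<in>{T \<in> ?A. B T}. \<Sum>ys\<in>permutations_of_set T. ?w ys)"
    by (intro sum_mono w) auto
  also have "\<dots> \<le> (\<Sum>T\<in>?A. \<Sum>ys\<in>permutations_of_set T. ?w ys)"
    using finA \<open>0 < d\<close> by (intro sum_mono2 sum_nonneg) auto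
  also have "\<dots> = (\<Sum>ys\<in>draws R t. ?w ys)" by (rule sum_draws_by_set[symmetric, OF assms(1)])
  also have "\<dots> \<le> 2 ^ t * real (card (draws R t))" by (rule sum_draws_le[OF assms(1,2,4,5)])
  also have "real (card (draws R t)) = (\<Sum>ys\<in>draws R t. 1)" by simp
  also have "\<dots> = fact t * real (card ?A)"
    unfolding sum_draws_by_set[OF assms(1)] by (simp add: card)
  finally have "(1 / d) powr (e * real t) * real (card {T \<in> ?A. B T}) \<le> 2 ^ t * real (card ?A)"
    by (simp add: mult.assoc mult.left_commute[of "2 ^ t"])
  moreover have "(1 / d) powr (e * real t) = 1 / (d powr e) ^ t"
    using \<open>0 < d\<close> by (simp add: powr_divide powr_powr[symmetric] powr_realpow)
  ultimately have "real (card {T \<in> ?A. B T}) \<le> (d powr e) ^ t * (2 ^ t * real (card ?A))"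
    using \<open>0 < d\<close> by (simp add: field_simps)
  then show ?thesis by (simp add: power_mult_distrib algebra_simps)
qed

text \<open>An empty block runs no test and so cannot end the loop, whereas the power alone would
  charge it with 1.\<close>

definition block_weight :: "real \<Rightarrow> real \<Rightarrow> int \<Rightarrow> real" where
  "block_weight \<epsilon> d i = (if block_size \<epsilon> i = 0 then 0 else (2 * d powr \<epsilon>) ^ block_size \<epsilon> i)"

lemma block_weight_nonneg: "0 \<le> block_weight \<epsilon> d i"
  by (simp add: block_weight_def)

section \<open>Probability that an iteration is stuck\<close>

context threshold_instance
begin

text \<open>Telescoping along the draws: a draw that is not bad adds at least \<open>\<tau>\<close>,
  and by monotonicity a bad one loses nothing.\<close>

lemma bad_draws_marginal:
  assumes "S \<subseteq> V" "set ys \<subseteq> V"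
  shows "\<tau> * (real (length ys) - real (bad_draws (\<lambda>U y. marginal g {y} (S \<union> U) < \<tau>) ys)) \<le>
    marginal g (set ys) S"
  using assms(2)
proof (induction ys)
  case Nil
  then show ?case by (simp add: marginal_def)
next
  case (Cons y ys)
  have "marginal g (set (y # ys)) S = marginal g {y} (S \<union> set ys) + marginal g (set ys) S"
    by (simp add: marginal_def Un_commute)
  moreover have "0 \<le> marginal g {y} (S \<union> set ys)"
    using Cons.prems assms by (intro marginal_nonneg) auto
  ultimately show ?case using Cons by (auto simp: algebra_simps)
qed

text \<open>An iteration that starts with the filtered elements \<open>P\<close> and the set \<open>S0\<close> and ends with \<open>S\<close>
  makes no progress: the loop goes on, more than the fraction \<open>1 - d\<close> of the elements survives
  the next filtering, and fewer than \<open>\<kappa> / 2\<close> elements have been added.\<close>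

definition stuck :: "real \<Rightarrow> 'a set \<Rightarrow> 'a set \<Rightarrow> 'a set \<Rightarrow> bool" where
  "stuck d P S0 S \<longleftrightarrow> card S < \<kappa> \<and>
     (1 - d) * real (card P) < real (card (survivors P S)) \<and>
     2 * (real (card S) - real (card S0)) < real \<kappa>"

lemma not_stuck_if_exhausted:
  assumes "P - S = {}" "d \<le> 1"
  shows "\<not> stuck d P S0 S"
proof -
  have "survivors P S = {}" using assms survivors_disjoint[of P S] survivors_subset[of P S] by blast
  then show ?thesis using assms by (simp add: stuck_def not_less)
qed

text \<open>All survivors lie in \<open>P - S\<close>, so a share \<open>1 - d\<close> of
  \<open>P\<close> surviving leaves at most a share \<open>d\<close> of the smaller set
  \<open>P - S\<close>.\<close>

lemma card_nonsurvivors: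
  assumes "P \<subseteq> V" "S \<subseteq> V" "(1 - d) * real (card P) < real (card (survivors P S))" "d \<le> 1"
  shows "real (card {x \<in> P - S. marginal g {x} S < \<tau>}) \<le> d * real (card (P - S))"
proof -
  have finP: "finite P" using assms(1) fin by (rule finite_subset)
  have "{x \<in> P - S. marginal g {x} S < \<tau>} = (P - S) - survivors P S"
    by (auto simp: survivors_def not_le)
  moreover have "survivors P S \<subseteq> P - S"
    using survivors_disjoint[of P S] survivors_subset[of P S] by blast
  ultimately have "real (card {x \<in> P - S. marginal g {x} S < \<tau>}) =
      real (card (P - S)) - real (card (survivors P S))"
    using finP by (simp add: card_Diff_subset finite_subset of_nat_diff card_mono)
  also have "\<dots> \<le> real (card (P - S)) - (1 - d) * real (card P)" using assms by simp
  also have "\<dots> \<le> real (card (P - S)) - (1 - d) * real (card (P - S))"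
    using assms finP card_mono[OF finP, of "P - S"] by (intro diff_left_mono mult_left_mono) auto
  finally show ?thesis by (simp add: algebra_simps)
qed

text \<open>A failed test on the average forces at least \<open>\<epsilon> * t\<close> draws with
  gain below \<open>\<tau>\<close>. If most of \<open>P\<close> survives at the end, then by
  submodularity most of it survived before every draw, so each such draw had conditional probability
  at most \<open>d\<close>.\<close>

lemma card_stuck_samples_le:
  assumes "P \<subseteq> V" "S \<subseteq> V" "0 < d" "d \<le> 1" "0 < t"
  shows "real (card {T. T \<subseteq> P - S \<and> card T = t \<and>
      marginal g T S / real t \<le> (1 - \<epsilon>) * \<tau> \<and> stuck d P S0 (S \<union> T)}) \<le>
    (2 * d powr \<epsilon>) ^ t * real (card {T. T \<subseteq> P - S \<and> card T = t})"
proof -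
  have finPS: "finite (P - S)" using finite_subset[OF assms(1) fin] by simp
  let ?good = "\<lambda>U. U \<subseteq> P - S \<and> (1 - d) * real (card P) < real (card (survivors P (S \<union> U)))"
  let ?bad = "\<lambda>U y. marginal g {y} (S \<union> U) < \<tau>"
  let ?B = "\<lambda>T. T \<subseteq> P - S \<and> marginal g T S / real t \<le> (1 - \<epsilon>) * \<tau> \<and> stuck d P S0 (S \<union> T)"
  have "real (card {T. T \<subseteq> P - S \<and> card T = t \<and> ?B T}) \<le>
    (2 * d powr \<epsilon>) ^ t * real (card {T. T \<subseteq> P - S \<and> card T = t})"
  proof (rule card_bad_samples_le[where good = ?good and bad = ?bad])
    fix U y assume *: "?good (insert y U)"
    have "survivors P (S \<union> insert y U) \<subseteq> survivors P (S \<union> U)"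
      using * assms by (intro survivors_antimono) auto
    moreover have "finite (survivors P (S \<union> U))"
      using survivors_subset assms fin by (meson finite_subset subset_trans)
    ultimately have "card (survivors P (S \<union> insert y U)) \<le> card (survivors P (S \<union> U))"
      by (intro card_mono)
    then show "?good U" using * by auto
  next
    fix U assume U: "U \<subseteq> P - S" "?good U"
    then show "real (card {y \<in> P - S - U. ?bad U y}) \<le> d * real (card (P - S - U))"
      using card_nonsurvivors[of P "S \<union> U" d] assms by (auto simp: Diff_eq Int_assoc)
  next
    fix ys assume ys: "?B (set ys)" "set ys \<subseteq> P - S" "length ys = t"
    have "\<tau> * (real t - real (bad_draws ?bad ys)) \<le> marginal g (set ys) S"
      using bad_draws_marginal[of S ys] ys assms by auto
    also have "\<dots> \<le> (1 - \<epsilon>) * \<tau> * real t" using ys \<open>0 < t\<close> by (simp add: field_simps)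
    also have "\<dots> = \<tau> * ((1 - \<epsilon>) * real t)" by simp
    finally have "real t - real (bad_draws ?bad ys) \<le> (1 - \<epsilon>) * real t"
      using tau by (simp only: mult_le_cancel_left_pos)
    then show "\<epsilon> * real t \<le> real (bad_draws ?bad ys)" by (simp add: algebra_simps)
  qed (use assms finPS in \<open>auto simp: stuck_def\<close>)
  moreover have "{T. T \<subseteq> P - S \<and> card T = t \<and> ?B T} = {T. T \<subseteq> P - S \<and> card T = t \<and>
      marginal g T S / real t \<le> (1 - \<epsilon>) * \<tau> \<and> stuck d P S0 (S \<union> T)}" by auto
  ultimately show ?thesis by simp
qed

abbreviation stuck_prob :: "real \<Rightarrow> 'a set \<Rightarrow> 'a set \<Rightarrow> 'a set comp \<Rightarrow> ennreal" where
  "stuck_prob d P S0 c \<equiv> expect c (\<lambda>S _. if stuck d P S0 S then 1 else 0)"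

text \<open>A loop that runs through all its indices is not stuck: the pool is exhausted or, by
  \<open>grown\<close> at the last index, at least \<open>\<kappa> / 2\<close> elements were added.
  Hence only a failed test can lead to a stuck state, and the block weights add up.\<close>

lemma stuck_prob_sample_blocks:
  assumes "0 < d" "d \<le> 1" "P \<subseteq> V" "S \<subseteq> V" "S0 \<subseteq> S" "card S < \<kappa>"
    and "grown P i S0 S"
    and "i \<le> j + 1" and j: "real \<kappa> \<le> (1 + \<epsilon>) powi (j + 1)"
  shows "stuck_prob d P S0 (sample_blocks g \<kappa> \<tau> \<epsilon> P [i..j] S) \<le> ennreal (\<Sum>i\<in>{i..j}. block_weight \<epsilon> d i)"
  using assms(3-8)
proof (induction "nat (j + 1 - i)" arbitrary: i S)
  case 0
  then have "i = j + 1" by simp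
  then have "\<not> stuck d P S0 S"
    using 0 j not_stuck_if_exhausted[of P S d S0] \<open>d \<le> 1\<close> by (auto simp: stuck_def)
  then show ?case using \<open>i = j + 1\<close> by (simp add: expect_return)
next
  case (Suc n)
  have ij: "[i..j] = i # [i+1..j]" using Suc.hyps(2) by (intro upto_rec1) simp
  define t where "t = min (block_size \<epsilon> i) (min (card (P - S)) (\<kappa> - card S))"
  have n: "n = nat (j + 1 - (i + 1))" and ij1: "i + 1 \<le> j + 1" using Suc.hyps(2) by simp_all
  note IH = Suc.hyps(1)[OF n]
  let ?rest = "\<Sum>i\<in>{i+1..j}. block_weight \<epsilon> d i"
  have rest: "0 \<le> ?rest" by (intro sum_nonneg block_weight_nonneg)
  have "{i..j} = insert i {i+1..j}" using ij1 by auto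
  then have sum: "(\<Sum>i\<in>{i..j}. block_weight \<epsilon> d i) = block_weight \<epsilon> d i + ?rest" by simp
  show ?case
  proof (cases "t = 0")
    case True
    have "P - S = {} \<or> block_size \<epsilon> i = 0"
      using Suc.prems(1,4) by (rule empty_block) (use True t_def in simp)
    then have "grown P (i+1) S0 S"
      using grown_enough_step[of i "real (card S) - real (card S0)"] Suc.prems by auto
    from IH[OF Suc.prems(1-4) this ij1]
    have "stuck_prob d P S0 (sample_blocks g \<kappa> \<tau> \<epsilon> P [i+1..j] S) \<le> ennreal ?rest" .
    also have "\<dots> \<le> ennreal (\<Sum>i\<in>{i..j}. block_weight \<epsilon> d i)"
      using block_weight_nonneg[of \<epsilon> d i] by (intro ennreal_leI) (simp add: sum)
    finally show ?thesis unfolding ij sample_blocks_Cons[OF t_def] using True by simp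
  next
    case False
    let ?A = "{T. T \<subseteq> P - S \<and> card T = t}"
    let ?B = "\<lambda>T. marginal g T S / real t \<le> (1 - \<epsilon>) * \<tau> \<and> stuck d P S0 (S \<union> T)"
    have tle: "t \<le> card (P - S)" by (simp add: t_def)
    have ne: "P - S \<noteq> {}" by (rule nonempty_if_min_card[OF False[unfolded t_def]])
    then have size: "(1 + \<epsilon>) powi i \<le> 2 * (real (card S) - real (card S0))"
      "1 / \<epsilon> \<le> real (card S) - real (card S0)" using Suc.prems by auto
    note A = finite_samples[OF Suc.prems(1), of S t] samples_nonempty[OF Suc.prems(1) tle]
    \<comment> \<open>A block that was cut short exhausts the pool or fills the set, and neither is
      stuck. So only blocks of the nominal size are charged.\<close>
    have step: "stuck_prob d P S0 (block_step P [i+1..j] S T) \<le>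
      ennreal (?rest + (if t = block_size \<epsilon> i \<and> ?B T then 1 else 0))" if T: "T \<in> ?A" for T
    proof -
      have T': "T \<subseteq> P - S" "card T = t" using T by auto
      note block = block_sample[OF Suc.prems(1,2,4) T' t_def]
      note card = block(1) and le = block(2) and ex = block(4)
      have sub: "S \<union> T \<subseteq> V" "S0 \<subseteq> S \<union> T" using block(3) Suc.prems by auto
      show ?thesis
      proof (cases "card (S \<union> T) = \<kappa>")
        case True
        then show ?thesis using rest by (simp add: block_step_def expect_return stuck_def)
      next
        case ne: False
        then have lt: "card (S \<union> T) < \<kappa>" using le by simp
        show ?thesis
        proof (cases "marginal g T S / real (card T) \<le> (1 - \<epsilon>) * \<tau>")
          case True
          then have eq: "stuck_prob d P S0 (block_step P [i+1..j] S T) = (if stuck d P S0 (S \<union> T) then 1 else 0)"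
            using ne by (simp add: block_step_def expect_return expect_bind expect_oracle_round marginal_restrict)
          show ?thesis
            using ex[OF lt] not_stuck_if_exhausted[OF _ \<open>d \<le> 1\<close>, of P "S \<union> T" S0] rest True T
            unfolding eq by (auto simp: ennreal_plus simp del: Diff_eq_empty_iff)
        next
          case ok: False
          have "grown P (i + 1) S0 (S \<union> T)"
            using ex[OF lt] grown_enough_step[OF size] size(2) card by (auto simp: algebra_simps)
          from IH[OF Suc.prems(1) sub lt this ij1]
          have "stuck_prob d P S0 (sample_blocks g \<kappa> \<tau> \<epsilon> P [i+1..j] (S \<union> T)) \<le> ennreal ?rest" .
          also have "\<dots> \<le> ennreal (?rest + (if t = block_size \<epsilon> i \<and> ?B T then 1 else 0))"
            by (intro ennreal_leI) simp
          finally show ?thesis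
            using ne ok by (simp add: block_step_def expect_bind expect_oracle_round marginal_restrict)
        qed
      qed
    qed
    have count: "real (card {T \<in> ?A. t = block_size \<epsilon> i \<and> ?B T}) \<le> block_weight \<epsilon> d i * real (card ?A)"
    proof (cases "t = block_size \<epsilon> i")
      case True
      then have "{T \<in> ?A. t = block_size \<epsilon> i \<and> ?B T} = {T. T \<subseteq> P - S \<and> card T = t \<and> ?B T}" by auto
      then show ?thesis
        using card_stuck_samples_le[OF Suc.prems(1,2) assms(1,2), of t S0] False True
        by (simp add: block_weight_def)
    next
      case False
      then show ?thesis using block_weight_nonneg by simp
    qed
    show ?thesis
      unfolding ij sample_blocks_Cons[OF t_def] if_not_P[OF False] sum add.commute[of "block_weight _ _ _"]
      by (rule expect_uniform_bind_le[OF A rest step count])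
  qed
qed

text \<open>A break at \<open>x\<close> leaves \<open>S\<close> as the final state. If that state is
  stuck, then \<open>x\<close> is one of the few nonsurvivors, so each sample costs at most
  \<open>d\<close>. \<open>\<beta>\<close> stands for the cost of the blocks, which are reached only
  after all \<open>N\<close> samples.\<close>

lemma expect_sample_singles_le:
  fixes h :: "'a set \<Rightarrow> ennreal"
  assumes "0 < d" "d \<le> 1" "P \<subseteq> V" "S0 \<subseteq> V" "0 \<le> \<beta>"
    and h: "\<And>S'. S0 \<subseteq> S' \<Longrightarrow> S' \<subseteq> S0 \<union> P \<Longrightarrow> card S' = card S0 + N \<Longrightarrow> card S' < \<kappa> \<Longrightarrow> h S' \<le> ennreal \<beta>"
    and "S0 \<subseteq> S" "S \<subseteq> S0 \<union> P" "card S + n = card S0 + N" "card S < \<kappa>"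
  shows "expect (sample_singles g \<kappa> \<tau> \<epsilon> P n S)
      (\<lambda>(c, S') _. if c then h S' else if stuck d P S0 S' then 1 else 0) \<le> ennreal (real n * d + \<beta>)"
    (is "expect _ ?\<phi> \<le> _")
  using assms(7-10)
proof (induction n arbitrary: S)
  case 0
  then show ?case using h by (simp add: expect_return)
next
  case (Suc n)
  have sub: "S \<subseteq> V" using Suc.prems assms by auto
  have finP: "finite (P - S)" using finite_subset[OF assms(3) fin] by simp
  have finS: "finite S" using sub fin by (rule finite_subset)
  have nonneg: "0 \<le> real n * d + \<beta>" using assms by simp
  show ?case
  proof (cases "P - S = {}")
    case True
    then show ?thesis
      using not_stuck_if_exhausted[OF True \<open>d \<le> 1\<close>] by (simp add: expect_return)
  next
    case False
    let ?bad = "\<lambda>x. marginal g {x} S < \<tau> \<and> stuck d P S0 S"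
    let ?c = "\<lambda>x a. if marginal a {x} S \<le> (1 - \<epsilon>) * \<tau> then return_comp (False, S)
        else if card (S \<union> {x}) = \<kappa> then return_comp (False, S \<union> {x})
        else sample_singles g \<kappa> \<tau> \<epsilon> P n (S \<union> {x})"
    have step: "expect (oracle_round g {{x} \<union> S, S} \<bind> ?c x) ?\<phi> \<le>
      ennreal ((real n * d + \<beta>) + (if ?bad x then 1 else 0))" if x: "x \<in> P - S" for x
    proof -
      have eq: "expect (oracle_round g {{x} \<union> S, S} \<bind> ?c x) ?\<phi> = expect (?c x g) ?\<phi>"
        by (simp only: expect_bind expect_oracle_round marginal_restrict) (simp add: case_prod_unfold)
      have card: "card (S \<union> {x}) = card S + 1" using x finS by simp
      consider (break) "marginal g {x} S \<le> (1 - \<epsilon>) * \<tau>"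
        | (full) "\<not> marginal g {x} S \<le> (1 - \<epsilon>) * \<tau>" "card (S \<union> {x}) = \<kappa>"
        | (continue) "\<not> marginal g {x} S \<le> (1 - \<epsilon>) * \<tau>" "card (S \<union> {x}) \<noteq> \<kappa>" by blast
      then show ?thesis
      proof cases
        case break
        moreover have "(1 - \<epsilon>) * \<tau> < \<tau>" using eps tau by simp
        ultimately have "marginal g {x} S < \<tau>" by linarith
        then show ?thesis using break nonneg unfolding eq
          by (auto simp: expect_return ennreal_plus)
      next
        case full
        then show ?thesis unfolding eq by (simp add: expect_return stuck_def)
      next
        case continue
        have "expect (sample_singles g \<kappa> \<tau> \<epsilon> P n (S \<union> {x})) ?\<phi> \<le> ennreal (real n * d + \<beta>)"
          using x card Suc.prems continue by (intro Suc.IH) auto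
        also have "\<dots> \<le> ennreal ((real n * d + \<beta>) + (if ?bad x then 1 else 0))"
          by (intro ennreal_leI) simp
        finally show ?thesis unfolding eq using continue by simp
      qed
    qed
    have count: "real (card {x \<in> P - S. ?bad x}) \<le> d * real (card (P - S))"
    proof (cases "stuck d P S0 S")
      case True
      then show ?thesis
        using card_nonsurvivors[OF assms(3) sub _ assms(2)] by (simp add: stuck_def)
    next
      case False
      then show ?thesis using \<open>0 < d\<close> by simp
    qed
    have eq: "real (Suc n) * d + \<beta> = (real n * d + \<beta>) + d" by (simp add: algebra_simps)
    show ?thesis
      unfolding sample_singles.simps if_not_P[OF False] eq
      by (rule expect_uniform_bind_le[OF finP False nonneg step count])
  qed
qed

lemma stuck_prob_refine:
  assumes "0 < d" "d \<le> 1" "P \<subseteq> V" "S \<subseteq> V" "card S < \<kappa>"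
  shows "stuck_prob d P S (refine P S) \<le>
    ennreal (real (singles_count \<epsilon>) * d + (\<Sum>i\<in>set (block_indices \<epsilon> \<kappa>). block_weight \<epsilon> d i))"
proof -
  let ?i = "\<lfloor>log (1 + \<epsilon>) (1 / \<epsilon>)\<rfloor>" and ?j = "\<lceil>log (1 + \<epsilon>) (real \<kappa>)\<rceil> - 1"
  let ?\<beta> = "\<Sum>i\<in>set (block_indices \<epsilon> \<kappa>). block_weight \<epsilon> d i"
  let ?h = "\<lambda>S'. stuck_prob d P S (sample_blocks g \<kappa> \<tau> \<epsilon> P (block_indices \<epsilon> \<kappa>) S')"
  have set: "set (block_indices \<epsilon> \<kappa>) = {?i..?j}" by (simp add: block_indices_def)
  have i: "(1 + \<epsilon>) powi ?i \<le> 1 / \<epsilon>" using eps by (intro powi_floor_log_le) simp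
  have j: "real \<kappa> \<le> (1 + \<epsilon>) powi (?j + 1)" using le_powi_ceiling_log[of "real \<kappa>"] assms by simp
  have h: "?h S' \<le> ennreal ?\<beta>"
    if S': "S \<subseteq> S'" "S' \<subseteq> S \<union> P" "card S' = card S + singles_count \<epsilon>" "card S' < \<kappa>" for S'
  proof -
    have size: "1 / \<epsilon> \<le> real (card S') - real (card S)" using S' singles_count_ge by simp
    \<comment> \<open>Otherwise \<open>\<kappa> \<le> 1 / \<epsilon>\<close>, and the single samples
      would already have filled the set.\<close>
    have "?i \<le> ?j + 1"
    proof (rule ccontr)
      assume "\<not> ?i \<le> ?j + 1"
      then have "real \<kappa> \<le> (1 + \<epsilon>) powi ?i"
        using j eps power_int_increasing[of "?j + 1" ?i "1 + \<epsilon>"] by linarith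
      then show False using i size S' by linarith
    qed
    moreover have "(1 + \<epsilon>) powi ?i \<le> 2 * (real (card S') - real (card S))"
    proof -
      have "0 < 1 / \<epsilon>" using eps by simp
      then show ?thesis
        using less_le_trans[OF \<open>0 < 1 / \<epsilon>\<close> size] by (intro order_trans[OF order_trans[OF i size]]) simp
    qed
    moreover have "S' \<subseteq> V" using S' assms by blast
    ultimately show ?thesis
      using assms S' size j unfolding set unfolding block_indices_def
      by (intro stuck_prob_sample_blocks) auto
  qed
  have "stuck_prob d P S (refine P S) = expect (sample_singles g \<kappa> \<tau> \<epsilon> P (singles_count \<epsilon>) S)
      (\<lambda>(c, S') _. if c then ?h S' else if stuck d P S S' then 1 else 0)"
    unfolding refine_def expect_bind
    by (rule arg_cong[where f = "expect _"]) (auto simp: fun_eq_iff expect_return)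
  also have "\<dots> \<le> ennreal (real (singles_count \<epsilon>) * d + ?\<beta>)"
    using h assms by (intro expect_sample_singles_le[where N = "singles_count \<epsilon>"])
      (auto intro!: sum_nonneg block_weight_nonneg)
  finally show ?thesis .
qed

text \<open>A finished loop has value 1. If the next filtering leaves nothing, one more iteration
  follows, hence a factor 2. Otherwise the survivor count enters with a power so large that losing a
  share \<open>d\<close> divides it by 4. The extra factor 4 pays for an iteration that adds half of
  \<open>\<kappa>\<close>, and 8 ensures that a drop to a value of at most 2 is also a division by
  4.\<close>

definition potential :: "nat \<Rightarrow> 'a set \<times> 'a set \<Rightarrow> real" where
  "potential p = (\<lambda>(P, S). if 0 < card P \<and> card S < \<kappa>
     then if survivors P S = {} then 2
       else 8 * real (card (survivors P S)) ^ p * (if 2 * card S < \<kappa> then 4 else 1)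
     else 1)"

lemma potential_decrease:
  fixes d :: real
  assumes "P \<subseteq> V" "0 < card P" "card S < \<kappa>" "survivors P S \<noteq> {}"
    and S': "S \<subseteq> S'" "S' \<subseteq> V"
    and d: "0 < d" "d \<le> 1" "(1 - d) ^ p \<le> 1 / 4"
  shows "potential p (survivors P S, S') \<le>
    potential p (P, S) / 4 + potential p (P, S) * (if stuck d (survivors P S) S S' then 1 else 0)"
proof -
  let ?P = "survivors P S"
  let ?W = "potential p (P, S)"
  define q q' where "q = card ?P" and "q' = card (survivors ?P S')"
  have finP: "finite ?P" using assms(1) survivors_subset fin by (meson finite_subset)
  have q: "1 \<le> q" using assms(4) finP by (simp add: q_def Suc_leI card_gt_0_iff)
  have q': "q' \<le> q" unfolding q_def q'_def by (intro card_mono finP survivors_subset)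
  have cardS: "card S \<le> card S'" using S' fin by (meson card_mono finite_subset)
  have W: "?W = 8 * real q ^ p * (if 2 * card S < \<kappa> then 4 else 1)"
    using assms by (simp add: potential_def q_def)
  have "1 \<le> real q ^ p" using q by simp
  then have W8: "8 \<le> ?W" unfolding W by simp
  show ?thesis
  proof (cases "card S' < \<kappa> \<and> survivors ?P S' \<noteq> {}")
    case False
    then have "potential p (?P, S') \<le> 2" by (auto simp: potential_def)
    then show ?thesis using W8 by simp
  next
    case True
    have "survivors ?P S' \<subseteq> ?P" by (rule survivors_subset)
    then have V': "potential p (?P, S') = 8 * real q' ^ p * (if 2 * card S' < \<kappa> then 4 else 1)"
      using True finP by (auto simp: potential_def q'_def card_gt_0_iff)
    have pow: "real q' ^ p \<le> real q ^ p" using q' by (intro power_mono) auto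
    show ?thesis
    proof (cases "stuck d ?P S S'")
      case True
      have "potential p (?P, S') \<le> ?W"
        unfolding V' W using pow cardS by (intro mult_mono) auto
      then show ?thesis using True W8 by simp
    next
      case False
      have "potential p (?P, S') \<le> ?W / 4"
      proof (cases "real q' \<le> (1 - d) * real q")
        case small: True
        have "real q' ^ p \<le> ((1 - d) * real q) ^ p" using small by (intro power_mono) auto
        also have "\<dots> \<le> 1 / 4 * real q ^ p"
          unfolding power_mult_distrib using d(3) by (rule mult_right_mono) simp
        finally have "real q' ^ p \<le> real q ^ p / 4" by simp
        then have "8 * real q' ^ p * (if 2 * card S' < \<kappa> then 4 else 1) \<le>
          8 * (real q ^ p / 4) * (if 2 * card S < \<kappa> then 4 else 1)"
          using cardS by (intro mult_mono) auto
        then show ?thesis unfolding V' W by simp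
      next
        case large: False
        then have "real \<kappa> \<le> 2 * (real (card S') - real (card S))"
          using False True by (simp add: stuck_def q_def q'_def not_less)
        \<comment> \<open>At least half of \<open>\<kappa>\<close> was added in a single iteration
          and the set is still not full. So this iteration crosses \<open>\<kappa> / 2\<close>, and
          the extra factor 4 disappears.\<close>
        then have "2 * card S < \<kappa>" "\<not> 2 * card S' < \<kappa>"
          using True by (simp_all only: of_nat_less_iff[where 'a = real, symmetric]) auto
        then show ?thesis unfolding V' W using pow by simp
      qed
      then show ?thesis using False by simp
    qed
  qed
qed

text \<open>The rounds of the iteration contribute a factor of at most 2. The potential falls to a
  quarter, except with the stuck probability, which is at most 1 / 4. Since 2 (1 / 4 + 1 / 4) = 1,
  the product of \<open>b ^ n\<close> and the potential does not grow in expectation.\<close>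

lemma expect_iteration_le:
  fixes b d :: real
  assumes "P \<subseteq> V" "S \<subseteq> V" "0 < card P" "card S < \<kappa>" "card P \<le> N"
    and b: "1 \<le> b" "b ^ iteration_rounds \<epsilon> \<kappa> N \<le> 2"
    and d: "0 < d" "d \<le> 1" "(1 - d) ^ p \<le> 1 / 4"
    and prob: "real (singles_count \<epsilon>) * d + (\<Sum>i\<in>set (block_indices \<epsilon> \<kappa>). block_weight \<epsilon> d i) \<le> 1 / 4"
  shows "expect (iteration P S) (\<lambda>s n. ennreal b ^ n * ennreal (potential p s)) \<le> ennreal (potential p (P, S))"
proof -
  let ?P = "survivors P S"
  let ?W = "potential p (P, S)"
  have pos: "0 \<le> potential p s" for s by (auto simp: potential_def split: prod.splits)
  have P: "?P \<subseteq> V" using assms survivors_subset by blast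
  have pow: "ennreal b ^ n \<le> 2" if "n \<le> iteration_rounds \<epsilon> \<kappa> N" for n
  proof -
    have "b ^ n \<le> 2" using b that power_increasing[OF that, of b] by linarith
    then have "ennreal (b ^ n) \<le> ennreal 2" by (rule ennreal_leI)
    then show ?thesis using b by (simp add: ennreal_power)
  qed
  note sure = sure_iteration[OF assms(1,2,4,5)]
  show ?thesis
  proof (cases "?P = {}")
    case True
    have "expect (iteration P S) (\<lambda>s n. ennreal b ^ n * ennreal (potential p s)) \<le> 2"
    proof (rule expect_le_const[OF sure], clarify)
      fix S' n assume "n \<le> iteration_rounds \<epsilon> \<kappa> N"
      then show "ennreal b ^ n * ennreal (potential p (?P, S')) \<le> 2"
        using pow True by (simp add: potential_def)
    qed
    then show ?thesis using True assms by (simp add: potential_def)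
  next
    case False
    let ?\<phi> = "\<lambda>s. ennreal ?W / 2 + 2 * ennreal ?W * (if stuck d ?P S (snd s) then 1 else 0)"
    have half: "ennreal (?W / 4 * 2) = ennreal ?W / 2"
      using pos by (simp add: divide_ennreal[symmetric])
    have "expect (iteration P S) (\<lambda>s n. ennreal b ^ n * ennreal (potential p s)) \<le>
      expect (iteration P S) (\<lambda>s n. ?\<phi> s)"
    proof (rule expect_mono[OF sure], clarify)
      fix S' n
      assume *: "S \<subseteq> S'" "S' \<subseteq> S \<union> ?P" "n \<le> iteration_rounds \<epsilon> \<kappa> N"
      have "S' \<subseteq> V" using * P assms by auto
      then have le: "potential p (?P, S') \<le> ?W / 4 + ?W * (if stuck d ?P S S' then 1 else 0)"
        using assms False * by (intro potential_decrease) auto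
      have "ennreal b ^ n * ennreal (potential p (?P, S')) \<le>
        2 * ennreal (?W / 4 + ?W * (if stuck d ?P S S' then 1 else 0))"
        using pow[OF *(3)] le by (intro mult_mono ennreal_leI) auto
      also have "\<dots> = ennreal (2 * (?W / 4 + ?W * (if stuck d ?P S S' then 1 else 0)))"
        using pos[of "(P, S)"] by (subst ennreal_mult) auto
      also have "\<dots> = ennreal (?W / 4 * 2 + 2 * ?W * (if stuck d ?P S S' then 1 else 0))"
        by (simp add: algebra_simps)
      also have "\<dots> = ?\<phi> (?P, S')"
        using pos[of "(P, S)"] half by (simp add: ennreal_plus ennreal_mult)
      finally show "ennreal b ^ n * ennreal (potential p (?P, S')) \<le> ?\<phi> (?P, S')" .
    qed
    also have "\<dots> = expect (iteration P S) (\<lambda>_ _. ennreal ?W / 2) + 2 * ennreal ?W *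
        expect (iteration P S) (\<lambda>s n. if stuck d ?P S (snd s) then 1 else 0)"
      unfolding expect_add expect_cmult ..
    also have "expect (iteration P S) (\<lambda>s n. if stuck d ?P S (snd s) then 1 else 0) =
        stuck_prob d ?P S (refine ?P S)"
      unfolding iteration_def expect_bind expect_oracle_round filter_restrict Let_def expect_return
      by simp
    also have "\<dots> \<le> ennreal (real (singles_count \<epsilon>) * d + (\<Sum>i\<in>set (block_indices \<epsilon> \<kappa>). block_weight \<epsilon> d i))"
      using P assms by (intro stuck_prob_refine) auto
    also have "\<dots> \<le> ennreal (1 / 4)" using prob by (rule ennreal_leI)
    also have "expect (iteration P S) (\<lambda>_ _. ennreal ?W / 2) \<le> ennreal ?W / 2"
      by (rule expect_const_le)
    also have "ennreal ?W / 2 + 2 * ennreal ?W * ennreal (1 / 4) = ennreal (?W / 4 * 2 + 2 * ?W * (1 / 4))"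
    proof -
      have "2 * ennreal ?W * ennreal (1 / 4) = ennreal (2 * ?W * (1 / 4))"
        using pos[of "(P, S)"] by (subst ennreal_mult) (auto simp: ennreal_mult)
      then show ?thesis
        unfolding half[symmetric] using pos[of "(P, S)"] by (simp add: ennreal_plus[symmetric] del: ennreal_plus)
    qed
    also have "?W / 4 * 2 + 2 * ?W * (1 / 4) = ?W" by simp
    finally show ?thesis by (simp add: add_mono mult_left_mono)
  qed
qed

lemma expect_threshold_sampling_le:
  fixes b d :: real
  assumes "E \<subseteq> V" "card E \<le> N" "1 \<le> b" "b ^ iteration_rounds \<epsilon> \<kappa> N \<le> 2"
    and "0 < d" "d \<le> 1" "(1 - d) ^ p \<le> 1 / 4"
    and "real (singles_count \<epsilon>) * d + (\<Sum>i\<in>set (block_indices \<epsilon> \<kappa>). block_weight \<epsilon> d i) \<le> 1 / 4"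
  shows "expect (threshold_sampling g E \<kappa> \<tau> \<epsilon>) (\<lambda>_ n. ennreal b ^ n) \<le> ennreal (2 + 32 * real N ^ p)"
proof -
  define I where "I = (\<lambda>(P, S). P \<subseteq> E \<and> S \<subseteq> V)"
  define v where "v = (\<lambda>(P :: 'a set, S :: 'a set). card P + (\<kappa> - card S))"
  let ?test = "\<lambda>(P :: 'a set, S :: 'a set). 0 < card P \<and> card S < \<kappa>"
  have finE: "finite E" using assms(1) fin by (rule finite_subset)
  have "expect (while_comp ?test (\<lambda>(P, S). iteration P S) (E, {})) (\<lambda>s n. ennreal b ^ n)
    \<le> ennreal (potential p (E, {}))"
  proof (rule expect_while_le[where I = I and v = v])
    fix s assume "I s" "?test s"
    then obtain P S where s: "s = (P, S)" "P \<subseteq> E" "S \<subseteq> V" "0 < card P" "card S < \<kappa>"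
      by (auto simp: I_def)
    have P: "P \<subseteq> V" "finite P" "card P \<le> N"
      using s assms finE finite_subset card_mono[OF finE s(2)] by auto
    show "expect (case s of (P, S) \<Rightarrow> iteration P S) (\<lambda>s' n. ennreal b ^ n * ennreal (potential p s'))
      \<le> ennreal (potential p s)"
      unfolding s(1) prod.case using s P assms by (intro expect_iteration_le[where N = N]) auto
    show "sure (case s of (P, S) \<Rightarrow> iteration P S) (\<lambda>s' n. I s' \<and> v s' < v s)"
      unfolding s(1) prod.case
    proof (rule sure_mono[OF sure_iteration[OF P(1) s(3,5) order_refl]], clarify, intro conjI)
      fix S'
      let ?P' = "survivors P S"
      assume *: "S \<subseteq> S'" "S' \<subseteq> S \<union> ?P'" "card S' \<le> \<kappa>" "?P' \<noteq> {} \<longrightarrow> card S < card S'"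
      have P': "?P' \<subseteq> P" by (rule survivors_subset)
      have "S' \<subseteq> V" using *(2) P' P(1) s(3) by blast
      then show "I (?P', S')" using s(2) P' by (auto simp: I_def)
      show "v (?P', S') < v (P, S)"
      proof (cases "?P' = {}")
        case True
        then have "S' = S" using * by auto
        then show ?thesis using s True by (simp add: v_def)
      next
        case False
        then show ?thesis using * s card_mono[OF P(2) P'] by (simp add: v_def)
      qed
    qed
  next
    fix s assume "\<not> ?test s"
    then show "1 \<le> ennreal (potential p s)" by (auto simp: potential_def split: prod.splits)
  qed (simp add: I_def)
  also have "potential p (E, {}) \<le> 2 + 32 * real N ^ p"
  proof -
    have "card (survivors E {}) \<le> N"
      using card_mono[OF finE survivors_subset[of E "{}"]] assms(2) by linarith
    then have "real (card (survivors E {})) ^ p \<le> real N ^ p" by (intro power_mono) auto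
    moreover have "0 \<le> real N ^ p" by simp
    moreover have "0 \<le> real (card (survivors E {})) ^ p" by simp
    ultimately show ?thesis unfolding potential_def by (auto split: if_splits)
  qed
  finally have "expect (while_comp ?test (\<lambda>(P, S). iteration P S) (E, {})) (\<lambda>s n. ennreal b ^ n)
    \<le> ennreal (2 + 32 * real N ^ p)" by (simp add: ennreal_leI)
  then show ?thesis
    unfolding threshold_sampling_iteration expect_bind case_prod_unfold expect_return by simp
qed

end

section \<open>Constants that depend on the accuracy only\<close>

lemma atLeastAtMost_int_eq_image: "{i..j} = (\<lambda>n. i + int n) ` {..<nat (j - i + 1)}"
proof (intro set_eqI iffI)
  fix x assume "x \<in> {i..j}"
  then show "x \<in> (\<lambda>n. i + int n) ` {..<nat (j - i + 1)}"
    by (intro image_eqI[of _ _ "nat (x - i)"]) auto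
qed auto

lemma exists_power_le:
  fixes d :: real
  assumes "0 < d" "d \<le> 1"
  shows "\<exists>p. (1 - d) ^ p \<le> 1 / 4"
  using real_arch_pow_inv[of "1 / 4" "1 - d"] assms by (auto intro: less_imp_le)

text \<open>With \<open>y = n ln b - ln M\<close> this is the inequality \<open>y \<le> exp y\<close>.\<close>

lemma expect_rounds_le_of_moment:
  assumes "1 < b" "1 \<le> M" and moment: "expect c (\<lambda>_ n. ennreal b ^ n) \<le> ennreal M"
  shows "expect c (\<lambda>_ n. of_nat n) \<le> ennreal ((ln M + 1) / ln b)"
proof -
  have lnb: "0 < ln b" and lnM: "0 \<le> ln M" using assms by auto
  have le: "real n \<le> ln M / ln b + b ^ n * (1 / (M * ln b))" for n
  proof -
    have "real n * ln b - ln M \<le> exp (real n * ln b - ln M)"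
      using exp_ge_add_one_self[of "real n * ln b - ln M"] by linarith
    also have "\<dots> = b ^ n / M"
      using assms by (simp add: exp_diff exp_of_nat_mult)
    finally show ?thesis using lnb \<open>1 \<le> M\<close> by (simp add: field_simps)
  qed
  have "expect c (\<lambda>_ n. of_nat n) \<le>
    expect c (\<lambda>_ n. ennreal (ln M / ln b) + ennreal (1 / (M * ln b)) * ennreal b ^ n)"
    unfolding expect_def
  proof (rule nn_integral_mono)
    fix x :: "'a \<times> nat"
    have "of_nat (snd x) = ennreal (real (snd x))" by (simp add: ennreal_of_nat_eq_real_of_nat)
    also have "\<dots> \<le> ennreal (ln M / ln b + b ^ snd x * (1 / (M * ln b)))"
      by (intro ennreal_leI le)
    also have "\<dots> = ennreal (ln M / ln b) + ennreal (1 / (M * ln b)) * ennreal b ^ snd x"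
      using assms lnb lnM
      by (simp add: ennreal_plus ennreal_mult'' ennreal_power mult.commute flip: ennreal_mult')
    finally show "of_nat (snd x) \<le> ennreal (ln M / ln b) + ennreal (1 / (M * ln b)) * ennreal b ^ snd x" .
  qed
  also have "\<dots> \<le> ennreal (ln M / ln b) + ennreal (1 / (M * ln b)) * ennreal M"
    unfolding expect_add expect_cmult using moment
    by (intro add_mono expect_const_le mult_left_mono) auto
  also have "\<dots> = ennreal (ln M / ln b + 1 / (M * ln b) * M)"
    using assms lnb lnM by (subst ennreal_plus) (auto simp: ennreal_mult simp flip: ennreal_mult')
  also have "ln M / ln b + 1 / (M * ln b) * M = (ln M + 1) / ln b"
    using assms lnb by (simp add: field_simps)
  finally show ?thesis .
qed

definition grid :: "real \<Rightarrow> real \<Rightarrow> real \<Rightarrow> real set" where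
  "grid \<epsilon> lo hi = {\<tau>. \<exists>i::int. \<tau> = (1 + \<epsilon>) powi i \<and> lo \<le> \<tau> \<and> \<tau> \<le> hi}"

context accuracy
begin

lemma powi_eq_powr: "(1 + \<epsilon>) powi i = (1 + \<epsilon>) powr of_int i"
  using eps by (simp add: powr_real_of_int')

definition first_index :: int where
  "first_index = \<lfloor>log (1 + \<epsilon>) (1 / \<epsilon>)\<rfloor>"

text \<open>From the index after the first on, \<open>\<epsilon> * (1 + \<epsilon>) powi i\<close>
  is at least \<open>(1 + \<epsilon>) ^ m\<close>, and rounding costs a factor 2. The linear growth
  from Bernoulli's inequality is enough, since the failure bound is exponential in the size.\<close>

lemma block_size_large:
  "1 + real m * \<epsilon> \<le> 2 * real (block_size \<epsilon> (first_index + 1 + int m))"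
proof -
  define j where "j = first_index + 1"
  define u where "u = \<epsilon> * (1 + \<epsilon>) powi (j + int m)"
  have "log (1 + \<epsilon>) (1 / \<epsilon>) \<le> of_int j" unfolding j_def first_index_def by linarith
  then have "1 / \<epsilon> \<le> (1 + \<epsilon>) powi j"
    using eps by (simp add: powi_eq_powr log_le_iff)
  then have "1 * (1 + real m * \<epsilon>) \<le> (\<epsilon> * (1 + \<epsilon>) powi j) * (1 + \<epsilon>) ^ m"
    using eps Bernoulli_inequality[of \<epsilon> m] by (intro mult_mono) (auto simp: field_simps)
  also have "\<dots> = u" unfolding u_def using eps by (simp add: power_int_add)
  finally have u: "1 + real m * \<epsilon> \<le> u" by simp
  have "0 \<le> real m * \<epsilon>" using eps by simp
  then have "1 \<le> \<lfloor>u\<rfloor>" using u by linarith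
  then have "real (nat \<lfloor>u\<rfloor>) = of_int \<lfloor>u\<rfloor>" by simp
  then have "1 + real m * \<epsilon> \<le> 2 * real (nat \<lfloor>u\<rfloor>)"
    using u \<open>1 \<le> \<lfloor>u\<rfloor>\<close> by linarith
  then show ?thesis unfolding block_size_alt u_def j_def by (simp add: add.assoc)
qed

text \<open>The base \<open>2 * d powr \<epsilon>\<close> is bounded by the square of
  \<open>s\<close> so that the 2 in the exponent undoes the rounding: \<open>s powr (2 * t)\<close>
  is at most \<open>s powr (1 + m * \<epsilon>)\<close>, a geometric sequence in \<open>m\<close>.
  The first index is separate, because its block may round down to 0.\<close>

lemma block_weight_le:
  assumes "0 < d" and s: "0 < s" "s \<le> 1" "s powr \<epsilon> \<le> 1 / 2" "2 * d powr \<epsilon> \<le> s\<^sup>2"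
  shows "block_weight \<epsilon> d (first_index + int n) \<le> 2 * s * (1 / 2) ^ n"
proof (cases n)
  case 0
  have "block_weight \<epsilon> d first_index \<le> 2 * s"
  proof (cases "block_size \<epsilon> first_index")
    case 0
    then show ?thesis using s(1) by (simp add: block_weight_def)
  next
    case (Suc t)
    have "(2 * d powr \<epsilon>) ^ Suc t \<le> (s\<^sup>2) ^ Suc t"
      using s(4) by (rule power_mono) simp
    also have "\<dots> \<le> (s\<^sup>2) ^ 1" using s(1,2) by (intro power_decreasing) (auto simp: power_le_one)
    also have "\<dots> \<le> s * 1"
      unfolding power2_eq_square power_one_right using s(1,2) by (intro mult_left_mono) auto
    finally have "(2 * d powr \<epsilon>) ^ Suc t \<le> 2 * s" using s(1) by linarith
    then show ?thesis unfolding block_weight_def Suc by (simp only: nat.distinct if_False)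
  qed
  then show ?thesis using 0 by simp
next
  case (Suc m)
  let ?t = "block_size \<epsilon> (first_index + 1 + int m)"
  have "(2 * d powr \<epsilon>) ^ ?t \<le> (s\<^sup>2) ^ ?t"
    using s(4) by (rule power_mono) simp
  also have "\<dots> = s powr real (2 * ?t)"
    unfolding powr_realpow[OF s(1)] by (simp only: power_mult)
  also have "\<dots> \<le> s powr (1 + real m * \<epsilon>)"
    using s(1,2) block_size_large[of m] by (intro powr_mono') auto
  also have "\<dots> = s powr 1 * (s powr \<epsilon>) powr real m"
    unfolding powr_add powr_powr by (simp only: mult.commute)
  also have "\<dots> = s * (s powr \<epsilon>) ^ m"
    using s(1) by (simp add: powr_realpow)
  also have "\<dots> \<le> s * (1 / 2) ^ m" using s(1,3) by (intro mult_left_mono power_mono) auto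
  finally have le: "(2 * d powr \<epsilon>) ^ ?t \<le> s * (1 / 2) ^ m" .
  have "block_weight \<epsilon> d (first_index + 1 + int m) \<le> (2 * d powr \<epsilon>) ^ ?t"
    by (simp add: block_weight_def)
  also note le
  also have "s * (1 / 2) ^ m = 2 * s * (1 / 2) ^ n" using Suc by simp
  finally show ?thesis using Suc by (simp add: algebra_simps)
qed

lemma sum_block_weight_le:
  assumes "0 < d" "0 < s" "s \<le> 1" "s powr \<epsilon> \<le> 1 / 2" "2 * d powr \<epsilon> \<le> s\<^sup>2"
  shows "(\<Sum>i\<in>set (block_indices \<epsilon> \<kappa>). block_weight \<epsilon> d i) \<le> 4 * s"
proof -
  let ?i = "first_index"
  define j where "j = \<lceil>log (1 + \<epsilon>) (real \<kappa>)\<rceil> - 1"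
  have indices: "block_indices \<epsilon> \<kappa> = [?i..j]" by (simp add: block_indices_def first_index_def j_def)
  define M where "M = nat (j - ?i + 1)"
  have set: "set (block_indices \<epsilon> \<kappa>) = (\<lambda>n. ?i + int n) ` {..<M}"
    by (simp add: indices M_def atLeastAtMost_int_eq_image)
  have "(\<Sum>i\<in>set (block_indices \<epsilon> \<kappa>). block_weight \<epsilon> d i) = (\<Sum>n<M. block_weight \<epsilon> d (?i + int n))"
    unfolding set by (subst sum.reindex) (auto simp: inj_on_def)
  also have "\<dots> \<le> (\<Sum>n<M. 2 * s * (1 / 2) ^ n)"
    by (intro sum_mono block_weight_le assms)
  also have "\<dots> = 2 * s * (\<Sum>n<M. (1 / 2) ^ n)" by (simp add: sum_distrib_left)
  also have "(\<Sum>n<M. (1 / 2 :: real) ^ n) \<le> 2" by (simp add: sum_gp_strict)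
  finally show ?thesis using assms by (simp add: mult_left_mono)
qed

text \<open>The order of the quantifiers matters: \<open>d\<close> and \<open>p\<close> serve all
  \<open>\<kappa>\<close>, so that \<open>p\<close> enters the final bound as a constant.\<close>

lemma progress_constants:
  "\<exists>d p. 0 < d \<and> d \<le> 1 \<and> (1 - d) ^ p \<le> 1 / 4 \<and>
     (\<forall>\<kappa>. real (singles_count \<epsilon>) * d + (\<Sum>i\<in>set (block_indices \<epsilon> \<kappa>). block_weight \<epsilon> d i) \<le> 1 / 4)"
proof -
  \<comment> \<open>The bound 1 / 32 turns \<open>4 * s\<close> into 1 / 8 for the blocks, and the
    power makes \<open>s powr \<epsilon>\<close> at most 1 / 2. In \<open>d\<close>, the first term
    leaves 1 / 8 for the single samples and the second bounds \<open>2 * d powr \<epsilon>\<close>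
    by \<open>s\<^sup>2\<close>.\<close>
  define s where "s = min (1 / 32) ((1 / 2) powr (1 / \<epsilon>))"
  define d where "d = min (1 / (8 * real (singles_count \<epsilon>))) ((s\<^sup>2 / 2) powr (1 / \<epsilon>))"
  have s: "0 < s" "s \<le> 1 / 32" by (auto simp: s_def)
  have "s powr \<epsilon> \<le> ((1 / 2) powr (1 / \<epsilon>)) powr \<epsilon>"
    using s eps by (intro powr_mono2) (auto simp: s_def)
  then have s': "s powr \<epsilon> \<le> 1 / 2" using eps by (simp add: powr_powr)
  have c: "1 \<le> real (singles_count \<epsilon>)" using singles_count_ge(2) by linarith
  have d: "0 < d" "d \<le> 1 / (8 * real (singles_count \<epsilon>))" using s c by (auto simp: d_def)
  have "1 / (8 * real (singles_count \<epsilon>)) \<le> 1 / 8" using c by (intro divide_left_mono) auto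
  then have "d \<le> 1 / 8" using d(2) by linarith
  have "d powr \<epsilon> \<le> ((s\<^sup>2 / 2) powr (1 / \<epsilon>)) powr \<epsilon>"
    using d eps by (intro powr_mono2) (auto simp: d_def)
  then have d': "2 * d powr \<epsilon> \<le> s\<^sup>2" using eps s by (simp add: powr_powr)
  have "real (singles_count \<epsilon>) * d \<le> 1 / 8" using d c by (simp add: field_simps)
  moreover have "(\<Sum>i\<in>set (block_indices \<epsilon> \<kappa>). block_weight \<epsilon> d i) \<le> 1 / 8" for \<kappa>
    using sum_block_weight_le[OF d(1) s(1) _ s' d', of \<kappa>] s(2) by linarith
  ultimately have "real (singles_count \<epsilon>) * d + (\<Sum>i\<in>set (block_indices \<epsilon> \<kappa>). block_weight \<epsilon> d i)
    \<le> 1 / 8 + 1 / 8" for \<kappa>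
    by (rule add_mono)
  then have "real (singles_count \<epsilon>) * d + (\<Sum>i\<in>set (block_indices \<epsilon> \<kappa>). block_weight \<epsilon> d i) \<le> 1 / 4" for \<kappa>
    by simp
  moreover obtain p where "(1 - d) ^ p \<le> 1 / 4"
    using exists_power_le[of d] d \<open>d \<le> 1 / 8\<close> by auto
  ultimately show ?thesis using d \<open>d \<le> 1 / 8\<close> by (intro exI[of _ d] exI[of _ p]) auto
qed

lemma first_index_nonneg: "0 \<le> first_index"
  using eps by (simp add: first_index_def)

lemma length_block_indices_le:
  assumes "1 \<le> \<kappa>" "\<kappa> \<le> k"
  shows "real (length (block_indices \<epsilon> \<kappa>)) \<le> ln (real k) / ln (1 + \<epsilon>) + 1"
proof -
  have "real (length (block_indices \<epsilon> \<kappa>)) \<le> real (nat \<lceil>log (1 + \<epsilon>) (real \<kappa>)\<rceil>)"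
    using first_index_nonneg unfolding block_indices_def length_upto first_index_def of_nat_le_iff by (intro nat_mono) linarith
  also have "\<dots> \<le> log (1 + \<epsilon>) (real \<kappa>) + 1"
  proof -
    have "0 \<le> log (1 + \<epsilon>) (real \<kappa>)" using assms eps by simp
    then show ?thesis by linarith
  qed
  also have "\<dots> \<le> log (1 + \<epsilon>) (real k) + 1" using assms eps by simp
  finally show ?thesis by (simp add: log_def)
qed

lemma length_small_blocks_le:
  assumes "1 \<le> N"
  shows "real (length (filter (\<lambda>i. block_size \<epsilon> i < N) (block_indices \<epsilon> \<kappa>))) \<le>
    (ln (real N) + ln (1 / \<epsilon>)) / ln (1 + \<epsilon>) + 1"
proof -
  let ?A = "set (filter (\<lambda>i. block_size \<epsilon> i < N) (block_indices \<epsilon> \<kappa>))"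
  let ?l = "log (1 + \<epsilon>) (real N / \<epsilon>)"
  have "?A \<subseteq> {0..\<lfloor>?l\<rfloor>}"
  proof
    fix i assume "i \<in> ?A"
    then have i: "first_index \<le> i" "block_size \<epsilon> i < N" by (auto simp: block_indices_def first_index_def)
    have "\<epsilon> * (1 + \<epsilon>) powi i < real N"
      using i(2) \<open>1 \<le> N\<close> unfolding block_size_alt by linarith
    then have "of_int i \<le> ?l"
      using eps \<open>1 \<le> N\<close> by (subst le_log_iff) (auto simp: powi_eq_powr[symmetric] field_simps)
    then show "i \<in> {0..\<lfloor>?l\<rfloor>}" using i(1) first_index_nonneg by (simp add: le_floor_iff)
  qed
  then have "card ?A \<le> card {0..\<lfloor>?l\<rfloor>}" by (intro card_mono) auto
  moreover have "distinct (filter (\<lambda>i. block_size \<epsilon> i < N) (block_indices \<epsilon> \<kappa>))"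
    by (simp add: block_indices_def)
  ultimately have "length (filter (\<lambda>i. block_size \<epsilon> i < N) (block_indices \<epsilon> \<kappa>)) \<le> nat (\<lfloor>?l\<rfloor> + 1)"
    by (simp add: distinct_card[symmetric] del: set_filter)
  moreover have "0 \<le> ?l" using eps \<open>1 \<le> N\<close> by (simp add: field_simps)
  ultimately have "real (length (filter (\<lambda>i. block_size \<epsilon> i < N) (block_indices \<epsilon> \<kappa>))) \<le> ?l + 1"
    by linarith
  moreover have "?l = (ln (real N) + ln (1 / \<epsilon>)) / ln (1 + \<epsilon>)"
    using eps \<open>1 \<le> N\<close> by (simp add: log_def ln_div)
  ultimately show ?thesis by simp
qed

lemma ln_ge_half: "2 \<le> n \<Longrightarrow> 1 \<le> 2 * ln (real n)"
proof -
  assume "2 \<le> n"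
  then have "ln 2 \<le> ln (real n)" by simp
  then show ?thesis using ln2_ge_two_thirds by linarith
qed

lemma iteration_rounds_bound:
  "\<exists>C>0. \<forall>\<kappa> k N. 1 \<le> \<kappa> \<longrightarrow> \<kappa> \<le> k \<longrightarrow> 2 \<le> k \<longrightarrow> 2 \<le> N \<longrightarrow>
     real (iteration_rounds \<epsilon> \<kappa> N) \<le> C * ln (real k) \<and> real (iteration_rounds \<epsilon> \<kappa> N) \<le> C * ln (real N)"
proof (intro exI conjI allI impI)
  define c where "c = 3 + real (singles_count \<epsilon>) + ln (1 / \<epsilon>) / ln (1 + \<epsilon>)"
  let ?C = "2 * c + 1 / ln (1 + \<epsilon>)"
  have nonneg: "0 \<le> ln (1 / \<epsilon>) / ln (1 + \<epsilon>)" "0 < ln (1 + \<epsilon>)" using eps by (auto intro!: divide_nonneg_pos)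
  then have c: "0 < c" by (simp add: c_def)
  show "0 < ?C" using c nonneg(2) by (intro add_pos_pos) simp_all
  fix \<kappa> k N :: nat assume *: "1 \<le> \<kappa>" "\<kappa> \<le> k" "2 \<le> k" "2 \<le> N"
  \<comment> \<open>A logarithm of at least 1 / 2 absorbs additive constants; this is where
    \<open>2 \<le> k\<close> and \<open>2 \<le> N\<close> enter.\<close>
  have scale: "c + x / ln (1 + \<epsilon>) \<le> ?C * x" if "1 \<le> 2 * x" for x
    using mult_left_mono[OF that, of c] c by (simp add: algebra_simps)
  have "real (iteration_rounds \<epsilon> \<kappa> N) \<le> 1 + real (singles_count \<epsilon>) + real (length (block_indices \<epsilon> \<kappa>))"
    by (simp add: iteration_rounds_def)
  also have "\<dots> \<le> c + ln (real k) / ln (1 + \<epsilon>)"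
    using length_block_indices_le[OF *(1,2)] nonneg by (simp add: c_def)
  also have "\<dots> \<le> ?C * ln (real k)" using * by (intro scale ln_ge_half)
  finally show "real (iteration_rounds \<epsilon> \<kappa> N) \<le> ?C * ln (real k)" .
  have "real (iteration_rounds \<epsilon> \<kappa> N) \<le> 2 + real (singles_count \<epsilon>) +
    real (length (filter (\<lambda>i. block_size \<epsilon> i < N) (block_indices \<epsilon> \<kappa>)))"
    by (simp add: iteration_rounds_def)
  also have "\<dots> \<le> c + ln (real N) / ln (1 + \<epsilon>)"
    using length_small_blocks_le[of N \<kappa>] * by (simp add: c_def add_divide_distrib)
  also have "\<dots> \<le> ?C * ln (real N)" using * by (intro scale ln_ge_half)
  finally show "real (iteration_rounds \<epsilon> \<kappa> N) \<le> ?C * ln (real N)" .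
qed

section \<open>Number of thresholds and the sum of their reciprocals\<close>

lemma grid_eq_image:
  assumes "0 < lo" "0 < hi"
  shows "grid \<epsilon> lo hi = (\<lambda>i. (1 + \<epsilon>) powi i) ` {\<lceil>log (1 + \<epsilon>) lo\<rceil>..\<lfloor>log (1 + \<epsilon>) hi\<rfloor>}"
proof -
  have "lo \<le> (1 + \<epsilon>) powi i \<longleftrightarrow> \<lceil>log (1 + \<epsilon>) lo\<rceil> \<le> i" "(1 + \<epsilon>) powi i \<le> hi \<longleftrightarrow> i \<le> \<lfloor>log (1 + \<epsilon>) hi\<rfloor>" for i
    using assms eps by (simp_all add: powi_eq_powr log_le_iff[symmetric] le_log_iff[symmetric] ceiling_le_iff le_floor_iff)
  then show ?thesis by (auto simp: grid_def image_iff)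
qed

lemma grid_empty: "hi \<le> 0 \<Longrightarrow> grid \<epsilon> lo hi = {}"
  using eps by (auto simp: grid_def not_le intro: less_le_trans) (smt (verit) zero_less_power_int)

lemma finite_grid: "0 < lo \<or> hi \<le> 0 \<Longrightarrow> finite (grid \<epsilon> lo hi)"
  using grid_eq_image[of lo hi] grid_empty[of hi lo] by (cases "hi \<le> 0") auto

lemma card_grid_le:
  assumes "0 < lo" "lo \<le> hi"
  shows "real (card (grid \<epsilon> lo hi)) \<le> ln (hi / lo) / ln (1 + \<epsilon>) + 1"
proof -
  have "card (grid \<epsilon> lo hi) \<le> card {\<lceil>log (1 + \<epsilon>) lo\<rceil>..\<lfloor>log (1 + \<epsilon>) hi\<rfloor>}"
    using assms by (simp only: grid_eq_image card_image_le finite_atLeastAtMost_int)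
  moreover have "log (1 + \<epsilon>) lo \<le> log (1 + \<epsilon>) hi" using assms eps by simp
  ultimately have "real (card (grid \<epsilon> lo hi)) \<le> log (1 + \<epsilon>) hi - log (1 + \<epsilon>) lo + 1"
    unfolding card_atLeastAtMost_int by linarith
  also have "log (1 + \<epsilon>) hi - log (1 + \<epsilon>) lo = ln (hi / lo) / ln (1 + \<epsilon>)"
    using assms by (simp add: log_def ln_div diff_divide_distrib)
  finally show ?thesis .
qed

text \<open>The thresholds grow by the factor \<open>1 + \<epsilon>\<close> from at least
  \<open>lo\<close>, so the terms are dominated by a geometric series. The bound does not depend on
  \<open>hi\<close>, which keeps a factor of order \<open>log k\<close> out of the memory
  bound.\<close>

lemma sum_grid_le:
  assumes "0 < lo" "F \<subseteq> grid \<epsilon> lo hi"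
  shows "(\<Sum>\<tau>\<in>F. lo / \<tau>) \<le> (1 + \<epsilon>) / \<epsilon>"
proof (cases "0 < hi")
  case False
  then have "F = {}" using assms grid_empty[of hi lo] by simp
  then show ?thesis using eps by simp
next
  case True
  let ?i = "\<lceil>log (1 + \<epsilon>) lo\<rceil>" and ?j = "\<lfloor>log (1 + \<epsilon>) hi\<rfloor>"
  have i: "lo \<le> (1 + \<epsilon>) powi ?i" using assms by (intro le_powi_ceiling_log)
  define M where "M = nat (?j - ?i + 1)"
  have fin: "finite (grid \<epsilon> lo hi)" using assms finite_grid by blast
  have pos: "0 \<le> lo / \<tau>" if "\<tau> \<in> grid \<epsilon> lo hi" for \<tau>
    using that assms by (auto simp: grid_def)
  have grid: "grid \<epsilon> lo hi = (\<lambda>n. (1 + \<epsilon>) powi (?i + int n)) ` {..<M}"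
    unfolding grid_eq_image[OF assms(1) True] atLeastAtMost_int_eq_image image_image M_def ..
  have "(\<Sum>\<tau>\<in>F. lo / \<tau>) \<le> (\<Sum>\<tau>\<in>grid \<epsilon> lo hi. lo / \<tau>)"
    using fin assms pos by (intro sum_mono2) auto
  also have "\<dots> = (\<Sum>n<M. lo / (1 + \<epsilon>) powi (?i + int n))"
    unfolding grid using eps by (subst sum.reindex) (auto simp: inj_on_def power_int_add)
  also have "\<dots> \<le> (\<Sum>n<M. (1 / (1 + \<epsilon>)) ^ n)"
  proof (intro sum_mono)
    fix n
    have "lo / (1 + \<epsilon>) powi (?i + int n) \<le> (1 + \<epsilon>) powi ?i / (1 + \<epsilon>) powi (?i + int n)"
      using i eps by (intro divide_right_mono) auto
    also have "\<dots> = (1 / (1 + \<epsilon>)) ^ n" using eps by (simp add: power_int_add power_divide)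
    finally show "lo / (1 + \<epsilon>) powi (?i + int n) \<le> (1 / (1 + \<epsilon>)) ^ n" .
  qed
  also have "\<dots> \<le> 1 / (1 - 1 / (1 + \<epsilon>))"
    using eps by (simp add: sum_gp_strict divide_right_mono)
  also have "\<dots> = (1 + \<epsilon>) / \<epsilon>" using eps by (simp add: field_simps)
  finally show ?thesis .
qed

end

section \<open>Batch-Sieve-Streaming++: invariant and memory\<close>

lemma map_of_list_all2:
  assumes "list_all2 (\<lambda>x p. fst p = x \<and> Q x (snd p)) xs ps"
  shows "dom (map_of ps) = set xs" "map_of ps x = Some y \<Longrightarrow> Q x y"
  using assms by (induction xs ps rule: list_all2_induct) (auto split: if_splits)

lemma arg_max_on_finite:
  fixes f :: "'a \<Rightarrow> 'b :: linorder"
  assumes "finite A" "A \<noteq> {}"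
  shows "arg_max_on f A \<in> A" "x \<in> A \<Longrightarrow> f x \<le> f (arg_max_on f A)"
proof -
  have "Max (f ` A) \<in> f ` A" using assms by (intro Max_in) auto
  then obtain y where y: "y \<in> A" "f y = Max (f ` A)" by auto
  then have "\<forall>z\<in>A. f z \<le> f y" using assms by simp
  then have "is_arg_max f (\<lambda>x. x \<in> A) y" using y(1) by (simp add: is_arg_max_linorder)
  then have "is_arg_max f (\<lambda>x. x \<in> A) (arg_max_on f A)"
    unfolding arg_max_on_def arg_max_def by (rule someI)
  then show "arg_max_on f A \<in> A" "x \<in> A \<Longrightarrow> f x \<le> f (arg_max_on f A)"
    by (simp_all add: is_arg_max_linorder)
qed

section \<open>The streaming problem and its invariant\<close>

locale stream_instance = accuracy +
  fixes V :: "'a set" and f :: "'a set \<Rightarrow> real" and k B :: nat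
  assumes finV: "finite V" and f_nonneg: "A \<subseteq> V \<Longrightarrow> 0 \<le> f A"
    and f_mono_on: "mono_on (Pow V) f" and f_submod: "submodular_on V f"
    and k: "1 \<le> k" and B: "1 \<le> B"
begin

definition opt :: real where
  "opt = Max (f ` {A. A \<subseteq> V \<and> card A \<le> k})"

lemma f_le_opt: "A \<subseteq> V \<Longrightarrow> card A \<le> k \<Longrightarrow> f A \<le> opt"
  unfolding opt_def using finV by (intro Max_ge) auto

lemma threshold_instance_marginal:
  assumes "S \<subseteq> V" "0 < \<tau>"
  shows "threshold_instance \<epsilon> V (\<lambda>A. marginal f A S) \<tau>"
proof unfold_locales
  show "mono_on (Pow V) (\<lambda>A. marginal f A S)"
    unfolding marginal_def using assms
    by (intro mono_onI diff_right_mono mono_onD[OF f_mono_on]) auto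
  show "submodular_on V (\<lambda>A. marginal f A S)"
    unfolding submodular_on_def
  proof (intro allI impI)
    fix A A' e assume *: "A \<subseteq> A' \<and> A' \<subseteq> V \<and> e \<in> V - A'"
    show "marginal f (A' \<union> {e}) S - marginal f A' S \<le> marginal f (A \<union> {e}) S - marginal f A S"
    proof (cases "e \<in> S")
      case True
      then have "A' \<union> {e} \<union> S = A' \<union> S" "A \<union> {e} \<union> S = A \<union> S" by auto
      then show ?thesis by (simp add: marginal_def)
    next
      case False
      have "f ((A' \<union> S) \<union> {e}) - f (A' \<union> S) \<le> f ((A \<union> S) \<union> {e}) - f (A \<union> S)"
        using f_submod[unfolded submodular_on_def, rule_format, of "A \<union> S" "A' \<union> S" e] * False assms
        by auto
      then show ?thesis by (simp add: marginal_def Un_ac)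
    qed
  qed
qed (use finV assms in auto)

text \<open>The threshold 1 is a placeholder that gives access to the facts on marginals of
  \<open>f\<close>.\<close>

interpretation f: threshold_instance \<epsilon> V f _ 1
  by unfold_locales (use finV f_mono_on f_submod in auto)

definition update :: "'a set \<Rightarrow> real \<Rightarrow> 'a set \<Rightarrow> (real \<times> 'a set) comp" where
  "update E \<tau> S = (if card S < k
     then do {
       T \<leftarrow> threshold_sampling (\<lambda>A. marginal f A S) E (k - card S) \<tau> \<epsilon>;
       return_comp (\<tau>, S \<union> T)
     }
     else return_comp (\<tau>, S))"

definition updated :: "'a set \<Rightarrow> real \<Rightarrow> 'a set \<Rightarrow> 'a set \<Rightarrow> bool" where
  "updated E \<tau> S S' \<longleftrightarrow> S \<subseteq> S' \<and> S' \<subseteq> S \<union> E \<and> card S' \<le> k \<and>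
     density \<epsilon> * \<tau> * real (card S') \<le> f S' \<and>
     (card S' < k \<longrightarrow> (\<forall>x\<in>E. marginal f {x} S' < \<tau>))"

text \<open>Disjointness of the buffer and the earlier selection makes the sizes add up, so that the
  density of the old set and that of the new part combine.\<close>

lemma sure_update:
  assumes "S \<subseteq> V" "E \<subseteq> V" "S \<inter> E = {}" "0 < \<tau>" "card S \<le> k"
    and "density \<epsilon> * \<tau> * real (card S) \<le> f S"
  shows "sure (update E \<tau> S) (\<lambda>p r. fst p = \<tau> \<and> updated E \<tau> S (snd p))"
proof (cases "card S < k")
  case False
  then show ?thesis using assms by (simp add: update_def updated_def sure_return)
next
  case True
  let ?g = "\<lambda>A. marginal f A S"
  have "sure (threshold_sampling ?g E (k - card S) \<tau> \<epsilon>) (\<lambda>T m.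
    sure (return_comp (\<tau>, S \<union> T)) (\<lambda>p r. fst p = \<tau> \<and> updated E \<tau> S (snd p)))"
  proof (rule sure_mono[OF threshold_instance.sure_threshold_sampling[OF threshold_instance_marginal assms(2)]])
    fix T m
    assume *: "T \<subseteq> E \<and> card T \<le> k - card S \<and> density \<epsilon> * \<tau> * real (card T) \<le> ?g T - ?g {} \<and>
      (card T < k - card S \<longrightarrow> (\<forall>x\<in>E. marginal ?g {x} T < \<tau>))"
    have "T \<subseteq> V" using * assms by blast
    then have "finite S" "finite T" using finite_subset[OF _ finV] assms by auto
    then have card: "card (S \<union> T) = card S + card T"
      using assms * by (intro card_Un_disjoint) auto
    have "density \<epsilon> * \<tau> * real (card T) \<le> f (S \<union> T) - f S"
      using * by (simp add: marginal_def Un_commute)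
    then have "density \<epsilon> * \<tau> * real (card (S \<union> T)) \<le> f (S \<union> T)"
      using assms(6) card by (simp add: algebra_simps)
    moreover have "marginal ?g {x} T = marginal f {x} (S \<union> T)" for x
      by (simp add: marginal_def Un_ac)
    ultimately show "sure (return_comp (\<tau>, S \<union> T)) (\<lambda>p r. fst p = \<tau> \<and> updated E \<tau> S (snd p))"
      using * card True by (auto simp: sure_return updated_def)
  qed (use assms in auto)
  then show ?thesis unfolding update_def if_P[OF True] by (rule sure_bind)
qed

text \<open>Below, \<open>D\<close> is the set of the elements that have been processed.\<close>

definition candidates_dense :: "'a set \<Rightarrow> 'a bss_state \<Rightarrow> bool" where
  "candidates_dense D st \<longleftrightarrow>
     (\<forall>\<tau> S. cand st \<tau> = Some S \<longrightarrow> 0 < \<tau> \<and> (\<exists>i::int. \<tau> = (1 + \<epsilon>) powi i) \<and> \<tau> \<le> delta st \<and>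
        S \<subseteq> D \<and> card S \<le> k \<and> density \<epsilon> * \<tau> * real (card S) \<le> f S)"

text \<open>A threshold above \<open>opt / (2 k (1 + \<epsilon>))\<close> is never discarded, since \<open>LB\<close> and \<open>\<Delta>\<close> are
  at most \<open>opt\<close>.\<close>

definition large_thresholds_active :: "'a set \<Rightarrow> 'a bss_state \<Rightarrow> bool" where
  "large_thresholds_active D st \<longleftrightarrow>
     (\<forall>i::int. opt / (2 * real k * (1 + \<epsilon>)) < (1 + \<epsilon>) powi i \<and> (1 + \<epsilon>) powi i \<le> delta st \<longrightarrow>
        (\<exists>S. cand st ((1 + \<epsilon>) powi i) = Some S \<and>
          (card S < k \<longrightarrow> (\<forall>x\<in>D. marginal f {x} S < (1 + \<epsilon>) powi i))))"

text \<open>Just after a batch, the candidates may contain the whole buffer on top of what was kept,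
  hence \<open>B + 9 * k / \<epsilon>\<close>. While the next buffer fills, up to \<open>B\<close>
  further elements are in memory, which gives \<open>2 * B\<close> in the bound on
  \<open>peak\<close>.\<close>

definition invariant :: "'a set \<Rightarrow> 'a bss_state \<Rightarrow> bool" where
  "invariant D st \<longleftrightarrow> D \<subseteq> V \<and> buf st \<subseteq> V - D \<and>
     0 \<le> delta st \<and> delta st \<le> opt \<and> (\<forall>e\<in>D. f {e} \<le> delta st) \<and>
     0 \<le> LB st \<and> LB st \<le> opt \<and> (\<forall>S\<in>ran (cand st). f S \<le> LB st) \<and>
     finite (dom (cand st)) \<and>
     candidates_dense D st \<and> large_thresholds_active D st \<and>
     real (card (\<Union>(ran (cand st)))) \<le> real B + 9 * real k / \<epsilon> \<and>
     real (peak st) \<le> 2 * real B + 9 * real k / \<epsilon>"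

lemma opt_nonneg: "0 \<le> opt"
  using f_nonneg[of "{}"] f_le_opt[of "{}"] by simp

lemma invariant_init: "invariant {} init_state"
proof -
  have "(1 + \<epsilon>) powi i > 0" for i using eps by simp
  then show ?thesis
    using opt_nonneg eps by (auto simp: invariant_def candidates_dense_def large_thresholds_active_def init_state_def not_le[symmetric] ran_def)
qed

lemma invariant_arrive:
  assumes inv: "invariant D st" and e: "e \<in> V" "e \<notin> D" "e \<notin> buf st" and card: "card (buf st) < B"
  shows "invariant D (arrive e st)"
proof -
  have "card (insert e (buf st)) \<le> B" using card card_insert_le_m1[of B "buf st" e] B by simp
  moreover have "card (insert e (buf st) \<union> \<Union>(ran (cand st))) \<le>
    card (insert e (buf st)) + card (\<Union>(ran (cand st)))" by (rule card_Un_le)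
  ultimately have "real (footprint (insert e (buf st)) (cand st)) \<le> real B + real (card (\<Union>(ran (cand st))))"
    unfolding footprint_def by linarith
  also have "\<dots> \<le> 2 * real B + 9 * real k / \<epsilon>" using inv by (simp add: invariant_def)
  finally show ?thesis using inv e
    by (auto simp: invariant_def candidates_dense_def large_thresholds_active_def arrive_def)
qed

text \<open>A candidate has at most \<open>LB / (density \<epsilon> * \<tau>)\<close> elements, and these bounds form a
  geometric series.\<close>

lemma card_kept_le:
  assumes inv: "invariant D st" and lo: "LB st / (2 * real k * (1 + \<epsilon>)) \<le> lo"
  shows "real (card (\<Union>(ran (cand st |` {\<tau>. lo \<le> \<tau>})))) \<le> 9 * real k / \<epsilon>"
proof -
  let ?F = "dom (cand st) \<inter> {\<tau>. lo \<le> \<tau>}"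
  let ?S = "\<lambda>\<tau>. the (cand st \<tau>)"
  have finF: "finite ?F" using inv by (simp add: invariant_def)
  have S: "0 < \<tau>" "\<exists>i::int. \<tau> = (1 + \<epsilon>) powi i" "\<tau> \<le> delta st"
    "density \<epsilon> * \<tau> * real (card (?S \<tau>)) \<le> LB st" if \<tau>: "\<tau> \<in> ?F" for \<tau>
  proof -
    obtain S where S: "cand st \<tau> = Some S" using \<tau> by auto
    then have "f S \<le> LB st" using inv by (auto simp: invariant_def ran_def)
    moreover have "density \<epsilon> * \<tau> * real (card S) \<le> f S" using inv S by (auto simp: invariant_def candidates_dense_def)
    ultimately show "density \<epsilon> * \<tau> * real (card (?S \<tau>)) \<le> LB st" using S by simp
  qed (use inv \<tau> in \<open>auto simp: invariant_def candidates_dense_def\<close>)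
  have "ran (cand st |` {\<tau>. lo \<le> \<tau>}) = ?S ` ?F"
    by (force simp: ran_def restrict_map_def image_iff split: if_splits)
  then have "real (card (\<Union>(ran (cand st |` {\<tau>. lo \<le> \<tau>})))) \<le> (\<Sum>\<tau>\<in>?F. real (card (?S \<tau>)))"
    using card_UN_le[OF finF, of ?S] by (simp flip: of_nat_sum)
  also have "\<dots> \<le> 9 * real k / \<epsilon>"
  \<comment> \<open>The series needs a positive lower end. If \<open>LB\<close> is 0, all candidates
    are empty because their density is positive.\<close>
  proof (cases "LB st = 0")
    case True
    have "card (?S \<tau>) = 0" if "\<tau> \<in> ?F" for \<tau>
      using S(1,4)[OF that] True density_pos by (simp add: mult_le_0_iff)
    then have "(\<Sum>\<tau>\<in>?F. real (card (?S \<tau>))) = 0" by (intro sum.neutral) simp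
    then show ?thesis using eps by simp
  next
    case False
    let ?l = "LB st / (2 * real k * (1 + \<epsilon>))"
    have LB: "0 < LB st" using False inv by (auto simp: invariant_def)
    then have l: "0 < ?l" using k eps by simp
    have "(\<Sum>\<tau>\<in>?F. real (card (?S \<tau>))) \<le> (\<Sum>\<tau>\<in>?F. 2 * real k * (1 + \<epsilon>) / density \<epsilon> * (?l / \<tau>))"
    proof (rule sum_mono)
      fix \<tau> assume "\<tau> \<in> ?F"
      note S = S[OF this]
      have "real (card (?S \<tau>)) \<le> LB st / (density \<epsilon> * \<tau>)"
        using S(1,4) density_pos by (simp add: field_simps)
      also have "\<dots> = 2 * real k * (1 + \<epsilon>) / density \<epsilon> * (?l / \<tau>)"
        using k eps density_pos S(1) by (simp add: divide_simps)
      finally show "real (card (?S \<tau>)) \<le> 2 * real k * (1 + \<epsilon>) / density \<epsilon> * (?l / \<tau>)" .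
    qed
    also have "\<dots> = 2 * real k * (1 + \<epsilon>) / density \<epsilon> * (\<Sum>\<tau>\<in>?F. ?l / \<tau>)"
      by (rule sum_distrib_left[symmetric])
    also have "\<dots> \<le> 2 * real k * (1 + \<epsilon>) / density \<epsilon> * ((1 + \<epsilon>) / \<epsilon>)"
    proof (intro mult_left_mono sum_grid_le[OF l, of _ "delta st"])
      show "?F \<subseteq> grid \<epsilon> ?l (delta st)"
      proof
        fix \<tau> assume \<tau>: "\<tau> \<in> ?F"
        then have "?l \<le> \<tau>" using lo by simp
        then show "\<tau> \<in> grid \<epsilon> ?l (delta st)" using S(2,3)[OF \<tau>] by (simp add: grid_def)
      qed
      show "0 \<le> 2 * real k * (1 + \<epsilon>) / density \<epsilon>" using density_pos eps by simp
    qed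
    also have "\<dots> \<le> 9 * real k / \<epsilon>"
    proof -
      \<comment> \<open>The extreme case is \<open>\<epsilon> = 1 / 3\<close>, where the density is
        2 / 5 and 32 / 9 is just below 18 / 5. This fixes the constant 9.\<close>
      have "2 * (1 + \<epsilon>) * (1 + \<epsilon>) \<le> 2 * (4 / 3) * (4 / 3)"
        using eps by (intro mult_mono) auto
      also have "\<dots> \<le> 9 * (2 / 5)" by simp
      also have "\<dots> \<le> 9 * density \<epsilon>" using eps by (simp add: density_def field_simps)
      finally have "2 * (1 + \<epsilon>) * (1 + \<epsilon>) / density \<epsilon> \<le> 9"
        using density_pos by (simp add: divide_le_eq)
      then have "2 * (1 + \<epsilon>) * (1 + \<epsilon>) / density \<epsilon> * (real k / \<epsilon>) \<le> 9 * (real k / \<epsilon>)"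
        using eps by (intro mult_right_mono) auto
      then show ?thesis by (simp add: mult_ac)
    qed
    finally show ?thesis .
  qed
  finally show ?thesis .
qed

section \<open>Processing of one buffer\<close>

definition new_delta :: "'a bss_state \<Rightarrow> real" where
  "new_delta st = max (delta st) (Max ((\<lambda>e. f {e}) ` buf st))"

definition min_threshold :: "'a bss_state \<Rightarrow> real" where
  "min_threshold st = max (LB st) (new_delta st) / (2 * real k * (1 + \<epsilon>))"

definition kept :: "'a bss_state \<Rightarrow> real \<rightharpoonup> 'a set" where
  "kept st = cand st |` {\<tau>. min_threshold st \<le> \<tau>}"

definition old_set :: "'a bss_state \<Rightarrow> real \<Rightarrow> 'a set" where
  "old_set st \<tau> = (case kept st \<tau> of None \<Rightarrow> {} | Some S \<Rightarrow> S)"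

definition thresholds :: "'a bss_state \<Rightarrow> real set" where
  "thresholds st = grid \<epsilon> (min_threshold st) (new_delta st)"

definition updates :: "'a bss_state \<Rightarrow> (real \<times> 'a set) list comp" where
  "updates st = par_map (\<lambda>\<tau>. update (buf st) \<tau> (old_set st \<tau>)) (sorted_list_of_set (thresholds st))"

definition finish :: "'a bss_state \<Rightarrow> (real \<times> 'a set) list \<Rightarrow> 'a bss_state comp" where
  "finish st new = do {
     let c = kept st ++ map_of new;
     b \<leftarrow> oracle_round f (ran c);
     return_comp
       \<lparr>buf = {}, delta = new_delta st, LB = (if ran c = {} then LB st else Max (b ` ran c)), cand = c,
        peak = max (peak st) (footprint (buf st) c)\<rparr>
   }"

lemma process_buffer_eq:
  "process_buffer f k \<epsilon> st =
     oracle_round f ((\<lambda>e. {e}) ` buf st) \<bind> (\<lambda>_. updates st \<bind> finish st)"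
proof -
  have "(\<lambda>e. restrict f ((\<lambda>e. {e}) ` buf st) {e}) ` buf st = (\<lambda>e. f {e}) ` buf st"
    by (intro image_cong) auto
  then show ?thesis
    unfolding process_buffer_def
    by (subst bind_oracle_round)
      (simp add: updates_def finish_def[abs_def] update_def thresholds_def grid_def old_set_def kept_def
        min_threshold_def new_delta_def Let_def)
qed

text \<open>For an infinite set \<open>sorted_list_of_set\<close> would return the empty list. If
  \<open>new_delta\<close> is not positive, the lower end of the grid may be 0, but then the grid is
  empty.\<close>

lemma finite_thresholds:
  assumes "0 \<le> LB st"
  shows "finite (thresholds st)"
proof (cases "0 < new_delta st")
  case True
  then have "0 < min_threshold st" using k eps unfolding min_threshold_def
    by (intro divide_pos_pos) auto
  then show ?thesis by (simp add: thresholds_def finite_grid)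
next
  case False
  then show ?thesis by (simp add: thresholds_def finite_grid)
qed

lemma invariant_cover:
  assumes "invariant D st" "opt / (2 * real k * (1 + \<epsilon>)) < (1 + \<epsilon>) powi i" "(1 + \<epsilon>) powi i \<le> delta st"
  shows "\<exists>S. cand st ((1 + \<epsilon>) powi i) = Some S \<and>
    (card S < k \<longrightarrow> (\<forall>x\<in>D. marginal f {x} S < (1 + \<epsilon>) powi i))"
proof -
  have "large_thresholds_active D st" using assms(1) by (simp add: invariant_def)
  from this[unfolded large_thresholds_active_def, rule_format, of i] assms(2,3) show ?thesis by blast
qed

lemma invariant_cand:
  assumes "invariant D st" "cand st \<tau> = Some S"
  shows "0 < \<tau>" "\<exists>i::int. \<tau> = (1 + \<epsilon>) powi i" "\<tau> \<le> delta st" "S \<subseteq> D" "card S \<le> k"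
    "density \<epsilon> * \<tau> * real (card S) \<le> f S"
proof -
  have "candidates_dense D st" using assms(1) by (simp add: invariant_def)
  from this[unfolded candidates_dense_def, rule_format, OF assms(2)]
  show "0 < \<tau>" "\<exists>i::int. \<tau> = (1 + \<epsilon>) powi i" "\<tau> \<le> delta st" "S \<subseteq> D" "card S \<le> k"
    "density \<epsilon> * \<tau> * real (card S) \<le> f S" by blast+
qed

lemma invariant_kept:
  assumes inv: "invariant D st" and "kept st \<tau> = Some S"
  shows "cand st \<tau> = Some S" "\<tau> \<in> thresholds st" "0 < \<tau>" "S \<subseteq> D" "card S \<le> k"
    "density \<epsilon> * \<tau> * real (card S) \<le> f S"
proof -
  show *: "cand st \<tau> = Some S" using assms by (auto simp: kept_def restrict_map_def split: if_splits)
  have le: "min_threshold st \<le> \<tau>" using assms by (auto simp: kept_def restrict_map_def split: if_splits)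
  have d: "delta st \<le> new_delta st" by (simp add: new_delta_def)
  note cand = invariant_cand[OF inv *]
  from cand(2,3) show "\<tau> \<in> thresholds st" using le d by (simp add: thresholds_def grid_def)
  show "0 < \<tau>" "S \<subseteq> D" "card S \<le> k" "density \<epsilon> * \<tau> * real (card S) \<le> f S"
    by (fact cand)+
qed

lemma invariant_old_set:
  assumes inv: "invariant D st"
  shows "old_set st \<tau> \<subseteq> D" "card (old_set st \<tau>) \<le> k"
    "density \<epsilon> * \<tau> * real (card (old_set st \<tau>)) \<le> f (old_set st \<tau>)"
  using invariant_kept[OF inv, of \<tau>] f_nonneg[of "{}"]
  by (auto simp: old_set_def split: option.split)

lemma thresholds_pos: "\<tau> \<in> thresholds st \<Longrightarrow> 0 < \<tau>"
  using eps by (auto simp: thresholds_def grid_def)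

lemma sure_updates:
  assumes inv: "invariant D st"
  shows "sure (updates st) (\<lambda>new r. dom (map_of new) = thresholds st \<and>
    (\<forall>\<tau> S'. map_of new \<tau> = Some S' \<longrightarrow> updated (buf st) \<tau> (old_set st \<tau>) S'))"
proof -
  let ?h = "\<lambda>\<tau>. update (buf st) \<tau> (old_set st \<tau>)"
  let ?Q = "\<lambda>\<tau> S'. updated (buf st) \<tau> (old_set st \<tau>) S'"
  have V: "D \<subseteq> V" "buf st \<subseteq> V - D" and LB: "0 \<le> LB st" using inv by (auto simp: invariant_def)
  have fin: "finite (thresholds st)" using LB by (rule finite_thresholds)
  have "sure (?h \<tau>) (\<lambda>p r. fst p = \<tau> \<and> ?Q \<tau> (snd p))"
    if "\<tau> \<in> set (sorted_list_of_set (thresholds st))" for \<tau>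
    using invariant_old_set[OF inv, of \<tau>] V that fin
    by (intro sure_update) (auto intro: thresholds_pos)
  then have "sure (updates st) (\<lambda>new r.
      list_all2 (\<lambda>\<tau> p. fst p = \<tau> \<and> ?Q \<tau> (snd p)) (sorted_list_of_set (thresholds st)) new)"
    unfolding updates_def by (rule sure_par_map)
  then show ?thesis
  proof (rule sure_mono)
    fix new assume *: "list_all2 (\<lambda>\<tau> p. fst p = \<tau> \<and> ?Q \<tau> (snd p)) (sorted_list_of_set (thresholds st)) new"
    show "dom (map_of new) = thresholds st \<and> (\<forall>\<tau> S'. map_of new \<tau> = Some S' \<longrightarrow> ?Q \<tau> S')"
      using map_of_list_all2[OF *] fin by simp
  qed
qed

lemma invariant_finish:
  assumes inv: "invariant D st" and ne: "buf st \<noteq> {}" and card: "card (buf st) \<le> B"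
    and dom: "dom new = thresholds st"
    and new: "\<And>\<tau> S'. new \<tau> = Some S' \<Longrightarrow> updated (buf st) \<tau> (old_set st \<tau>) S'"
  shows "invariant (D \<union> buf st)
    \<lparr>buf = {}, delta = new_delta st, LB = (if ran new = {} then LB st else Max (f ` ran new)),
     cand = new, peak = max (peak st) (footprint (buf st) new)\<rparr>"
proof -
  let ?E = "buf st" and ?\<Delta> = "new_delta st"
  have V: "D \<subseteq> V" "?E \<subseteq> V - D" using inv by (simp_all add: invariant_def)
  have finE: "finite ?E" using V finV by (auto intro: finite_subset)
  have LB: "0 \<le> LB st" "LB st \<le> opt" using inv by (simp_all add: invariant_def)
  have fin: "finite (thresholds st)" using LB(1) by (rule finite_thresholds)
  have ran: "finite (ran new)" using dom fin by (simp add: finite_ran)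
  have \<Delta>: "delta st \<le> ?\<Delta>" "\<And>e. e \<in> ?E \<Longrightarrow> f {e} \<le> ?\<Delta>"
    unfolding new_delta_def using finE by (auto intro: max.coboundedI2)
  have "Max ((\<lambda>e. f {e}) ` ?E) \<in> (\<lambda>e. f {e}) ` ?E" using finE ne by (intro Max_in) auto
  then have "Max ((\<lambda>e. f {e}) ` ?E) \<le> opt" using V k by (auto intro!: f_le_opt)
  then have \<Delta>_le: "?\<Delta> \<le> opt" using inv by (simp add: new_delta_def invariant_def)
  have old: "old_set st \<tau> \<subseteq> D" for \<tau> by (rule invariant_old_set[OF inv])
  have S': "S' \<subseteq> D \<union> ?E" "card S' \<le> k" "density \<epsilon> * \<tau> * real (card S') \<le> f S'" "\<tau> \<in> thresholds st"
    if "new \<tau> = Some S'" for \<tau> S'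
    using new[OF that] old[of \<tau>] dom that by (auto simp: updated_def)
  have f_ran: "0 \<le> f S' \<and> f S' \<le> opt" if "S' \<in> ran new" for S'
  proof -
    from that obtain \<tau> where "new \<tau> = Some S'" by (auto simp: ran_def)
    then show ?thesis using S'[of \<tau> S'] V by (auto intro!: f_nonneg f_le_opt)
  qed
  have LB': "0 \<le> Max (f ` ran new)" "Max (f ` ran new) \<le> opt" if "ran new \<noteq> {}"
  proof -
    have "Max (f ` ran new) \<in> f ` ran new" using that ran by (intro Max_in) auto
    then show "0 \<le> Max (f ` ran new)" "Max (f ` ran new) \<le> opt" using f_ran by auto
  qed
  have cover: "\<exists>S'. new \<tau> = Some S' \<and> (card S' < k \<longrightarrow> (\<forall>x\<in>D \<union> ?E. marginal f {x} S' < \<tau>))"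
    if \<tau>: "\<tau> = (1 + \<epsilon>) powi i" "opt / (2 * real k * (1 + \<epsilon>)) < \<tau>" "\<tau> \<le> ?\<Delta>" for \<tau> and i :: int
  proof -
    have "min_threshold st \<le> opt / (2 * real k * (1 + \<epsilon>))"
      unfolding min_threshold_def using LB \<Delta>_le eps by (intro divide_right_mono) auto
    then have min: "min_threshold st \<le> \<tau>" using \<tau> by simp
    then have "\<tau> \<in> thresholds st" using \<tau> by (auto simp: thresholds_def grid_def)
    then obtain S' where S': "new \<tau> = Some S'" using dom by auto
    have upd: "updated ?E \<tau> (old_set st \<tau>) S'" by (rule new[OF S'])
    have "S' \<subseteq> old_set st \<tau> \<union> ?E" using upd by (simp add: updated_def)
    then have S'V: "S' \<subseteq> V" using old[of \<tau>] V by blast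
    have "marginal f {x} S' < \<tau>" if lt: "card S' < k" and x: "x \<in> D" for x
    proof (cases "cand st \<tau>")
      \<comment> \<open>A threshold of this range that was not active exceeds the old
        \<open>delta\<close>, which bounds the singleton value of every earlier element. So those
        elements could be skipped: by submodularity their gain is below \<open>\<tau>\<close> for
        any set.\<close>
      case None
      then have "\<not> \<tau> \<le> delta st" using invariant_cover[OF inv, of i] \<tau> by auto
      moreover have "f {x} \<le> delta st" using inv x by (simp add: invariant_def)
      moreover have "marginal f {x} S' \<le> marginal f {x} {}"
        using x V S'V by (intro f.marginal_antimono) auto
      moreover have "marginal f {x} {} \<le> f {x}" using f_nonneg[of "{}"] by (simp add: marginal_def)
      ultimately show ?thesis by linarith
    next
      case (Some S)
      then have "old_set st \<tau> = S" using min by (simp add: old_set_def kept_def)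
      then have sub: "S \<subseteq> S'" using upd by (simp add: updated_def)
      then have "card S < k"
        using lt card_mono[OF finite_subset[OF S'V finV] sub] by linarith
      then have "marginal f {x} S < \<tau>"
      proof -
        have "\<tau> \<le> delta st" by (rule invariant_cand(3)[OF inv Some])
        then have "\<exists>S. cand st \<tau> = Some S \<and> (card S < k \<longrightarrow> (\<forall>x\<in>D. marginal f {x} S < \<tau>))"
          using invariant_cover[OF inv, of i] \<tau>(1,2) by simp
        then show ?thesis using Some x \<open>card S < k\<close> by simp
      qed
      moreover have "marginal f {x} S' \<le> marginal f {x} S"
        using x V S'V sub by (intro f.marginal_antimono) auto
      ultimately show ?thesis by linarith
    qed
    then show ?thesis using S' upd by (auto simp: updated_def)
  qed
  have mem: "real (card (?E \<union> \<Union>(ran new))) \<le> real B + 9 * real k / \<epsilon>"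
  proof -
    have "LB st / (2 * real k * (1 + \<epsilon>)) \<le> min_threshold st"
      unfolding min_threshold_def using eps by (intro divide_right_mono) auto
    then have le: "real (card (\<Union>(ran (kept st)))) \<le> 9 * real k / \<epsilon>"
      unfolding kept_def by (rule card_kept_le[OF inv])
    have "S \<subseteq> D" if "S \<in> ran (kept st)" for S
      using that invariant_kept(4)[OF inv] unfolding ran_def by blast
    then have "\<Union>(ran (kept st)) \<subseteq> V" using V(1) by blast
    then have finK: "finite (\<Union>(ran (kept st)))" using finV by (rule finite_subset)
    have "?E \<union> \<Union>(ran new) \<subseteq> ?E \<union> \<Union>(ran (kept st))"
    proof -
      have "S' \<subseteq> ?E \<union> \<Union>(ran (kept st))" if "new \<tau> = Some S'" for \<tau> S'
      proof -
        have "old_set st \<tau> \<subseteq> \<Union>(ran (kept st))"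
          by (cases "kept st \<tau>") (auto simp: old_set_def ran_def)
        moreover have "S' \<subseteq> old_set st \<tau> \<union> ?E" using new[OF that] by (simp add: updated_def)
        ultimately show ?thesis by blast
      qed
      then show ?thesis unfolding ran_def by blast
    qed
    then have "card (?E \<union> \<Union>(ran new)) \<le> card (?E \<union> \<Union>(ran (kept st)))"
      using finE finK by (intro card_mono) auto
    also have "\<dots> \<le> card ?E + card (\<Union>(ran (kept st)))" by (rule card_Un_le)
    finally show ?thesis using le card by linarith
  qed
  have mem': "real (card (\<Union>(ran new))) \<le> real B + 9 * real k / \<epsilon>"
  proof -
    have "S \<subseteq> V" if "S \<in> ran new" for S
      using that S'(1) V unfolding ran_def by blast
    then have "\<Union>(ran new) \<subseteq> V" by blast
    then have "finite (\<Union>(ran new))" using finV by (rule finite_subset)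
    then have "card (\<Union>(ran new)) \<le> card (?E \<union> \<Union>(ran new))"
      using finE by (intro card_mono) auto
    then show ?thesis using mem by linarith
  qed
  have grid: "0 < \<tau> \<and> (\<exists>i::int. \<tau> = (1 + \<epsilon>) powi i) \<and> \<tau> \<le> ?\<Delta>" if "\<tau> \<in> thresholds st" for \<tau>
    using thresholds_pos[OF that] that by (auto simp: thresholds_def grid_def)
  have peak: "real (peak st) \<le> 2 * real B + 9 * real k / \<epsilon>" "0 \<le> delta st" "\<forall>e\<in>D. f {e} \<le> delta st"
    using inv by (simp_all add: invariant_def)
  show ?thesis
    unfolding invariant_def candidates_dense_def large_thresholds_active_def bss_state.select_convs
  proof (intro conjI allI impI ballI)
    show "D \<union> ?E \<subseteq> V" "{} \<subseteq> V - (D \<union> ?E)" using V by auto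
    show "0 \<le> ?\<Delta>" "?\<Delta> \<le> opt" using peak \<Delta> \<Delta>_le by auto
    show "f {e} \<le> ?\<Delta>" if "e \<in> D \<union> ?E" for e
      using that peak(3) \<Delta>(1) \<Delta>(2)[of e] by force
    show "0 \<le> (if ran new = {} then LB st else Max (f ` ran new))"
      "(if ran new = {} then LB st else Max (f ` ran new)) \<le> opt"
      using LB LB' by simp_all
    show "f S \<le> (if ran new = {} then LB st else Max (f ` ran new))" if "S \<in> ran new" for S
      using that ran by auto
    show "finite (dom new)" using dom fin by simp
    show "real (card (\<Union>(ran new))) \<le> real B + 9 * real k / \<epsilon>" by (rule mem')
    show "real (max (peak st) (footprint ?E new)) \<le> 2 * real B + 9 * real k / \<epsilon>"
      using peak mem by (simp add: footprint_def max_def)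
  next
    fix \<tau> S assume "new \<tau> = Some S"
    note S = S'[OF this]
    show "0 < \<tau>" "\<exists>i::int. \<tau> = (1 + \<epsilon>) powi i" "\<tau> \<le> ?\<Delta>" using grid[OF S(4)] by blast+
    show "S \<subseteq> D \<union> ?E" "card S \<le> k" "density \<epsilon> * \<tau> * real (card S) \<le> f S" by (fact S)+
  next
    fix i :: int
    assume "opt / (2 * real k * (1 + \<epsilon>)) < (1 + \<epsilon>) powi i \<and> (1 + \<epsilon>) powi i \<le> ?\<Delta>"
    then show "\<exists>S. new ((1 + \<epsilon>) powi i) = Some S \<and>
      (card S < k \<longrightarrow> (\<forall>x\<in>D \<union> ?E. marginal f {x} S < (1 + \<epsilon>) powi i))"
      by (intro cover[OF refl]) auto
  qed
qed

lemma sure_process_buffer: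
  assumes inv: "invariant D st" and ne: "buf st \<noteq> {}" and card: "card (buf st) \<le> B"
  shows "sure (process_buffer f k \<epsilon> st) (\<lambda>st' r. invariant (D \<union> buf st) st' \<and> buf st' = {})"
    (is "sure _ ?Q")
proof -
  have "sure (updates st) (\<lambda>new m. sure (finish st new) (\<lambda>st' r. ?Q st' (m + r)))"
  proof (rule sure_mono[OF sure_updates[OF inv]])
    fix new and m :: nat
    assume *: "dom (map_of new) = thresholds st \<and>
      (\<forall>\<tau> S'. map_of new \<tau> = Some S' \<longrightarrow> updated (buf st) \<tau> (old_set st \<tau>) S')"
    \<comment> \<open>\<open>delta\<close> only grows, so every kept threshold lies in the new grid
      and is processed again: the new map overrides all of \<open>kept\<close>.\<close>
    have "dom (kept st) \<subseteq> dom (map_of new)" using * invariant_kept(2)[OF inv] by auto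
    then have c: "kept st ++ map_of new = map_of new"
      by (fastforce simp: map_add_def fun_eq_iff split: option.splits)
    from * have "invariant (D \<union> buf st)
      \<lparr>buf = {}, delta = new_delta st,
       LB = (if ran (map_of new) = {} then LB st else Max (f ` ran (map_of new))),
       cand = map_of new, peak = max (peak st) (footprint (buf st) (map_of new))\<rparr>"
      by (intro invariant_finish[OF inv ne card]) auto
    then show "sure (finish st new) (\<lambda>st' r. ?Q st' (m + r))"
      unfolding finish_def c Let_def
      by (intro sure_bind)
        (unfold sure_oracle_round sure_return image_restrict_eq, simp split del: if_split)
  qed
  then have "sure (updates st \<bind> finish st) ?Q" by (rule sure_bind)
  then show ?thesis
    unfolding process_buffer_eq by (intro sure_bind) (simp add: sure_oracle_round)
qed

section \<open>Batch-Sieve-Streaming++: approximation\<close>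

lemma f_Un_le:
  assumes "A \<subseteq> V" "S \<subseteq> V" "\<And>x. x \<in> A \<Longrightarrow> marginal f {x} S \<le> t"
  shows "f (A \<union> S) \<le> f S + real (card A) * t"
  using finite_subset[OF assms(1) finV] assms(1,3)
proof (induction A rule: finite_induct)
  case empty
  then show ?case by simp
next
  case (insert x A)
  have "f (insert x A \<union> S) = f (A \<union> S) + marginal f {x} (A \<union> S)" by (simp add: marginal_def)
  also have "marginal f {x} (A \<union> S) \<le> marginal f {x} S"
    using insert.prems assms(2) by (intro f.marginal_antimono) auto
  also have "\<dots> \<le> t" using insert.prems by simp
  finally show ?case using insert by (simp add: algebra_simps)
qed

lemma opt_attained: obtains A where "A \<subseteq> V" "card A \<le> k" "f A = opt"
proof -
  have "opt \<in> f ` {A. A \<subseteq> V \<and> card A \<le> k}"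
    unfolding opt_def using finV by (intro Max_in) auto
  then show thesis using that by auto
qed

lemma opt_le:
  assumes "S \<subseteq> V" "0 \<le> t" "\<And>x. x \<in> V \<Longrightarrow> marginal f {x} S \<le> t"
  shows "opt \<le> f S + real k * t"
proof -
  obtain A where A: "A \<subseteq> V" "card A \<le> k" "f A = opt" by (rule opt_attained)
  have "opt \<le> f (A \<union> S)" using A assms by (auto intro!: f.g_mono simp flip: A(3))
  also have "\<dots> \<le> f S + real (card A) * t" using A assms by (intro f_Un_le) auto
  also have "\<dots> \<le> f S + real k * t" using A assms(2) by (simp add: mult_right_mono)
  finally show ?thesis .
qed

text \<open>\<open>f\<close> need not vanish on the empty set. An optimal set with value above
  \<open>f {}\<close> is nonempty, so the summand \<open>f {}\<close> is absorbed by the singleton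
  values.\<close>

lemma opt_le_delta:
  assumes inv: "invariant V st" and "f {} < opt"
  shows "opt \<le> real k * delta st"
proof -
  obtain A where A: "A \<subseteq> V" "card A \<le> k" "f A = opt" by (rule opt_attained)
  have "A \<noteq> {}" using A assms(2) by auto
  then have one: "1 \<le> real (card A)"
    using finite_subset[OF A(1) finV] by (simp add: Suc_le_eq card_gt_0_iff)
  have d: "0 \<le> delta st" "\<And>e. e \<in> V \<Longrightarrow> f {e} \<le> delta st" using inv by (auto simp: invariant_def)
  have "opt \<le> f {} + real (card A) * (delta st - f {})"
    using f_Un_le[of A "{}" "delta st - f {}"] A d by (auto simp: marginal_def)
  also have "\<dots> \<le> real (card A) * f {} + real (card A) * (delta st - f {})"
    using mult_right_mono[OF one f_nonneg[of "{}"]] by simp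
  also have "\<dots> = real (card A) * delta st" by (simp add: algebra_simps)
  also have "\<dots> \<le> real k * delta st" using A d by (simp add: mult_right_mono)
  finally show ?thesis .
qed

text \<open>The smallest threshold \<open>\<tau>\<close> of the grid above \<open>opt / (2 k (1 + \<epsilon>))\<close> and its successor are
  both active in the end. If the set of one of them is not full, it is at least \<open>opt - k \<tau>\<close>, and a
  full set is at least \<open>(1 - 3 \<epsilon>) k \<tau>\<close>. The bad case is a full set for \<open>\<tau>\<close> and a set for the
  successor that is not full. Then both inequalities are combined.\<close>

lemma approximation:
  assumes inv: "invariant V st" and F: "\<And>S. S \<in> ran (cand st) \<Longrightarrow> f S \<le> F" "f {} \<le> F"
  shows "(1 / 2 - 3 * \<epsilon> / 2) * opt \<le> F"
proof (cases "f {} < opt")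
  case False
  have "(1 / 2 - 3 * \<epsilon> / 2) * opt \<le> 1 * opt" using eps opt_nonneg by (intro mult_right_mono) auto
  then show ?thesis using False F(2) by linarith
next
  case True
  have opt: "0 < opt" using True f_nonneg[of "{}"] by simp
  have F0: "0 \<le> F" using f_nonneg[of "{}"] F(2) by simp
  have delta: "opt \<le> real k * delta st" using inv True by (rule opt_le_delta)
  have k0: "0 < real k" using k by simp
  define c where "c = 1 - 3 * \<epsilon>"
  \<comment> \<open>The density is at least \<open>c\<close> since \<open>(1 - 3 * \<epsilon>) * (1
    + 2 * \<epsilon>) = 1 - \<epsilon> - 6 * \<epsilon>\<^sup>2\<close>.\<close>
  have c: "0 < c" "c \<le> density \<epsilon>" using eps by (auto simp: c_def density_def field_simps)
  define x where "x = opt / (2 * real k)"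
  have x: "0 < x" using opt k0 by (simp add: x_def)
  have xk: "real k * x = opt / 2" using k0 by (simp add: x_def)
  \<comment> \<open>This places \<open>\<tau>\<close> and its successor below \<open>delta\<close>,
    since \<open>\<tau> * (1 + \<epsilon>) \<le> 2 * x\<close>.\<close>
  have kd: "2 * x \<le> delta st" using delta k0 by (simp add: x_def field_simps)
  define i where "i = \<lfloor>log (1 + \<epsilon>) x\<rfloor>"
  define \<tau> where "\<tau> = (1 + \<epsilon>) powi i"
  have \<tau>0: "0 < \<tau>" using eps by (simp add: \<tau>_def)
  have \<tau>_le: "\<tau> \<le> x" unfolding \<tau>_def i_def using x by (rule powi_floor_log_le)
  have "log (1 + \<epsilon>) x < of_int (i + 1)" unfolding i_def by linarith
  then have "x < (1 + \<epsilon>) powi (i + 1)"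
    using eps x by (simp only: powi_eq_powr log_less_iff)
  then have \<tau>_gt: "x < \<tau> * (1 + \<epsilon>)" using eps by (simp add: \<tau>_def power_int_add)
  have "opt / (2 * real k * (1 + \<epsilon>)) = x / (1 + \<epsilon>)" by (simp add: x_def)
  also have "\<dots> < \<tau>" using \<tau>_gt eps by (simp add: pos_divide_less_eq)
  finally have low: "opt / (2 * real k * (1 + \<epsilon>)) < \<tau>" .
  have two: "f S \<ge> c * real k * t \<or> opt \<le> F + real k * t"
    if t: "t = (1 + \<epsilon>) powi j" "cand st t = Some S"
      "card S < k \<longrightarrow> (\<forall>x\<in>V. marginal f {x} S < t)" for t S and j :: int
  proof (cases "card S < k")
    case True
    have "opt \<le> f S + real k * t"
      using invariant_cand(1,4)[OF inv t(2)] t(3) True by (intro opt_le) auto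
    also have "f S \<le> F" using t(2) by (intro F(1)) (auto simp: ran_def)
    finally show ?thesis by simp
  next
    case False
    then have "card S = k" using invariant_cand(5)[OF inv t(2)] by simp
    then have "density \<epsilon> * t * real k \<le> f S" using invariant_cand(6)[OF inv t(2)] by simp
    moreover have "c * (t * real k) \<le> density \<epsilon> * (t * real k)"
      using c invariant_cand(1)[OF inv t(2)] by (intro mult_right_mono) auto
    ultimately show ?thesis by (simp add: algebra_simps)
  qed
  have active: "c * real k * t \<le> F \<or> opt \<le> F + real k * t"
    if t: "t = (1 + \<epsilon>) powi j" "opt / (2 * real k * (1 + \<epsilon>)) < t" "t \<le> 2 * x" for t and j :: int
  proof -
    obtain S where S: "cand st t = Some S" "card S < k \<longrightarrow> (\<forall>x\<in>V. marginal f {x} S < t)"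
      using invariant_cover[OF inv, of j] t kd by auto
    have "f S \<le> F" using S(1) by (intro F(1)) (auto simp: ran_def)
    then show ?thesis using two[OF t(1) S] by linarith
  qed
  have "c * real k * \<tau> \<le> F \<or> opt \<le> F + real k * \<tau>"
    using active[OF \<tau>_def low] \<tau>_le x by linarith
  moreover have "c * real k * (\<tau> * (1 + \<epsilon>)) \<le> F \<or> opt \<le> F + real k * (\<tau> * (1 + \<epsilon>))"
  proof (rule active)
    show "\<tau> * (1 + \<epsilon>) = (1 + \<epsilon>) powi (i + 1)" using eps by (simp add: \<tau>_def power_int_add)
    have "\<tau> < \<tau> * (1 + \<epsilon>)" using \<tau>0 eps by simp
    then show "opt / (2 * real k * (1 + \<epsilon>)) < \<tau> * (1 + \<epsilon>)" using low by linarith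
    have "\<tau> * (1 + \<epsilon>) \<le> x * 2" using \<tau>_le eps x \<tau>0 by (intro mult_mono) auto
    then show "\<tau> * (1 + \<epsilon>) \<le> 2 * x" by simp
  qed
  ultimately consider "opt \<le> F + real k * \<tau>" | "c * real k * (\<tau> * (1 + \<epsilon>)) \<le> F"
    | "c * real k * \<tau> \<le> F" "opt \<le> F + real k * (\<tau> * (1 + \<epsilon>))" by blast
  then have "c * opt \<le> 2 * F"
  proof cases
    case 1
    have "real k * \<tau> \<le> opt / 2" using mult_left_mono[OF \<tau>_le, of "real k"] xk by simp
    then have "1 * opt \<le> 2 * F" using 1 by simp
    moreover have "c * opt \<le> 1 * opt" using opt eps by (intro mult_right_mono) (auto simp: c_def)
    ultimately show ?thesis by linarith
  next
    case 2
    have "c * (real k * x) \<le> c * (real k * (\<tau> * (1 + \<epsilon>)))"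
      using c \<tau>_gt k0 by (intro mult_left_mono) auto
    also have "\<dots> \<le> F" using 2 by (simp only: mult.assoc)
    finally show ?thesis unfolding xk by simp
  next
    case 3
    \<comment> \<open>The term \<open>c * k * \<tau> * (1 + \<epsilon>)\<close> of the second
      inequality is bounded by \<open>(1 + \<epsilon>) * F\<close> through the first one, and
      \<open>c + 1 + \<epsilon> = 2 - 2 * \<epsilon>\<close>.\<close>
    have "c * opt \<le> c * (F + real k * (\<tau> * (1 + \<epsilon>)))" using 3(2) c by (intro mult_left_mono) auto
    moreover have "(c * real k * \<tau>) * (1 + \<epsilon>) \<le> F * (1 + \<epsilon>)" using 3(1) eps by (intro mult_right_mono) auto
    ultimately have "c * opt \<le> (c + 1 + \<epsilon>) * F" by (simp add: algebra_simps)
    also have "\<dots> \<le> 2 * F" using F0 eps by (intro mult_right_mono) (auto simp: c_def)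
    finally show ?thesis .
  qed
  then show ?thesis by (simp add: c_def algebra_simps)
qed

section \<open>Runs over the whole stream\<close>

lemma card_buf_less:
  assumes "\<theta> \<le> 100" "real n < \<theta> / 100 * real B"
  shows "n < B"
proof -
  have "\<theta> / 100 * real B \<le> 1 * real B" using assms(1) by (intro mult_right_mono) auto
  then show ?thesis using assms(2) by linarith
qed

lemma invariant_finite_buf: "invariant D st \<Longrightarrow> finite (buf st)"
  using finV by (auto simp: invariant_def intro: finite_subset)

text \<open>Before every arrival the buffer is below its trigger and hence below \<open>B\<close>,
  so the new element still fits and no batch exceeds \<open>B\<close>.\<close>

lemma sure_process_stream:
  assumes \<theta>: "0 < \<theta>" "\<theta> \<le> 100"
    and "invariant D st" "real (card (buf st)) < \<theta> / 100 * real B"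
    and "distinct es" "set es \<inter> (D \<union> buf st) = {}" "D \<union> buf st \<union> set es = V"
  shows "sure (process_stream f k B \<theta> \<epsilon> es st) (\<lambda>st' r. invariant V st')"
  using assms(3-)
proof (induction es arbitrary: D st)
  case Nil
  note card = card_buf_less[OF \<theta>(2) Nil.prems(2)]
  show ?case
  proof (cases "buf st = {}")
    case True
    then show ?thesis using Nil by (simp add: sure_return)
  next
    case False
    have "sure (process_buffer f k \<epsilon> st) (\<lambda>st' r. invariant (D \<union> buf st) st' \<and> buf st' = {})"
      using Nil False card by (intro sure_process_buffer) auto
    then have "sure (process_buffer f k \<epsilon> st) (\<lambda>st' r. invariant V st')"
      by (rule sure_mono) (use Nil in auto)
    then show ?thesis using False by simp
  qed
next
  case (Cons e es)
  let ?st = "arrive e st"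
  note card = card_buf_less[OF \<theta>(2) Cons.prems(2)]
  have buf: "buf ?st = insert e (buf st)" by (simp add: arrive_def)
  have card': "card (buf ?st) = Suc (card (buf st))"
    using Cons.prems invariant_finite_buf unfolding buf by (intro card_insert_disjoint) auto
  have inv: "invariant D ?st" using Cons.prems card by (intro invariant_arrive) auto
  show ?case
  proof (cases "\<theta> / 100 * real B \<le> real (card (buf ?st))")
    case True
    have "sure (process_buffer f k \<epsilon> ?st) (\<lambda>st' r. invariant (D \<union> buf ?st) st' \<and> buf st' = {})"
      using inv card card' buf by (intro sure_process_buffer) auto
    then have "sure (process_buffer f k \<epsilon> ?st) (\<lambda>st' m.
      sure (process_stream f k B \<theta> \<epsilon> es st') (\<lambda>st'' r. invariant V st''))"
    proof (rule sure_mono)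
      fix st' assume "invariant (D \<union> buf ?st) st' \<and> buf st' = {}"
      then show "sure (process_stream f k B \<theta> \<epsilon> es st') (\<lambda>st'' r. invariant V st'')"
        using Cons.prems \<theta> B by (intro Cons.IH[where D = "D \<union> buf ?st"]) (auto simp: buf)
    qed
    then have "sure (process_buffer f k \<epsilon> ?st \<bind> process_stream f k B \<theta> \<epsilon> es) (\<lambda>st' r. invariant V st')"
      by (rule sure_bind)
    then show ?thesis using True by simp
  next
    case False
    then have "sure (process_stream f k B \<theta> \<epsilon> es ?st) (\<lambda>st' r. invariant V st')"
      using Cons.prems inv by (intro Cons.IH[where D = D]) (auto simp: buf)
    then show ?thesis using False by simp
  qed
qed

lemma sure_batch_sieve_streaming:
  assumes \<theta>: "0 < \<theta>" "\<theta> \<le> 100" and xs: "distinct xs" "set xs = V"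
  shows "sure (batch_sieve_streaming f k B \<theta> \<epsilon> xs) (\<lambda>(S, mem) r. S \<subseteq> V \<and> card S \<le> k \<and>
    (1 / 2 - 3 * \<epsilon> / 2) * opt \<le> f S \<and> real mem \<le> 2 * real B + 9 * real k / \<epsilon>)"
    (is "sure _ ?Q")
proof -
  have "sure (process_stream f k B \<theta> \<epsilon> xs init_state) (\<lambda>st r. invariant V st)"
    using \<theta> xs B invariant_init
    by (intro sure_process_stream[where D = "{}"]) (auto simp: init_state_def)
  then have "sure (process_stream f k B \<theta> \<epsilon> xs init_state) (\<lambda>st m.
    sure (oracle_round f (ran (cand st)) \<bind> (\<lambda>a. return_comp
       (if ran (cand st) = {} then {} else arg_max_on a (ran (cand st)), peak st))) (\<lambda>p r. ?Q p (m + r)))"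
  proof (rule sure_mono)
    fix st and m :: nat assume inv: "invariant V st"
    let ?C = "ran (cand st)" and ?g = "restrict f (ran (cand st))"
    let ?R = "if ?C = {} then {} else arg_max_on ?g ?C"
    have fin: "finite ?C" using inv by (simp add: invariant_def finite_ran)
    have C: "S \<subseteq> V \<and> card S \<le> k" if "S \<in> ?C" for S
    proof -
      from that obtain \<tau> where "cand st \<tau> = Some S" by (auto simp: ran_def)
      then show ?thesis using invariant_cand(4,5)[OF inv] by blast
    qed
    have R: "?R \<subseteq> V \<and> card ?R \<le> k \<and> (\<forall>S\<in>?C. f S \<le> f ?R)"
    proof (cases "?C = {}")
      case False
      have in_C: "arg_max_on ?g ?C \<in> ?C" by (rule arg_max_on_finite(1)[OF fin False])
      have "f S \<le> f (arg_max_on ?g ?C)" if "S \<in> ?C" for S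
        using arg_max_on_finite(2)[OF fin False that, of ?g] in_C that by simp
      then show ?thesis using C[OF in_C] False by simp
    qed simp
    \<comment> \<open>Without candidates the empty set is returned. In both cases the result is at
      least \<open>f {}\<close>, as \<open>approximation\<close> requires.\<close>
    have "f {} \<le> f ?R" by (intro f.g_mono empty_subsetI) (use R in blast)
    then have "(1 / 2 - 3 * \<epsilon> / 2) * opt \<le> f ?R"
      using R by (intro approximation[OF inv]) blast+
    moreover have "real (peak st) \<le> 2 * real B + 9 * real k / \<epsilon>" using inv by (simp add: invariant_def)
    ultimately have "?Q (?R, peak st) (m + 1)" using R by blast
    then show "sure (oracle_round f ?C \<bind> (\<lambda>a. return_comp
       (if ?C = {} then {} else arg_max_on a ?C, peak st))) (\<lambda>p r. ?Q p (m + r))"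
      by (intro sure_bind) (unfold sure_oracle_round sure_return, simp only: add_0_right)
  qed
  then show ?thesis unfolding batch_sieve_streaming_def by (rule sure_bind)
qed

section \<open>Batch-Sieve-Streaming++: expected number of rounds\<close>

text \<open>The maximum in \<open>min_threshold\<close> is at least \<open>new_delta\<close>, so the
  ends of the grid differ by a factor of at most \<open>2 * k * (1 + \<epsilon>)\<close>, whatever
  the values of \<open>f\<close>.\<close>

lemma card_thresholds_le:
  assumes "2 \<le> k" "0 \<le> LB st"
  shows "real (card (thresholds st)) \<le> (3 / ln (1 + \<epsilon>) + 2) * ln (real k)"
proof (cases "0 < new_delta st")
  case False
  then have "thresholds st = {}" by (simp add: thresholds_def grid_empty)
  then show ?thesis using assms eps by simp
next
  case True
  let ?hi = "new_delta st" and ?lo = "new_delta st / (2 * real k * (1 + \<epsilon>))"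
  have pos: "0 < 2 * real k * (1 + \<epsilon>)" "0 < ln (1 + \<epsilon>)" using assms eps by auto
  have one: "1 \<le> 2 * ln (real k)" using assms(1) by (rule ln_ge_half)
  have lo: "0 < ?lo" using True pos by simp
  have "2 * 1 * 1 \<le> 2 * real k * (1 + \<epsilon>)" using assms eps by (intro mult_mono) auto
  then have "?lo \<le> ?hi / 1" using True by (intro divide_left_mono) auto
  then have le: "?lo \<le> ?hi" by simp
  have "?lo \<le> min_threshold st"
    unfolding min_threshold_def using pos by (intro divide_right_mono) auto
  then have "thresholds st \<subseteq> grid \<epsilon> ?lo ?hi" by (auto simp: thresholds_def grid_def)
  then have "card (thresholds st) \<le> card (grid \<epsilon> ?lo ?hi)"
    using lo by (intro card_mono finite_grid) auto
  then have "real (card (thresholds st)) \<le> ln (?hi / ?lo) / ln (1 + \<epsilon>) + 1"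
    using card_grid_le[OF lo le] by linarith
  also have "?hi / ?lo = 2 * real k * (1 + \<epsilon>)" using True by simp
  also have "ln (2 * real k * (1 + \<epsilon>)) \<le> 3 * ln (real k)"
  proof -
    have "2 * real k * (1 + \<epsilon>) \<le> real k * real k * real k"
      using assms eps by (intro mult_mono) auto
    then have "ln (2 * real k * (1 + \<epsilon>)) \<le> ln (real k * real k * real k)"
      using pos by (subst ln_le_cancel_iff) auto
    also have "\<dots> = 3 * ln (real k)" using assms by (simp add: ln_mult)
    finally show ?thesis .
  qed
  also have "3 * ln (real k) / ln (1 + \<epsilon>) + 1 \<le> (3 / ln (1 + \<epsilon>) + 2) * ln (real k)"
    using one by (simp add: algebra_simps)
  finally show ?thesis using pos by (simp add: divide_right_mono)
qed

lemma expect_update_le: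
  fixes b d :: real
  assumes "S \<subseteq> V" "E \<subseteq> V" "0 < \<tau>" "card E \<le> B"
    and b: "1 \<le> b" "\<And>\<kappa>. 1 \<le> \<kappa> \<Longrightarrow> \<kappa> \<le> k \<Longrightarrow> b ^ iteration_rounds \<epsilon> \<kappa> B \<le> 2"
    and d: "0 < d" "d \<le> 1" "(1 - d) ^ p \<le> 1 / 4"
    and prob: "\<And>\<kappa>. real (singles_count \<epsilon>) * d + (\<Sum>i\<in>set (block_indices \<epsilon> \<kappa>). block_weight \<epsilon> d i) \<le> 1 / 4"
  shows "expect (update E \<tau> S) (\<lambda>_ n. ennreal b ^ n) \<le> ennreal (2 + 32 * real B ^ p)"
proof (cases "card S < k")
  case True
  have "expect (update E \<tau> S) (\<lambda>_ n. ennreal b ^ n) =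
    expect (threshold_sampling (\<lambda>A. marginal f A S) E (k - card S) \<tau> \<epsilon>) (\<lambda>_ n. ennreal b ^ n)"
    unfolding update_def if_P[OF True] by (simp add: expect_bind expect_return)
  also have "\<dots> \<le> ennreal (2 + 32 * real B ^ p)"
    using True assms
    by (intro threshold_instance.expect_threshold_sampling_le[OF threshold_instance_marginal])
      (auto intro!: b(2))
  finally show ?thesis .
next
  case False
  have "ennreal 1 \<le> ennreal (2 + 32 * real B ^ p)" by (intro ennreal_leI) simp
  then show ?thesis unfolding update_def if_not_P[OF False] by (simp add: expect_return)
qed

lemma expect_process_buffer_le:
  fixes d \<rho> :: real
  assumes inv: "invariant D st" and card: "card (buf st) \<le> B"
    and \<rho>: "0 < \<rho>" "\<And>\<kappa>. 1 \<le> \<kappa> \<Longrightarrow> \<kappa> \<le> k \<Longrightarrow> real (iteration_rounds \<epsilon> \<kappa> B) \<le> \<rho>"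
    and d: "0 < d" "d \<le> 1" "(1 - d) ^ p \<le> 1 / 4"
    and prob: "\<And>\<kappa>. real (singles_count \<epsilon>) * d + (\<Sum>i\<in>set (block_indices \<epsilon> \<kappa>). block_weight \<epsilon> d i) \<le> 1 / 4"
  shows "expect (process_buffer f k \<epsilon> st) (\<lambda>_ n. of_nat n) \<le>
    ennreal (2 + \<rho> * (ln (1 + real (card (thresholds st)) * (2 + 32 * real B ^ p)) + 1) / ln 2)"
proof -
  let ?m = "card (thresholds st)"
  let ?M = "1 + real ?m * (2 + 32 * real B ^ p)"
  \<comment> \<open>With this base an iteration of at most \<open>\<rho>\<close> rounds contributes
    a factor of at most 2, and \<open>1 / ln b\<close> is \<open>\<rho> / ln 2\<close>.\<close>
  define b where "b = 2 powr (1 / \<rho>)"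
  have b: "1 < b" unfolding b_def using \<rho>(1) by simp
  have ln_b: "ln b = ln 2 / \<rho>" by (simp add: b_def ln_powr)
  have pow: "b ^ iteration_rounds \<epsilon> \<kappa> B \<le> 2" if "1 \<le> \<kappa>" "\<kappa> \<le> k" for \<kappa>
  proof -
    have "b ^ iteration_rounds \<epsilon> \<kappa> B = 2 powr (real (iteration_rounds \<epsilon> \<kappa> B) / \<rho>)"
      using b by (simp add: b_def powr_powr flip: powr_realpow)
    also have "\<dots> \<le> 2 powr 1" using \<rho>(1) \<rho>(2)[OF that] by (intro powr_mono) auto
    finally show ?thesis by simp
  qed
  have V: "D \<subseteq> V" "buf st \<subseteq> V" and LB: "0 \<le> LB st" using inv by (auto simp: invariant_def)
  have len: "length (sorted_list_of_set (thresholds st)) = ?m" by simp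
  have "expect (updates st) (\<lambda>_ n. ennreal b ^ n) \<le>
    1 + of_nat (length (sorted_list_of_set (thresholds st))) * ennreal (2 + 32 * real B ^ p)"
    unfolding updates_def
  proof (rule expect_par_map_power_le)
    fix \<tau> assume "\<tau> \<in> set (sorted_list_of_set (thresholds st))"
    then have "0 < \<tau>" using finite_thresholds[OF LB] by (auto intro: thresholds_pos)
    then show "expect (update (buf st) \<tau> (old_set st \<tau>)) (\<lambda>_ n. ennreal b ^ n) \<le> ennreal (2 + 32 * real B ^ p)"
      using invariant_old_set(1)[OF inv, of \<tau>] V card b pow d prob by (intro expect_update_le) auto
  qed (use b in simp)
  also have "\<dots> = ennreal ?M"
    unfolding len by (simp add: ennreal_plus ennreal_mult ennreal_of_nat_eq_real_of_nat del: of_nat_mult)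
  finally have "expect (updates st) (\<lambda>_ n. of_nat n) \<le> ennreal ((ln ?M + 1) / ln b)"
    using b by (intro expect_rounds_le_of_moment) auto
  also have "(ln ?M + 1) / ln b = \<rho> * (ln ?M + 1) / ln 2" by (simp add: ln_b)
  finally have upd: "expect (updates st) (\<lambda>_ n. of_nat n) \<le> ennreal (\<rho> * (ln ?M + 1) / ln 2)" .
  have M: "0 \<le> ln ?M" by (rule ln_ge_zero) simp
  have nonneg: "0 \<le> \<rho> * (ln ?M + 1) / ln 2" using M \<rho>(1) by simp
  \<comment> \<open>The two extra rounds query the singletons before the parallel calls and the
    candidates after them.\<close>
  have "expect (process_buffer f k \<epsilon> st) (\<lambda>_ n. of_nat n) \<le>
    expect (oracle_round f ((\<lambda>e. {e}) ` buf st)) (\<lambda>_ n. of_nat n) + (ennreal (\<rho> * (ln ?M + 1) / ln 2) + 1)"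
    unfolding process_buffer_eq
  proof (rule expect_bind_add_le[where Q = "\<lambda>_ _. True"])
    have "expect (updates st \<bind> finish st) (\<lambda>_ n. of_nat n) \<le> expect (updates st) (\<lambda>_ n. of_nat n) + 1"
      by (rule expect_bind_add_le[OF sure_updates[OF inv]])
        (simp add: finish_def Let_def expect_bind expect_oracle_round expect_return)
    also have "\<dots> \<le> ennreal (\<rho> * (ln ?M + 1) / ln 2) + 1" using upd by (rule add_right_mono)
    finally show "expect (updates st \<bind> finish st) (\<lambda>_ n. of_nat n) \<le> ennreal (\<rho> * (ln ?M + 1) / ln 2) + 1" .
  qed (simp add: sure_oracle_round)
  also have "\<dots> = ennreal 1 + (ennreal (\<rho> * (ln ?M + 1) / ln 2) + ennreal 1)"
    by (simp add: expect_oracle_round)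
  also have "\<dots> = ennreal (1 + (\<rho> * (ln ?M + 1) / ln 2 + 1))"
    using nonneg by (simp only: ennreal_plus[symmetric] zero_le_one add_nonneg_nonneg)
  also have "1 + (\<rho> * (ln ?M + 1) / ln 2 + 1) = 2 + \<rho> * (ln ?M + 1) / ln 2" by simp
  finally show ?thesis .
qed

text \<open>Amortization: a batch within the stream consumes at least
  \<open>\<theta> / 100 * B\<close> elements, so the stream length bounds the number of batches. The
  summand 1 is for the remainder processed at the end.\<close>

lemma expect_process_stream_le:
  assumes \<theta>: "0 < \<theta>" "\<theta> \<le> 100" and "0 \<le> K"
    and K: "\<And>D st. invariant D st \<Longrightarrow> card (buf st) \<le> B \<Longrightarrow>
      expect (process_buffer f k \<epsilon> st) (\<lambda>_ n. of_nat n) \<le> ennreal K"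
    and "invariant D st" "real (card (buf st)) < \<theta> / 100 * real B"
    and "distinct es" "set es \<inter> (D \<union> buf st) = {}" "set es \<subseteq> V"
  shows "expect (process_stream f k B \<theta> \<epsilon> es st) (\<lambda>_ n. of_nat n) \<le>
    ennreal (K * ((real (card (buf st)) + real (length es)) / (\<theta> / 100 * real B) + 1))"
  using assms(5-)
proof (induction es arbitrary: D st)
  case Nil
  note card = card_buf_less[OF \<theta>(2) Nil.prems(2)]
  have w: "0 < \<theta> / 100 * real B" using \<theta> B by simp
  show ?case
  proof (cases "buf st = {}")
    case True
    then show ?thesis by (simp add: expect_return)
  next
    case False
    have "expect (process_buffer f k \<epsilon> st) (\<lambda>_ n. of_nat n) \<le> ennreal K"
      using Nil card by (intro K) auto
    also have "\<dots> \<le> ennreal (K * (real (card (buf st)) / (\<theta> / 100 * real B) + 1))"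
      using \<open>0 \<le> K\<close> w by (intro ennreal_leI) (simp add: algebra_simps)
    finally show ?thesis using False by simp
  qed
next
  case (Cons e es)
  let ?st = "arrive e st" and ?w = "\<theta> / 100 * real B"
  have w: "0 < ?w" using \<theta> B by simp
  note card = card_buf_less[OF \<theta>(2) Cons.prems(2)]
  have buf: "buf ?st = insert e (buf st)" by (simp add: arrive_def)
  have card': "card (buf ?st) = Suc (card (buf st))"
    using Cons.prems invariant_finite_buf unfolding buf by (intro card_insert_disjoint) auto
  have inv: "invariant D ?st" using Cons.prems card by (intro invariant_arrive) auto
  show ?case
  proof (cases "?w \<le> real (card (buf ?st))")
    case True
    let ?N = "real (length es)"
    have "sure (process_buffer f k \<epsilon> ?st) (\<lambda>st' r. invariant (D \<union> buf ?st) st' \<and> buf st' = {})"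
      using inv card card' buf by (intro sure_process_buffer) auto
    then have "expect (process_buffer f k \<epsilon> ?st \<bind> process_stream f k B \<theta> \<epsilon> es) (\<lambda>_ n. of_nat n) \<le>
      expect (process_buffer f k \<epsilon> ?st) (\<lambda>_ n. of_nat n) + ennreal (K * (?N / ?w + 1))"
    proof (rule expect_bind_add_le)
      fix st' assume st': "invariant (D \<union> buf ?st) st' \<and> buf st' = {}"
      then have "expect (process_stream f k B \<theta> \<epsilon> es st') (\<lambda>_ n. of_nat n) \<le>
        ennreal (K * ((real (card (buf st')) + ?N) / ?w + 1))"
        using Cons.prems \<theta> B by (intro Cons.IH[where D = "D \<union> buf ?st"]) (auto simp: buf)
      then show "expect (process_stream f k B \<theta> \<epsilon> es st') (\<lambda>_ n. of_nat n) \<le> ennreal (K * (?N / ?w + 1))"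
        using st' by simp
    qed
    also have "\<dots> \<le> ennreal K + ennreal (K * (?N / ?w + 1))"
      using inv card card' by (intro add_right_mono K) auto
    also have "\<dots> = ennreal (K + K * (?N / ?w + 1))"
      using \<open>0 \<le> K\<close> w by (intro ennreal_plus[symmetric]) auto
    also have "\<dots> \<le> ennreal (K * ((real (card (buf st)) + real (length (e # es))) / ?w + 1))"
    proof (rule ennreal_leI)
      have "1 + (?N / ?w + 1) \<le> (real (card (buf st)) + real (length (e # es))) / ?w + 1"
        using True w card' by (simp add: add_divide_distrib[symmetric] pos_le_divide_eq algebra_simps)
      then show "K + K * (?N / ?w + 1) \<le> K * ((real (card (buf st)) + real (length (e # es))) / ?w + 1)"
        using mult_left_mono[OF _ \<open>0 \<le> K\<close>] by (fastforce simp: distrib_left)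
    qed
    finally show ?thesis using True by simp
  next
    case False
    then have "expect (process_stream f k B \<theta> \<epsilon> es ?st) (\<lambda>_ n. of_nat n) \<le>
      ennreal (K * ((real (card (buf ?st)) + real (length es)) / ?w + 1))"
      using Cons.prems inv by (intro Cons.IH[where D = D]) (auto simp: buf)
    then show ?thesis using False card' by (simp add: add_ac)
  qed
qed

end

text \<open>The factor \<open>\<rho>\<close> is bounded by \<open>C y\<close> for the summand \<open>p x\<close> of the logarithm and by \<open>C x\<close>
  for the other ones.\<close>

lemma batch_rounds_le:
  fixes x y \<rho> C c :: real
  assumes "2 \<le> B" "x = ln (real B)" "1 \<le> 2 * x" "1 \<le> 2 * y" "0 < C" "\<rho> = C * min x y"
    and m: "real m \<le> c * y"
  shows "2 + \<rho> * (ln (1 + real m * (2 + 32 * real B ^ p)) + 1) / ln 2 \<le>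
    (8 + C * (70 + c + real p) / ln 2) * (x * y)"
proof -
  have pow: "1 \<le> real B ^ p" using assms(1) by simp
  have \<rho>: "0 \<le> \<rho>" "\<rho> \<le> C * x" "\<rho> \<le> C * y" using assms by (auto simp: min_def)
  have x: "0 < x" and y: "0 < y" using assms by auto
  have "1 + real m * (2 + 32 * real B ^ p) \<le> 35 * (1 + real m) * real B ^ p"
  proof -
    have "real m * (2 + 32 * real B ^ p) \<le> real m * (34 * real B ^ p)"
      using pow by (intro mult_left_mono) auto
    then show ?thesis using pow by (simp add: algebra_simps)
  qed
  moreover have "0 < 1 + real m * (2 + 32 * real B ^ p)" by (intro add_pos_nonneg) auto
  ultimately have "ln (1 + real m * (2 + 32 * real B ^ p)) \<le> ln (35 * (1 + real m) * real B ^ p)"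
    using ln_le_cancel_iff less_le_trans by blast
  also have "\<dots> = ln (35 * (1 + real m)) + ln (real B ^ p)"
    using assms(1) by (intro ln_mult_pos) auto
  also have "ln (35 * (1 + real m)) = ln 35 + ln (1 + real m)" by (intro ln_mult_pos) auto
  also have "ln (real B ^ p) = real p * x" using assms(1,2) by (simp add: ln_realpow)
  \<comment> \<open>\<open>m\<close> is itself at most \<open>c * y\<close>, so the crude bound
    \<open>ln (1 + m) \<le> m\<close> suffices: multiplied by \<open>\<rho> \<le> C * x\<close> it
    stays of order \<open>x * y\<close>.\<close>
  also have "ln 35 + ln (1 + real m) + real p * x \<le> 34 + real m + real p * x"
    using ln_le_minus_one[of 35] ln_add_one_self_le_self[of "real m"] by simp
  finally have "\<rho> * (ln (1 + real m * (2 + 32 * real B ^ p)) + 1) \<le> \<rho> * (35 + c * y + real p * x)"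
    using \<rho> m by (intro mult_left_mono) auto
  also have "\<dots> = \<rho> * (35 + c * y) + \<rho> * (real p * x)" by (simp add: algebra_simps)
  also have "\<dots> \<le> C * x * (35 + c * y) + C * y * (real p * x)"
    using \<rho> x m by (intro add_mono mult_right_mono) auto
  also have "\<dots> \<le> C * x * (35 * (2 * y) + c * y) + C * y * (real p * x)"
    using assms x by (intro add_right_mono mult_left_mono) auto
  also have "\<dots> = C * (70 + c + real p) * (x * y)" by (simp add: algebra_simps)
  finally have "\<rho> * (ln (1 + real m * (2 + 32 * real B ^ p)) + 1) / ln 2 \<le>
    C * (70 + c + real p) * (x * y) / ln 2" by (intro divide_right_mono) auto
  moreover have "1 * 1 \<le> (2 * x) * (2 * y)" using assms by (intro mult_mono) auto
  ultimately show ?thesis by (simp add: algebra_simps)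
qed

text \<open>\<open>K\<close> is fixed before the instance, so the locale of instances cannot host
  this statement and is quantified over explicitly.\<close>

lemma (in accuracy) expect_process_buffer_bound:
  "\<exists>K\<ge>0. \<forall>(V :: 'a set) f k B. stream_instance \<epsilon> V f k B \<longrightarrow> 2 \<le> k \<longrightarrow> 2 \<le> B \<longrightarrow>
     (\<forall>D st. stream_instance.invariant \<epsilon> V f k B D st \<longrightarrow> card (buf st) \<le> B \<longrightarrow>
        expect (process_buffer f k \<epsilon> st) (\<lambda>_ n. of_nat n) \<le> ennreal (K * (ln (real B) * ln (real k))))"
proof -
  obtain C where C: "0 < C" "\<And>\<kappa> k N. 1 \<le> \<kappa> \<Longrightarrow> \<kappa> \<le> k \<Longrightarrow> 2 \<le> k \<Longrightarrow> 2 \<le> N \<Longrightarrow>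
     real (iteration_rounds \<epsilon> \<kappa> N) \<le> C * ln (real k) \<and> real (iteration_rounds \<epsilon> \<kappa> N) \<le> C * ln (real N)"
    using iteration_rounds_bound by blast
  obtain d p where d: "0 < d" "d \<le> 1" "(1 - d) ^ p \<le> 1 / 4"
    "\<And>\<kappa>. real (singles_count \<epsilon>) * d + (\<Sum>i\<in>set (block_indices \<epsilon> \<kappa>). block_weight \<epsilon> d i) \<le> 1 / 4"
    using progress_constants by blast
  define c where "c = 3 / ln (1 + \<epsilon>) + 2"
  define K where "K = 8 + C * (70 + c + real p) / ln 2"
  have "0 \<le> c" using eps by (simp add: c_def)
  then have "0 \<le> K" using C(1) by (simp add: K_def)
  moreover have "expect (process_buffer f k \<epsilon> st) (\<lambda>_ n. of_nat n) \<le> ennreal (K * (ln (real B) * ln (real k)))"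
    if "stream_instance \<epsilon> V f k B" and k2: "2 \<le> k" and B2: "2 \<le> B"
      and inv: "stream_instance.invariant \<epsilon> V f k B D st" and card: "card (buf st) \<le> B"
    for V :: "'a set" and f k B D st
  proof -
    interpret stream_instance \<epsilon> V f k B by fact
    let ?\<rho> = "C * min (ln (real B)) (ln (real k))"
    have one: "1 \<le> 2 * ln (real B)" "1 \<le> 2 * ln (real k)" using k2 B2 by (auto intro!: ln_ge_half)
    have "0 < ?\<rho>" using C(1) one by simp
    moreover have "real (iteration_rounds \<epsilon> \<kappa> B) \<le> ?\<rho>" if "1 \<le> \<kappa>" "\<kappa> \<le> k" for \<kappa>
      using C(2)[OF that k2 B2] by (simp add: min_def)
    ultimately have "expect (process_buffer f k \<epsilon> st) (\<lambda>_ n. of_nat n) \<le>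
      ennreal (2 + ?\<rho> * (ln (1 + real (card (thresholds st)) * (2 + 32 * real B ^ p)) + 1) / ln 2)"
      using inv card d by (intro expect_process_buffer_le) auto
    also have "\<dots> \<le> ennreal (K * (ln (real B) * ln (real k)))"
      unfolding K_def using B2 one C(1) inv k2 card_thresholds_le[of st]
      by (intro ennreal_leI batch_rounds_le) (auto simp: c_def invariant_def)
    finally show ?thesis .
  qed
  ultimately show ?thesis by blast
qed

section \<open>Total number of rounds and the final bounds\<close>

lemma expected_rounds_eq_expect: "expected_rounds c = expect c (\<lambda>_ n. of_nat n)"
  by (simp add: expected_rounds_def expect_def case_prod_unfold)

text \<open>\<open>B \<le> length xs\<close> makes the ratio of stream length to buffer size at
  least 1, which absorbs the last partial batch. The final round is absorbed by
  \<open>1 \<le> 4 * (ln B * ln k)\<close>. The leading \<open>\<epsilon>\<close> cancels the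
  division by \<open>\<epsilon>\<close> in the stated rate.\<close>

lemma (in stream_instance) expect_batch_sieve_streaming_le:
  assumes \<theta>: "0 < \<theta>" "\<theta> \<le> 100" and xs: "distinct xs" "set xs = V"
    and k2: "2 \<le> k" and B2: "2 \<le> B" "B \<le> length xs" and "0 \<le> K"
    and K: "\<And>D st. invariant D st \<Longrightarrow> card (buf st) \<le> B \<Longrightarrow>
      expect (process_buffer f k \<epsilon> st) (\<lambda>_ n. of_nat n) \<le> ennreal (K * (ln (real B) * ln (real k)))"
  shows "expect (batch_sieve_streaming f k B \<theta> \<epsilon> xs) (\<lambda>_ n. of_nat n) \<le>
    ennreal (\<epsilon> * (K * (100 / \<theta> + 1) + 4) * (real (length xs) * ln (real B) * ln (real k) / (real B * \<epsilon>)))"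
proof -
  let ?l = "ln (real B) * ln (real k)" and ?N = "real (length xs)"
  let ?K = "K * ?l * (?N / (\<theta> / 100 * real B) + 1)"
  have one: "1 \<le> 2 * ln (real B)" "1 \<le> 2 * ln (real k)" using k2 B2 by (auto intro!: ln_ge_half)
  have "1 * 1 \<le> (2 * ln (real B)) * (2 * ln (real k))" using one by (intro mult_mono) auto
  then have l: "1 \<le> 4 * ?l" by simp
  then have l0: "0 \<le> ?l" by simp
  have NB: "1 \<le> ?N / real B" using B2 by simp
  have K0: "0 \<le> K * ?l" using \<open>0 \<le> K\<close> l0 by (rule mult_nonneg_nonneg)
  then have nonneg: "0 \<le> ?K" using \<theta> by simp
  have sure: "sure (process_stream f k B \<theta> \<epsilon> xs init_state) (\<lambda>_ _. True)"
    using \<theta> xs B invariant_init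
    by (intro sure_mono[OF sure_process_stream[where D = "{}"]]) (auto simp: init_state_def)
  have "expect (batch_sieve_streaming f k B \<theta> \<epsilon> xs) (\<lambda>_ n. of_nat n) \<le>
    expect (process_stream f k B \<theta> \<epsilon> xs init_state) (\<lambda>_ n. of_nat n) + 1"
    unfolding batch_sieve_streaming_def
    by (rule expect_bind_add_le[OF sure]) (simp add: expect_bind expect_oracle_round expect_return)
  also have "expect (process_stream f k B \<theta> \<epsilon> xs init_state) (\<lambda>_ n. of_nat n) \<le> ennreal ?K"
  proof -
    have "expect (process_stream f k B \<theta> \<epsilon> xs init_state) (\<lambda>_ n. of_nat n) \<le>
      ennreal (K * ?l * ((real (card (buf (init_state :: 'a bss_state))) + ?N) / (\<theta> / 100 * real B) + 1))"
    proof (rule expect_process_stream_le[OF \<theta> K0 _ invariant_init])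
      show "expect (process_buffer f k \<epsilon> st) (\<lambda>_ n. of_nat n) \<le> ennreal (K * ?l)"
        if "invariant D st" "card (buf st) \<le> B" for D st using that by (rule K)
    qed (use xs B \<theta> in \<open>auto simp: init_state_def\<close>)
    then show ?thesis by (simp add: init_state_def)
  qed
  also have "ennreal ?K + 1 = ennreal (?K + 1)"
    using nonneg by (simp add: ennreal_plus)
  also have "\<dots> \<le> ennreal (\<epsilon> * (K * (100 / \<theta> + 1) + 4) * (?N * ln (real B) * ln (real k) / (real B * \<epsilon>)))"
  proof (rule ennreal_leI)
    have "?K = K * ?l * (100 / \<theta> * (?N / real B) + 1)" by simp
    also have "\<dots> \<le> K * ?l * (100 / \<theta> * (?N / real B) + ?N / real B)"
      using NB K0 by (intro mult_left_mono) auto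
    finally have "?K + 1 \<le> K * ?l * (100 / \<theta> * (?N / real B) + ?N / real B) + 4 * ?l * (?N / real B)"
      using mult_mono[OF l NB] l by simp
    also have "\<dots> = (K * (100 / \<theta> + 1) + 4) * (?N / real B * ?l)" by (simp add: algebra_simps)
    also have "?N / real B * ?l = \<epsilon> * (?N * ln (real B) * ln (real k) / (real B * \<epsilon>))"
      using eps by simp
    finally show "?K + 1 \<le> \<epsilon> * (K * (100 / \<theta> + 1) + 4) * (?N * ln (real B) * ln (real k) / (real B * \<epsilon>))"
      by (simp only: mult_ac)
  qed
  finally show ?thesis by (simp add: add_right_mono)
qed

lemma streaming_instanceD:
  assumes "streaming_instance f xs k B \<theta> \<epsilon>"
  shows "stream_instance \<epsilon> (set xs) f k B" "0 < \<theta>" "\<theta> \<le> 100" "distinct xs"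
  using assms by (auto simp: streaming_instance_def stream_instance_def accuracy_def stream_instance_axioms_def)

lemma batch_sieve_streaming_outcome:
  assumes "streaming_instance f xs k B \<theta> \<epsilon>"
  shows "sure (batch_sieve_streaming f k B \<theta> \<epsilon> xs) (\<lambda>(S, mem) r. S \<subseteq> set xs \<and> card S \<le> k \<and>
    (1 / 2 - 3 * \<epsilon> / 2) * Max (f ` {A. A \<subseteq> set xs \<and> card A \<le> k}) \<le> f S \<and>
    real mem \<le> 2 * real B + 9 * real k / \<epsilon>)"
proof -
  note inst = streaming_instanceD[OF assms]
  interpret stream_instance \<epsilon> "set xs" f k B by (fact inst(1))
  show ?thesis using sure_batch_sieve_streaming[OF inst(2-4) refl] unfolding opt_def .
qed

theorem theorem2:
  shows "(\<forall>(f :: 'a set \<Rightarrow> real) xs k B \<theta> \<epsilon>. streaming_instance f xs k B \<theta> \<epsilon> \<longrightarrow>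
            lossless_spmf (run_comp (batch_sieve_streaming f k B \<theta> \<epsilon> xs)) \<and>
            (\<forall>S mem r. ((S, mem), r) \<in> set_spmf (run_comp (batch_sieve_streaming f k B \<theta> \<epsilon> xs)) \<longrightarrow>
               S \<subseteq> set xs \<and> card S \<le> k \<and>
               f S \<ge> (1 / 2 - 3 * \<epsilon> / 2) * Max (f ` {A. A \<subseteq> set xs \<and> card A \<le> k})))
       \<and> (\<exists>C. \<forall>(f :: 'a set \<Rightarrow> real) xs k B \<theta> \<epsilon>. streaming_instance f xs k B \<theta> \<epsilon> \<longrightarrow>
            (\<forall>S mem r. ((S, mem), r) \<in> set_spmf (run_comp (batch_sieve_streaming f k B \<theta> \<epsilon> xs)) \<longrightarrow>
               real mem \<le> C * (real B + real k / \<epsilon>)))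
       \<and> (\<forall>\<epsilon> \<theta>. \<exists>C. \<forall>(f :: 'a set \<Rightarrow> real) xs k B.
            streaming_instance f xs k B \<theta> \<epsilon> \<and> 2 \<le> k \<and> 2 \<le> B \<and> B \<le> length xs \<longrightarrow>
            expected_rounds (batch_sieve_streaming f k B \<theta> \<epsilon> xs)
              \<le> ennreal (C * (real (length xs) * ln (real B) * ln (real k) / (real B * \<epsilon>))))"
proof (intro conjI allI impI)
  fix f :: "'a set \<Rightarrow> real" and xs k B \<theta> \<epsilon>
  assume "streaming_instance f xs k B \<theta> \<epsilon>"
  note out = batch_sieve_streaming_outcome[OF this]
  show "lossless_spmf (run_comp (batch_sieve_streaming f k B \<theta> \<epsilon> xs))"
    using out by (simp add: sure_def)
  fix S mem r assume "((S, mem), r) \<in> set_spmf (run_comp (batch_sieve_streaming f k B \<theta> \<epsilon> xs))"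
  then show "S \<subseteq> set xs" "card S \<le> k"
    "f S \<ge> (1 / 2 - 3 * \<epsilon> / 2) * Max (f ` {A. A \<subseteq> set xs \<and> card A \<le> k})"
    using out by (auto simp: sure_def)
next
  show "\<exists>C. \<forall>(f :: 'a set \<Rightarrow> real) xs k B \<theta> \<epsilon>. streaming_instance f xs k B \<theta> \<epsilon> \<longrightarrow>
            (\<forall>S mem r. ((S, mem), r) \<in> set_spmf (run_comp (batch_sieve_streaming f k B \<theta> \<epsilon> xs)) \<longrightarrow>
               real mem \<le> C * (real B + real k / \<epsilon>))"
  proof (intro exI[of _ 9] allI impI)
    fix f :: "'a set \<Rightarrow> real" and xs k B \<theta> \<epsilon> S mem r
    assume "streaming_instance f xs k B \<theta> \<epsilon>"
      and "((S, mem), r) \<in> set_spmf (run_comp (batch_sieve_streaming f k B \<theta> \<epsilon> xs))"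
    then have "real mem \<le> 2 * real B + 9 * real k / \<epsilon>"
      using batch_sieve_streaming_outcome[of f xs k B \<theta> \<epsilon>] by (auto simp: sure_def)
    then show "real mem \<le> 9 * (real B + real k / \<epsilon>)" by simp
  qed
next
  fix \<epsilon> \<theta> :: real
  show "\<exists>C. \<forall>(f :: 'a set \<Rightarrow> real) xs k B.
            streaming_instance f xs k B \<theta> \<epsilon> \<and> 2 \<le> k \<and> 2 \<le> B \<and> B \<le> length xs \<longrightarrow>
            expected_rounds (batch_sieve_streaming f k B \<theta> \<epsilon> xs)
              \<le> ennreal (C * (real (length xs) * ln (real B) * ln (real k) / (real B * \<epsilon>)))"
  proof (cases "accuracy \<epsilon>")
    case False
    then have "\<not> streaming_instance f xs k B \<theta> \<epsilon>" for f :: "'a set \<Rightarrow> real" and xs k B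
      by (auto simp: streaming_instance_def accuracy_def)
    then show ?thesis by blast
  next
    case True
    then obtain K where K: "0 \<le> K" "\<And>(V :: 'a set) f k B D st. stream_instance \<epsilon> V f k B \<Longrightarrow> 2 \<le> k \<Longrightarrow> 2 \<le> B \<Longrightarrow>
      stream_instance.invariant \<epsilon> V f k B D st \<Longrightarrow> card (buf st) \<le> B \<Longrightarrow>
      expect (process_buffer f k \<epsilon> st) (\<lambda>_ n. of_nat n) \<le> ennreal (K * (ln (real B) * ln (real k)))"
      using accuracy.expect_process_buffer_bound[OF True, where 'a = 'a] by blast
    show ?thesis
    proof (intro exI[of _ "\<epsilon> * (K * (100 / \<theta> + 1) + 4)"] allI impI)
      fix f :: "'a set \<Rightarrow> real" and xs k B
      assume *: "streaming_instance f xs k B \<theta> \<epsilon> \<and> 2 \<le> k \<and> 2 \<le> B \<and> B \<le> length xs"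
      then have "streaming_instance f xs k B \<theta> \<epsilon>" by blast
      note inst = streaming_instanceD[OF this]
      show "expected_rounds (batch_sieve_streaming f k B \<theta> \<epsilon> xs)
        \<le> ennreal (\<epsilon> * (K * (100 / \<theta> + 1) + 4) * (real (length xs) * ln (real B) * ln (real k) / (real B * \<epsilon>)))"
        unfolding expected_rounds_eq_expect
        using * K(1) by (intro stream_instance.expect_batch_sieve_streaming_le[OF inst refl] K(2)[OF inst(1)]) auto
    qed
  qed
qed

end
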